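(* For every $n\ge 0$, the map $\overline{I}:\mathbf{Q}\mathbf{D}\to\overline{\mathcal{A}}$ composed with the projection $\overline{\mathcal{A}}\cong\prod_{k\ge 0}V_k\to V_n$ is a finite type invariant of doodles in $S^2$ of order at most $2n$.
   Context: **Doodles.** $S^1$ and $S^2$ are oriented. A doodle is an immersion $S^1\to S^2$ whose only self-intersections (called crossings) are finitely many transversal double points. Doodles are taken up to orientation-preserving reparametrization of $S^1$ and isotopy of $S^2$. Two doodles are equivalent if they are related by isotopies of $S^2$ and the following two moves and their inverses: $R_1$ removes an empty monogon (a small kink, i.e. one crossing); $R_2$ removes an empty bigon formed by two branches crossing each other at two consecutive points (two crossings). No passing through triple points is allowed. An invariant of doodles is a function of doodles that depends only on the equivalence class. **Arrow diagrams.** A chord diagram is an oriented circle (the skeleton) with finitely many chords with pairwise distinct endpoints, up to orientation-preserving diffeomorphism of the circle. An arrow diagram is a chord diagram with directed chords. The arrow diagram of a doodle has one chord for each crossing, connecting its two preimages in $S^1$; the chord is directed from the first branch to the second branch, where the branches are ordered so that the tangent vectors to the first and second branches form a positive basis of the tangent space of $S^2$. A doodle is determined up to isotopy by its arrow diagram, and doodles are identified with their arrow diagrams. A chord is isolated if its two endpoints are adjacent on the skeleton (one of the two arcs between them contains no other chord endpoints). Two chords are adjacent if their endpoints can be named $a,b$ and $a',b'$ respectively so that $a,a'$ are adjacent on the skeleton and $b,b'$ are adjacent on the skeleton. Two adjacent arrows are oppositely directed if one goes from $a$ to $b$ and the other from $b'$ to $a'$. **The spaces and maps.** $\mathbf{D}$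 is the set of all arrow diagrams (whether or not they come from doodles), and $\mathbf{Q}\mathbf{D}$ is the vector space over $\mathbf{Q}$ (the rationals) with basis $\mathbf{D}$. The linear map $I_{\mathbf{D}}:\mathbf{Q}\mathbf{D}\to\mathbf{Q}\mathbf{D}$ sends a diagram $D$ to the sum, over all subsets of the set of chords of $D$, of the diagram obtained by deleting that subset. $\mathcal{A}$ is the quotient of $\mathbf{Q}\mathbf{D}$ by the relations: (1) $D=0$ if $D$ has an isolated chord; (2) $D+(D\setminus e)+(D\setminus e')=0$ whenever $e,e'$ are adjacent, oppositely directed chords of $D$. $I:\mathbf{Q}\mathbf{D}\to\mathcal{A}$ is $I_{\mathbf{D}}$ followed by the quotient map. For $n\ge 0$, $\mathcal{A}_n$ is the quotient of $\mathcal{A}$ by the span of all diagrams with more than $n$ chords (and $\mathcal{A}_{-1}=0$), and $I_n:\mathbf{Q}\mathbf{D}\to\mathcal{A}_n$ is $I$ followed by the quotient map. There are natural projections $\mathcal{A}_{n}\to\mathcal{A}_{n-1}$ annihilating the diagrams with $n$ chords. $\overline{\mathcal{A}}$ is the inverse limit of the $\mathcal{A}_n$ and $\overline{I}:\mathbf{Q}\mathbf{D}\to\overline{\mathcal{A}}$ is the inverse limit of the $I_n$. $V_n$ is the kernel of the projection $\mathcal{A}_n\to\mathcal{A}_{n-1}$ (the span in $\mathcal{A}_n$ of the diagrams with exactly $n$ chords). Fixing a linear splitting $\mathcal{A}_n\cong\mathcal{A}_{n-1}\oplus V_n$ for each $n$ gives an isomorphism $\overline{\mathcal{A}}\cong\prod_{k\ge0}V_k$,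 whose $n$-th coordinate $\overline{\mathcal{A}}\to V_n$ is the composition $\overline{\mathcal{A}}\to\mathcal{A}_n\to V_n$. **Finite type invariants.** A singular doodle is an immersed curve $S^1\to S^2$ with finitely many self-intersection points, such that the tangent lines to the branches at each self-intersection point are all distinct, together with a linear order of the branches at each self-intersection point. A singular point is a self-intersection point where three or more branches meet; its complexity is the number of branches meeting there minus 1. The complexity of a singular doodle is the sum of the complexities of its singular points. For a singular point $x$ of a singular doodle $D$, let $v$ be the tangent vector at $x$ to the last branch through $x$, and $v_\perp$ the vector obtained from $v$ by rotating by $\pi/2$ in the positive direction. Let $D'$, $D''$ be obtained by moving the last branch slightly off $x$ in the directions $v_\perp$ and $-v_\perp$ respectively (the remaining branches at $x$ keep their order). The one-step resolution of $D$ at $x$ is the formal difference $D'-D''$. Iterating one-step resolutions until no singular points remain gives a linear combination of doodles, the complete resolution of $D$. Doodle invariants are extended linearly to linear combinations of doodles. An invariant is of order (at most) $m$, and is then called of finite type, if it vanishes on the complete resolution of every singular doodle of complexity greater than $m$. *)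

theory Defs
  imports "HOL-Analysis.Analysis" "HOL-Library.Poly_Mapping" "HOL-Library.Set_Algebras"
begin

section \<open>Smooth maps\<close>

primrec ck_on :: "nat \<Rightarrow> 'a::real_normed_vector set \<Rightarrow> ('a \<Rightarrow> 'b::real_normed_vector) \<Rightarrow> bool" where
  "ck_on 0 S f \<longleftrightarrow> continuous_on S f"
| "ck_on (Suc k) S f \<longleftrightarrow>
     (\<exists>f'. (\<forall>x\<in>S. (f has_derivative f' x) (at x)) \<and> (\<forall>v. ck_on k S (\<lambda>x. f' x v)))"

text \<open>On a set that is not open, smoothness means having a smooth extension to an open
  neighbourhood. It is used only for finite-dimensional domains, where \<^const>\<open>ck_on\<close> is the
  usual notion of being \<open>k\<close> times continuously differentiable on an open set.\<close>

definition smooth_on :: "'a::real_normed_vector set \<Rightarrow> ('a \<Rightarrow> 'b::real_normed_vector) \<Rightarrow> bool" where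
  "smooth_on S f \<longleftrightarrow>
     (\<exists>W g. open W \<and> S \<subseteq> W \<and> (\<forall>k. ck_on k W g) \<and> (\<forall>x\<in>S. g x = f x))"

text \<open>The circle is \<open>\<real>/\<int>\<close>, oriented as \<open>\<real>\<close>. Its points are represented by the numbers in
  \<open>{0..<1}\<close>, maps out of it by 1-periodic functions on \<open>\<real>\<close>, and its orientation-preserving
  diffeomorphisms by their lifts to \<open>\<real>\<close>.\<close>

definition circle_diffeo :: "(real \<Rightarrow> real) \<Rightarrow> bool" where
  "circle_diffeo \<phi> \<longleftrightarrow> bij \<phi> \<and> strict_mono \<phi> \<and> smooth_on UNIV \<phi> \<and> smooth_on UNIV (inv \<phi>)
     \<and> (\<forall>t. \<phi> (t + 1) = \<phi> t + 1)"

definition circle_map :: "(real \<Rightarrow> real) \<Rightarrow> real \<Rightarrow> real" where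
  "circle_map \<phi> t = frac (\<phi> t)"

lemma ck_on_Suc_imp: "ck_on (Suc k) S f \<Longrightarrow> ck_on k S f"
proof (induction k arbitrary: f)
  case 0
  then obtain f' where "\<And>x. x \<in> S \<Longrightarrow> (f has_derivative f' x) (at x)" by auto
  then have "continuous_on S f"
    by (intro has_derivative_continuous_on) (rule has_derivative_at_withinI)
  then show ?case by simp
next
  case (Suc k)
  then obtain f' where "\<forall>x\<in>S. (f has_derivative f' x) (at x)" "\<forall>v. ck_on (Suc k) S (\<lambda>x. f' x v)"
    by (metis ck_on.simps(2))
  with Suc.IH show ?case by (auto simp del: ck_on.simps simp: ck_on.simps(2)[of k])
qed

lemma ck_on_const: "ck_on k S (\<lambda>x. c)"
proof (induction k arbitrary: c)
  case (Suc k)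
  then show ?case by (auto intro!: exI[of _ "\<lambda>x v. 0"])
qed auto

lemma ck_on_id: "ck_on k S (\<lambda>x. x)"
  by (cases k) (auto intro!: exI[of _ "\<lambda>x v. v"] ck_on_const)

lemma ck_on_add:
  "ck_on k S f \<Longrightarrow> ck_on k S g \<Longrightarrow> ck_on k S (\<lambda>x. f x + g x)"
proof (induction k arbitrary: f g)
  case (Suc k)
  from Suc.prems obtain f' g' where
    f: "\<forall>x\<in>S. (f has_derivative f' x) (at x)" "\<forall>v. ck_on k S (\<lambda>x. f' x v)" and
    g: "\<forall>x\<in>S. (g has_derivative g' x) (at x)" "\<forall>v. ck_on k S (\<lambda>x. g' x v)"
    by auto
  show ?case
    using f g Suc.IH
    by (auto intro!: exI[of _ "\<lambda>x v. f' x v + g' x v"] has_derivative_add)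
qed (auto intro: continuous_intros)

lemma ck_on_mult:
  fixes f g :: "'a::real_normed_vector \<Rightarrow> real"
  shows "ck_on k S f \<Longrightarrow> ck_on k S g \<Longrightarrow> ck_on k S (\<lambda>x. f x * g x)"
proof (induction k arbitrary: f g)
  case (Suc k)
  from Suc.prems obtain f' g' where
    f: "\<forall>x\<in>S. (f has_derivative f' x) (at x)" "\<forall>v. ck_on k S (\<lambda>x. f' x v)" and
    g: "\<forall>x\<in>S. (g has_derivative g' x) (at x)" "\<forall>v. ck_on k S (\<lambda>x. g' x v)"
    by auto
  have "ck_on k S f" "ck_on k S g" using Suc.prems by (auto simp del: ck_on.simps dest: ck_on_Suc_imp)
  then have "ck_on k S (\<lambda>x. f x * g' x v + f' x v * g x)" for v
    using f g Suc.IH by (intro ck_on_add) auto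
  then show ?case
    using f g
    by (auto intro!: exI[of _ "\<lambda>x v. f x * g' x v + f' x v * g x"] has_derivative_mult)
qed (auto intro: continuous_intros)

lemma ck_on_compose:
  fixes f g :: "real \<Rightarrow> real"
  shows "ck_on k UNIV f \<Longrightarrow> ck_on k UNIV g \<Longrightarrow> ck_on k UNIV (\<lambda>x. g (f x))"
proof (induction k arbitrary: f g)
  case 0
  then show ?case by (auto intro: continuous_on_compose2)
next
  case (Suc k)
  from Suc.prems obtain f' g' where
    f: "\<forall>x. (f has_derivative f' x) (at x)" "\<forall>v. ck_on k UNIV (\<lambda>x. f' x v)" and
    g: "\<forall>x. (g has_derivative g' x) (at x)" "\<forall>v. ck_on k UNIV (\<lambda>x. g' x v)"
    by auto
  have fk: "ck_on k UNIV f" using Suc.prems(1) by (rule ck_on_Suc_imp)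
  have lin: "g' y v = v * g' y 1" for y v
  proof -
    have "linear (g' y)" using g(1) has_derivative_linear by blast
    then show ?thesis using linear_scale[of "g' y" v 1] by simp
  qed
  have "ck_on k UNIV (\<lambda>x. f' x v * g' (f x) 1)" for v
    using f(2) Suc.IH[OF fk, of "\<lambda>y. g' y 1"] g(2) by (intro ck_on_mult) auto
  then have "ck_on k UNIV (\<lambda>x. g' (f x) (f' x v))" for v
    by (simp add: lin[of _ "f' _ v"])
  moreover have "((\<lambda>x. g (f x)) has_derivative (\<lambda>v. g' (f x) (f' x v))) (at x)" for x
    using f(1) g(1) has_derivative_compose by blast
  ultimately show ?case
    by (auto intro!: exI[of _ "\<lambda>x v. g' (f x) (f' x v)"])
qed

lemma smooth_on_UNIV_iff: "smooth_on UNIV f \<longleftrightarrow> (\<forall>k. ck_on k UNIV f)"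
proof
  assume "smooth_on UNIV f"
  then obtain g where "\<forall>k. ck_on k UNIV g" "\<forall>x. g x = f x"
    by (auto simp: smooth_on_def top.extremum_unique)
  then show "\<forall>k. ck_on k UNIV f" by (metis ext)
qed (auto simp: smooth_on_def)

lemma circle_diffeo_id: "circle_diffeo (\<lambda>t. t)"
proof -
  have "inv (\<lambda>t::real. t) = (\<lambda>t. t)" using inv_id by (simp add: id_def)
  moreover have "bij (\<lambda>t::real. t)" using bij_id by (simp add: id_def)
  ultimately show ?thesis
    by (auto simp: circle_diffeo_def smooth_on_UNIV_iff ck_on_id strict_mono_def)
qed

lemma circle_diffeo_inv:
  assumes "circle_diffeo \<phi>" shows "circle_diffeo (inv \<phi>)"
proof -
  have b: "bij \<phi>" and m: "strict_mono \<phi>" and p: "\<And>t. \<phi> (t + 1) = \<phi> t + 1"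
    using assms by (auto simp: circle_diffeo_def)
  have s: "\<phi> (inv \<phi> t) = t" for t using b by (simp add: bij_is_surj surj_f_inv_f)
  have "strict_mono (inv \<phi>)"
    by (rule strict_monoI) (metis m s strict_mono_less)
  moreover have "inv \<phi> (t + 1) = inv \<phi> t + 1" for t
    by (metis b bij_is_inj inv_f_f p s)
  moreover have "inv (inv \<phi>) = \<phi>" using b by (simp add: inv_inv_eq)
  ultimately show ?thesis
    using assms by (simp add: circle_diffeo_def bij_imp_bij_inv)
qed

lemma circle_diffeo_compose:
  assumes "circle_diffeo \<phi>" "circle_diffeo \<psi>" shows "circle_diffeo (\<psi> \<circ> \<phi>)"
proof -
  have "inv (\<psi> \<circ> \<phi>) = inv \<phi> \<circ> inv \<psi>"
    using assms by (simp add: circle_diffeo_def o_inv_distrib)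
  moreover have "smooth_on UNIV (\<psi> \<circ> \<phi>)" "smooth_on UNIV (inv \<phi> \<circ> inv \<psi>)"
    using assms by (auto simp: circle_diffeo_def smooth_on_UNIV_iff comp_def intro: ck_on_compose)
  ultimately show ?thesis
    using assms by (auto simp: circle_diffeo_def bij_comp strict_mono_def)
qed

lemma circle_diffeo_add_int:
  assumes "circle_diffeo \<phi>" shows "\<phi> (t + of_int k) = \<phi> t + of_int k"
proof (induction k rule: int_induct[of _ 0])
  case (step1 i)
  have "\<phi> (t + of_int i + 1) = \<phi> (t + of_int i) + 1"
    using assms by (simp add: circle_diffeo_def)
  with step1 show ?case by (simp add: add.assoc)
next
  case (step2 i)
  have "\<phi> (t + of_int (i - 1) + 1) = \<phi> (t + of_int (i - 1)) + 1"
    using assms unfolding circle_diffeo_def by blast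
  with step2 show ?case by (simp add: algebra_simps)
qed simp

lemma circle_map_compose:
  assumes "circle_diffeo \<psi>"
  shows "circle_map \<psi> (circle_map \<phi> t) = circle_map (\<psi> \<circ> \<phi>) t"
proof -
  have "\<psi> (frac (\<phi> t)) = \<psi> (\<phi> t) + of_int (- \<lfloor>\<phi> t\<rfloor>)"
    using circle_diffeo_add_int[OF assms, of "\<phi> t" "- \<lfloor>\<phi> t\<rfloor>"] by (simp add: frac_def)
  then have "frac (\<psi> (frac (\<phi> t))) = frac (\<psi> (\<phi> t))"
    by (simp add: frac_def)
  then show ?thesis by (simp add: circle_map_def)
qed

lemma circle_map_id: "t \<in> {0..<1} \<Longrightarrow> circle_map (\<lambda>t. t) t = t"
  by (simp add: circle_map_def frac_eq)

lemma circle_map_inv: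
  assumes "circle_diffeo \<phi>" "t \<in> {0..<1}"
  shows "circle_map (inv \<phi>) (circle_map \<phi> t) = t"
proof -
  have "inv \<phi> \<circ> \<phi> = (\<lambda>t. t)"
    using assms(1) by (auto simp: circle_diffeo_def bij_is_inj)
  then show ?thesis
    using circle_map_compose[OF circle_diffeo_inv[OF assms(1)], of \<phi> t] assms(2)
    by (simp add: circle_map_id)
qed


section \<open>Arrow diagrams\<close>

text \<open>An arrow is a pair (tail, head) of points of the circle.\<close>

definition endpoints :: "(real \<times> real) set \<Rightarrow> real set" where
  "endpoints A = fst ` A \<union> snd ` A"

definition is_arrow_diagram :: "(real \<times> real) set \<Rightarrow> bool" where
  "is_arrow_diagram A \<longleftrightarrow> finite A \<and> endpoints A \<subseteq> {0..<1}
     \<and> (\<forall>(a, b)\<in>A. a \<noteq> b)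
     \<and> (\<forall>(a, b)\<in>A. \<forall>(c, d)\<in>A. (a, b) \<noteq> (c, d) \<longrightarrow> {a, b} \<inter> {c, d} = {})"

definition arrow_equiv :: "(real \<times> real) set \<Rightarrow> (real \<times> real) set \<Rightarrow> bool" where
  "arrow_equiv A B \<longleftrightarrow> is_arrow_diagram A \<and> is_arrow_diagram B
     \<and> (\<exists>\<phi>. circle_diffeo \<phi> \<and> B = map_prod (circle_map \<phi>) (circle_map \<phi>) ` A)"

lemma map_prod_image_cong:
  assumes "is_arrow_diagram A" "\<And>t. t \<in> {0..<1} \<Longrightarrow> f t = g t"
  shows "map_prod f f ` A = map_prod g g ` A"
proof (rule image_cong[OF refl])
  fix e assume "e \<in> A"
  then have "fst e \<in> {0..<1}" "snd e \<in> {0..<1}"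
    using assms(1) by (auto simp: is_arrow_diagram_def endpoints_def subset_eq)
  then show "map_prod f f e = map_prod g g e" using assms(2) by (cases e) auto
qed

lemma map_prod_image_id:
  assumes "is_arrow_diagram A" "\<And>t. t \<in> {0..<1} \<Longrightarrow> f t = t"
  shows "map_prod f f ` A = A"
  using map_prod_image_cong[OF assms(1), of f id] assms(2) by (simp add: map_prod.id)

lemma arrow_equiv_part_equivp: "part_equivp arrow_equiv"
proof (rule part_equivpI)
  have "is_arrow_diagram {}" by (simp add: is_arrow_diagram_def endpoints_def)
  then have "arrow_equiv {} {}"
    using circle_diffeo_id by (auto simp: arrow_equiv_def)
  then show "\<exists>x. arrow_equiv x x" by blast
next
  show "symp arrow_equiv"
  proof (rule sympI)
    fix A B assume "arrow_equiv A B"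
    then obtain \<phi> where v: "is_arrow_diagram A" "is_arrow_diagram B" and \<phi>: "circle_diffeo \<phi>"
      and B: "B = map_prod (circle_map \<phi>) (circle_map \<phi>) ` A"
      by (auto simp: arrow_equiv_def)
    have "map_prod (circle_map (inv \<phi>)) (circle_map (inv \<phi>)) ` B = A"
      using map_prod_image_id[OF v(1), of "circle_map (inv \<phi>) \<circ> circle_map \<phi>"]
        circle_map_inv[OF \<phi>]
      by (auto simp: B image_image map_prod.compositionality)
    then show "arrow_equiv B A"
      using v circle_diffeo_inv[OF \<phi>] by (auto simp: arrow_equiv_def)
  qed
next
  show "transp arrow_equiv"
  proof (rule transpI)
    fix A B C assume "arrow_equiv A B" "arrow_equiv B C"
    then obtain \<phi> \<psi> where v: "is_arrow_diagram A" "is_arrow_diagram C"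
      and \<phi>: "circle_diffeo \<phi>" "B = map_prod (circle_map \<phi>) (circle_map \<phi>) ` A"
      and \<psi>: "circle_diffeo \<psi>" "C = map_prod (circle_map \<psi>) (circle_map \<psi>) ` B"
      by (auto simp: arrow_equiv_def)
    have "circle_map \<psi> \<circ> circle_map \<phi> = circle_map (\<psi> \<circ> \<phi>)"
      using circle_map_compose[OF \<psi>(1)] by auto
    then have "C = map_prod (circle_map (\<psi> \<circ> \<phi>)) (circle_map (\<psi> \<circ> \<phi>)) ` A"
      by (auto simp: \<phi>(2) \<psi>(2) image_image map_prod.compositionality)
    then show "arrow_equiv A C"
      using v circle_diffeo_compose[OF \<phi>(1) \<psi>(1)] by (auto simp: arrow_equiv_def)
  qed
qed

quotient_type arrow_diagram = "(real \<times> real) set" / partial: arrow_equiv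
  by (rule arrow_equiv_part_equivp)

lemma is_arrow_diagram_subset:
  assumes A: "is_arrow_diagram A" and B: "B \<subseteq> A"
  shows "is_arrow_diagram B"
proof -
  have 1: "finite B"
    using A B by (simp add: is_arrow_diagram_def finite_subset)
  have "endpoints B \<subseteq> endpoints A"
    unfolding endpoints_def by (intro Un_mono image_mono B)
  then have 2: "endpoints B \<subseteq> {0..<1}"
    using A unfolding is_arrow_diagram_def by (meson order.trans)
  have "\<forall>e\<in>A. case e of (a, b) \<Rightarrow> a \<noteq> b"
    using A unfolding is_arrow_diagram_def by (elim conjE)
  then have 3: "\<forall>e\<in>B. case e of (a, b) \<Rightarrow> a \<noteq> b"
    by (intro ballI) (drule (1) bspec[OF _ subsetD[OF B]])
  have "\<forall>e\<in>A. \<forall>e'\<in>A. case e of (a, b) \<Rightarrow> case e' of (c, d) \<Rightarrow>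
      (a, b) \<noteq> (c, d) \<longrightarrow> {a, b} \<inter> {c, d} = {}"
    using A unfolding is_arrow_diagram_def case_prod_beta by (elim conjE)
  then have 4: "\<forall>e\<in>B. \<forall>e'\<in>B. case e of (a, b) \<Rightarrow> case e' of (c, d) \<Rightarrow>
      (a, b) \<noteq> (c, d) \<longrightarrow> {a, b} \<inter> {c, d} = {}"
    by (intro ballI) (drule (1) bspec[OF _ subsetD[OF B]])+
  show ?thesis
    using 1 2 3 4 unfolding is_arrow_diagram_def case_prod_beta by (intro conjI)
qed

lemma arrow_equiv_inj:
  assumes "is_arrow_diagram A" "circle_diffeo \<phi>"
  shows "inj_on (map_prod (circle_map \<phi>) (circle_map \<phi>)) A"
proof (rule inj_onI)
  fix x y assume "x \<in> A" "y \<in> A"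
    and eq: "map_prod (circle_map \<phi>) (circle_map \<phi>) x = map_prod (circle_map \<phi>) (circle_map \<phi>) y"
  then have "fst x \<in> {0..<1}" "snd x \<in> {0..<1}" "fst y \<in> {0..<1}" "snd y \<in> {0..<1}"
    using assms(1) by (auto simp: is_arrow_diagram_def endpoints_def subset_eq)
  with eq circle_map_inv[OF assms(2)] show "x = y"
    by (cases x; cases y) (metis fst_conv snd_conv map_prod_simp)
qed

lift_definition num_arrows :: "arrow_diagram \<Rightarrow> nat" is card
  by (auto simp: arrow_equiv_def card_image arrow_equiv_inj)


section \<open>The algebra of arrow diagrams\<close>

type_synonym qd = "arrow_diagram \<Rightarrow>\<^sub>0 rat"

abbreviation diag :: "arrow_diagram \<Rightarrow> qd" where
  "diag D \<equiv> Poly_Mapping.single D 1"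

definition qd_scale :: "rat \<Rightarrow> qd \<Rightarrow> qd" where
  "qd_scale c = Poly_Mapping.map ((*) c)"

lemma lookup_qd_scale: "Poly_Mapping.lookup (qd_scale c x) D = c * Poly_Mapping.lookup x D"
  by (simp add: qd_scale_def Poly_Mapping.map.rep_eq when_def)

interpretation QD: vector_space qd_scale
  by standard (auto intro!: poly_mapping_eqI simp: lookup_qd_scale lookup_add algebra_simps)

text \<open>The sum of all the diagrams obtained by deleting a set of arrows.\<close>

lift_definition subdiagram_sum :: "arrow_diagram \<Rightarrow> qd" is
  "\<lambda>A. \<Sum>S\<in>Pow A. diag (abs_arrow_diagram (A - S))"
proof -
  fix A B assume "arrow_equiv A B"
  then obtain \<phi> where v: "is_arrow_diagram A" and \<phi>: "circle_diffeo \<phi>"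
    and B: "B = map_prod (circle_map \<phi>) (circle_map \<phi>) ` A" and vB: "is_arrow_diagram B"
    by (auto simp: arrow_equiv_def)
  define h where "h = map_prod (circle_map \<phi>) (circle_map \<phi>)"
  have inj: "inj_on h A" using arrow_equiv_inj[OF v \<phi>] by (simp add: h_def)
  have Bh: "B = h ` A" using B by (simp add: h_def)
  have "(\<Sum>S\<in>Pow B. diag (abs_arrow_diagram (B - S)))
      = (\<Sum>S\<in>(`) h ` Pow A. diag (abs_arrow_diagram (B - S)))"
    by (simp add: Bh image_Pow_surj)
  also have "\<dots> = (\<Sum>S\<in>Pow A. diag (abs_arrow_diagram (B - h ` S)))"
    by (subst sum.reindex) (auto simp: inj_on_image_Pow[OF inj])
  also have "\<dots> = (\<Sum>S\<in>Pow A. diag (abs_arrow_diagram (A - S)))"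
  proof (rule sum.cong[OF refl])
    fix S assume S: "S \<in> Pow A"
    have "B - h ` S = h ` (A - S)"
      using inj S by (simp add: Bh inj_on_image_set_diff)
    then have "arrow_equiv (A - S) (B - h ` S)"
      using is_arrow_diagram_subset[OF v, of "A - S"] is_arrow_diagram_subset[OF vB, of "B - h ` S"] \<phi>
      by (auto simp: arrow_equiv_def h_def)
    then show "diag (abs_arrow_diagram (B - h ` S)) = diag (abs_arrow_diagram (A - S))"
      by (metis Quotient3_arrow_diagram Quotient3_rel)
  qed
  finally show "(\<Sum>S\<in>Pow A. diag (abs_arrow_diagram (A - S)))
      = (\<Sum>S\<in>Pow B. diag (abs_arrow_diagram (B - S)))" ..
qed

definition I_D :: "qd \<Rightarrow> qd" where
  "I_D x = (\<Sum>D\<in>Poly_Mapping.keys x. qd_scale (Poly_Mapping.lookup x D) (subdiagram_sum D))"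

text \<open>The open arc of the circle from \<open>a\<close> to \<open>b\<close> in the positive direction.\<close>

definition circle_arc :: "real \<Rightarrow> real \<Rightarrow> real set" where
  "circle_arc a b = (if a < b then {a<..<b} else {a<..<1} \<union> {0..<b})"

definition adjacent_in :: "(real \<times> real) set \<Rightarrow> real \<Rightarrow> real \<Rightarrow> bool" where
  "adjacent_in A a b \<longleftrightarrow> a \<in> endpoints A \<and> b \<in> endpoints A \<and> a \<noteq> b
     \<and> (circle_arc a b \<inter> endpoints A = {} \<or> circle_arc b a \<inter> endpoints A = {})"

definition isolated_arrow :: "(real \<times> real) set \<Rightarrow> real \<times> real \<Rightarrow> bool" where
  "isolated_arrow A e \<longleftrightarrow> e \<in> A \<and> adjacent_in A (fst e) (snd e)"

definition adjacent_opposite_in :: "(real \<times> real) set \<Rightarrow> real \<times> real \<Rightarrow> real \<times> real \<Rightarrow> bool" where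
  "adjacent_opposite_in A e e' \<longleftrightarrow> e \<in> A \<and> e' \<in> A \<and> e \<noteq> e' \<and>
     (\<exists>a b a' b'. adjacent_in A a a' \<and> adjacent_in A b b' \<and>
        (e = (a, b) \<and> e' = (b', a') \<or> e = (b, a) \<and> e' = (a', b')))"

definition relations :: "qd set" where
  "relations =
     {diag (abs_arrow_diagram A) | A e. is_arrow_diagram A \<and> isolated_arrow A e} \<union>
     {diag (abs_arrow_diagram A) + diag (abs_arrow_diagram (A - {e}))
        + diag (abs_arrow_diagram (A - {e'})) | A e e'.
        is_arrow_diagram A \<and> adjacent_opposite_in A e e'}"

definition alg_equiv :: "qd \<Rightarrow> qd \<Rightarrow> bool" where
  "alg_equiv x y \<longleftrightarrow> x - y \<in> QD.span relations"

lemma alg_equiv_equivp: "equivp alg_equiv"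
proof (rule equivpI)
  show "reflp alg_equiv" by (simp add: reflp_def alg_equiv_def QD.span_zero)
  show "symp alg_equiv"
  proof (rule sympI)
    fix x y assume "alg_equiv x y"
    then have "- (x - y) \<in> QD.span relations" unfolding alg_equiv_def by (rule QD.span_neg)
    then show "alg_equiv y x" by (simp add: alg_equiv_def)
  qed
  show "transp alg_equiv"
  proof (rule transpI)
    fix x y z assume "alg_equiv x y" "alg_equiv y z"
    then have "(x - y) + (y - z) \<in> QD.span relations"
      unfolding alg_equiv_def by (rule QD.span_add)
    then show "alg_equiv x z" by (simp add: alg_equiv_def)
  qed
qed

quotient_type alg = qd / alg_equiv
  by (rule alg_equiv_equivp)

instantiation alg :: ab_group_add
begin

lift_definition zero_alg :: alg is 0 .

lift_definition plus_alg :: "alg \<Rightarrow> alg \<Rightarrow> alg" is "(+)"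
proof -
  fix a b c d assume "alg_equiv a b" "alg_equiv c d"
  then have "(a - b) + (c - d) \<in> QD.span relations"
    unfolding alg_equiv_def by (rule QD.span_add)
  then show "alg_equiv (a + c) (b + d)" by (simp add: alg_equiv_def algebra_simps)
qed

lift_definition uminus_alg :: "alg \<Rightarrow> alg" is uminus
proof -
  fix a b assume "alg_equiv a b"
  then have "- (a - b) \<in> QD.span relations" unfolding alg_equiv_def by (rule QD.span_neg)
  then show "alg_equiv (- a) (- b)" by (simp add: alg_equiv_def)
qed

definition minus_alg :: "alg \<Rightarrow> alg \<Rightarrow> alg" where "minus_alg a b = a + - b"

instance
proof
  fix a b c :: alg
  show "a + b + c = a + (b + c)"
    by transfer (simp add: alg_equiv_def QD.span_zero algebra_simps)
  show "a + b = b + a"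
    by transfer (simp add: alg_equiv_def QD.span_zero algebra_simps)
  show "0 + a = a"
    by transfer (simp add: alg_equiv_def QD.span_zero)
  show "- a + a = 0"
    by transfer (simp add: alg_equiv_def QD.span_zero)
  show "a - b = a + - b"
    by (rule minus_alg_def)
qed

end

lift_definition alg_scale :: "rat \<Rightarrow> alg \<Rightarrow> alg" is qd_scale
proof -
  fix c a b assume "alg_equiv a b"
  then have "qd_scale c (a - b) \<in> QD.span relations"
    unfolding alg_equiv_def by (rule QD.span_scale)
  then show "alg_equiv (qd_scale c a) (qd_scale c b)"
    by (simp add: alg_equiv_def QD.scale_right_diff_distrib)
qed

interpretation Alg: vector_space alg_scale
proof
  fix c d :: rat and a b :: alg
  show "alg_scale c (a + b) = alg_scale c a + alg_scale c b"
    by transfer (simp add: alg_equiv_def QD.span_zero QD.scale_right_distrib)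
  show "alg_scale (c + d) a = alg_scale c a + alg_scale d a"
    by transfer (simp add: alg_equiv_def QD.span_zero QD.scale_left_distrib)
  show "alg_scale c (alg_scale d a) = alg_scale (c * d) a"
    by transfer (simp add: alg_equiv_def QD.span_zero)
  show "alg_scale 1 a = a"
    by transfer (simp add: alg_equiv_def QD.span_zero)
qed

definition I_alg :: "qd \<Rightarrow> alg" where
  "I_alg x = abs_alg (I_D x)"


section \<open>Quotients, inverse limit and splittings\<close>

text \<open>The quotient of \<open>\<A>\<close> by a subspace \<open>U\<close> is the set of cosets of \<open>U\<close>. Its zero is \<open>U\<close>, its
  addition is addition of sets, and scalars act by \<open>coset_scale U\<close>, where adding \<open>U\<close> is needed
  only for the scalar \<open>0\<close>.\<close>

definition quot :: "alg set \<Rightarrow> alg set set" where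
  "quot U = range (\<lambda>a. a +o U)"

definition coset_scale :: "alg set \<Rightarrow> rat \<Rightarrow> alg set \<Rightarrow> alg set" where
  "coset_scale U c C = alg_scale c ` C + U"

definition quot_linear :: "alg set \<Rightarrow> alg set \<Rightarrow> (alg set \<Rightarrow> alg set) \<Rightarrow> bool" where
  "quot_linear U W f \<longleftrightarrow> (\<forall>a\<in>quot U. \<forall>b\<in>quot U. f (a + b) = f a + f b)
     \<and> (\<forall>c. \<forall>a\<in>quot U. f (coset_scale U c a) = coset_scale W c (f a))"

text \<open>\<open>filt k\<close> is the span of the diagrams with at least \<open>k\<close> arrows, so that
  \<open>\<A>\<^sub>n = quot (filt (Suc n))\<close> and \<open>\<A>\<^bsub>n-1\<^esub> = quot (filt n)\<close>. The latter is the zero space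
  for \<open>n = 0\<close>, since \<open>filt 0\<close> is everything.\<close>

definition filt :: "nat \<Rightarrow> alg set" where
  "filt k = Alg.span {abs_alg (diag D) | D. k \<le> num_arrows D}"

definition A_space :: "nat \<Rightarrow> alg set set" where
  "A_space n = quot (filt (Suc n))"

definition A_pred :: "nat \<Rightarrow> alg set set" where
  "A_pred n = quot (filt n)"

text \<open>The projection \<open>\<A>\<^sub>n \<rightarrow> \<A>\<^bsub>n-1\<^esub>\<close>.\<close>

definition proj :: "nat \<Rightarrow> alg set \<Rightarrow> alg set" where
  "proj n C = C + filt n"

definition V_space :: "nat \<Rightarrow> alg set set" where
  "V_space n = {C \<in> A_space n. proj n C = filt n}"

definition A_bar :: "(nat \<Rightarrow> alg set) set" where
  "A_bar = {a. \<forall>n. a n \<in> A_space n \<and> proj (Suc n) (a (Suc n)) = a n}"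

definition I_n :: "nat \<Rightarrow> qd \<Rightarrow> alg set" where
  "I_n n x = I_alg x +o filt (Suc n)"

definition I_bar :: "qd \<Rightarrow> nat \<Rightarrow> alg set" where
  "I_bar x = (\<lambda>n. I_n n x)"

text \<open>A splitting of \<open>V\<^sub>n \<rightarrow> \<A>\<^sub>n \<rightarrow> \<A>\<^bsub>n-1\<^esub>\<close> for each \<open>n\<close>: a linear isomorphism of
  \<open>\<A>\<^sub>n\<close> with \<open>\<A>\<^bsub>n-1\<^esub> \<oplus> V\<^sub>n\<close> that is compatible with the projection to \<open>\<A>\<^bsub>n-1\<^esub>\<close> and the
  inclusion of \<open>V\<^sub>n\<close>.\<close>

definition linear_splitting :: "(nat \<Rightarrow> alg set \<Rightarrow> alg set \<times> alg set) \<Rightarrow> bool" where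
  "linear_splitting \<sigma> \<longleftrightarrow> (\<forall>n.
     bij_betw (\<sigma> n) (A_space n) (A_pred n \<times> V_space n)
     \<and> quot_linear (filt (Suc n)) (filt n) (\<lambda>C. fst (\<sigma> n C))
     \<and> quot_linear (filt (Suc n)) (filt (Suc n)) (\<lambda>C. snd (\<sigma> n C))
     \<and> (\<forall>C\<in>A_space n. fst (\<sigma> n C) = proj n C)
     \<and> (\<forall>C\<in>V_space n. \<sigma> n C = (filt n, C)))"

definition split_iso ::
  "(nat \<Rightarrow> alg set \<Rightarrow> alg set \<times> alg set) \<Rightarrow> (nat \<Rightarrow> alg set) \<Rightarrow> nat \<Rightarrow> alg set" where
  "split_iso \<sigma> a = (\<lambda>k. snd (\<sigma> k (a k)))"

lemma subspace_filt: "Alg.subspace (filt k)"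
  by (simp add: filt_def)

lemma filt_mono: "k \<le> l \<Longrightarrow> filt l \<subseteq> filt k"
  unfolding filt_def by (rule Alg.span_mono) auto

lemma coset_add_filt: "k \<le> l \<Longrightarrow> (a +o filt l) + filt k = a +o filt k"
proof -
  assume "k \<le> l"
  have "filt l + filt k = filt k"
  proof
    show "filt l + filt k \<subseteq> filt k"
      using filt_mono[OF \<open>k \<le> l\<close>] Alg.subspace_add[OF subspace_filt, of _ k]
      by (auto simp: set_plus_def)
    show "filt k \<subseteq> filt l + filt k"
      using Alg.subspace_0[OF subspace_filt, of l] set_zero_plus2 by blast
  qed
  then show ?thesis by (simp add: set_plus_rearrange3)
qed

lemma I_bar_in_A_bar: "I_bar x \<in> A_bar"
  by (auto simp: A_bar_def I_bar_def I_n_def A_space_def quot_def proj_def coset_add_filt)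


section \<open>Doodles\<close>

type_synonym curve = "real \<Rightarrow> real^3"

abbreviation S2 :: "(real^3) set" where
  "S2 \<equiv> sphere 0 1"

abbreviation tangent :: "curve \<Rightarrow> real \<Rightarrow> real^3" where
  "tangent \<gamma> t \<equiv> vector_derivative \<gamma> (at t)"

definition immersed_curve :: "curve \<Rightarrow> bool" where
  "immersed_curve \<gamma> \<longleftrightarrow> smooth_on UNIV \<gamma> \<and> (\<forall>t. \<gamma> t \<in> S2) \<and> (\<forall>t. \<gamma> (t + 1) = \<gamma> t)
     \<and> (\<forall>t. tangent \<gamma> t \<noteq> 0)"

definition branches :: "curve \<Rightarrow> real^3 \<Rightarrow> real set" where
  "branches \<gamma> x = {t \<in> {0..<1}. \<gamma> t = x}"

definition self_intersections :: "curve \<Rightarrow> (real^3) set" where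
  "self_intersections \<gamma> = {x. \<exists>s\<in>branches \<gamma> x. \<exists>t\<in>branches \<gamma> x. s \<noteq> t}"

definition distinct_tangent_lines :: "curve \<Rightarrow> real^3 \<Rightarrow> bool" where
  "distinct_tangent_lines \<gamma> x \<longleftrightarrow>
     (\<forall>s\<in>branches \<gamma> x. \<forall>t\<in>branches \<gamma> x. s \<noteq> t \<longrightarrow> \<not> collinear {0, tangent \<gamma> s, tangent \<gamma> t})"

definition doodle :: "curve \<Rightarrow> bool" where
  "doodle \<gamma> \<longleftrightarrow> immersed_curve \<gamma> \<and> finite (self_intersections \<gamma>)
     \<and> (\<forall>x\<in>self_intersections \<gamma>. card (branches \<gamma> x) = 2 \<and> distinct_tangent_lines \<gamma> x)"

text \<open>The sphere is oriented by its outward normal: vectors \<open>v, w\<close> tangent at \<open>x\<close> form a positive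
  basis iff \<open>det (x, v, w) > 0\<close>.\<close>

definition arrows :: "curve \<Rightarrow> (real \<times> real) set" where
  "arrows \<gamma> = {(s, t). s \<in> {0..<1} \<and> t \<in> {0..<1} \<and> s \<noteq> t \<and> \<gamma> s = \<gamma> t
     \<and> \<gamma> s \<bullet> cross3 (tangent \<gamma> s) (tangent \<gamma> t) > 0}"

definition diagram_of :: "curve \<Rightarrow> arrow_diagram" where
  "diagram_of \<gamma> = abs_arrow_diagram (arrows \<gamma>)"

definition sphere_isotopy :: "(real \<times> (real^3) \<Rightarrow> real^3) \<Rightarrow> bool" where
  "sphere_isotopy H \<longleftrightarrow> smooth_on ({0..1} \<times> S2) H \<and> (\<forall>x\<in>S2. H (0, x) = x)
     \<and> (\<forall>s\<in>{0..1}. bij_betw (\<lambda>x. H (s, x)) S2 S2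
          \<and> smooth_on S2 (inv_into S2 (\<lambda>x. H (s, x))))"

definition isotopic :: "curve \<Rightarrow> curve \<Rightarrow> bool" where
  "isotopic \<gamma> \<delta> \<longleftrightarrow> doodle \<gamma> \<and> doodle \<delta> \<and>
     (\<exists>H \<phi>. sphere_isotopy H \<and> circle_diffeo \<phi> \<and> (\<forall>t. \<delta> t = H (1, \<gamma> (\<phi> t))))"

definition square :: "(real \<times> real) set" where
  "square = {-1<..<1} \<times> {-1<..<1}"

text \<open>A smooth parametrization, of either orientation, of an open disc in the sphere. (Being
  injective, it is a homeomorphism onto its image by invariance of domain.)\<close>

definition sphere_chart :: "(real \<times> real \<Rightarrow> real^3) \<Rightarrow> bool" where
  "sphere_chart \<psi> \<longleftrightarrow> smooth_on square \<psi> \<and> \<psi> ` square \<subseteq> S2 \<and> inj_on \<psi> square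
     \<and> (\<forall>p\<in>square. inj (frechet_derivative \<psi> (at p)))"

text \<open>All translates by integers of a set of parameters.\<close>

definition periodic :: "real set \<Rightarrow> real set" where
  "periodic J = {t + of_int k | t k. t \<in> J}"

text \<open>\<open>R\<^sub>1\<close>: inside a disc that meets the curve in a single arc \<open>{a<..<b}\<close> crossing itself
  exactly once, that arc is replaced by one without crossings. The loop of the old arc bounds a
  monogon in the disc, which is empty as nothing else enters the disc.\<close>

definition R1_move :: "curve \<Rightarrow> curve \<Rightarrow> bool" where
  "R1_move \<gamma> \<delta> \<longleftrightarrow> doodle \<gamma> \<and> doodle \<delta> \<and>
     (\<exists>\<psi> a b a' b'. sphere_chart \<psi> \<and> a < a' \<and> a' < b' \<and> b' < b \<and> b \<le> a + 1
        \<and> {t. \<gamma> t \<in> \<psi> ` square} = periodic {a<..<b}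
        \<and> {t. \<delta> t \<in> \<psi> ` square} = periodic {a<..<b}
        \<and> (\<forall>t. t \<notin> periodic {a'..b'} \<longrightarrow> \<delta> t = \<gamma> t)
        \<and> card (self_intersections \<gamma> \<inter> \<psi> ` square) = 1
        \<and> self_intersections \<delta> \<inter> \<psi> ` square = {})"

text \<open>\<open>R\<^sub>2\<close>: in suitable coordinates on a disc, the curve consists there of two arcs, one along
  the first coordinate axis and the other along a graph, with coordinates \<open>(u, h u)\<close>, that crosses
  the axis twice. The part of the disc between the axis and the graph, from one zero of \<open>h\<close> to the
  other, is an empty bigon. The graph is replaced by that of a function \<open>k\<close> without zeros which
  agrees with \<open>h\<close> near the ends.\<close>

definition R2_move :: "curve \<Rightarrow> curve \<Rightarrow> bool" where
  "R2_move \<gamma> \<delta> \<longleftrightarrow> doodle \<gamma> \<and> doodle \<delta> \<and>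
     (\<exists>\<psi> a1 b1 a2 b2 u1 u2 h k c. sphere_chart \<psi>
        \<and> a1 < b1 \<and> b1 \<le> a2 \<and> a2 < b2 \<and> b2 \<le> a1 + 1
        \<and> {t. \<gamma> t \<in> \<psi> ` square} = periodic ({a1<..<b1} \<union> {a2<..<b2})
        \<and> (\<forall>t. t \<notin> periodic {a2<..<b2} \<longrightarrow> \<delta> t = \<gamma> t)
        \<and> smooth_on {a1<..<b1} u1 \<and> bij_betw u1 {a1<..<b1} {-1<..<1}
        \<and> smooth_on {a2<..<b2} u2 \<and> bij_betw u2 {a2<..<b2} {-1<..<1}
        \<and> smooth_on {-1<..<1} h \<and> h ` {-1<..<1} \<subseteq> {-1<..<1}
        \<and> smooth_on {-1<..<1} k \<and> k ` {-1<..<1} \<subseteq> {-1<..<1}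
        \<and> (\<forall>t\<in>{a1<..<b1}. \<gamma> t = \<psi> (u1 t, 0))
        \<and> (\<forall>t\<in>{a2<..<b2}. \<gamma> t = \<psi> (u2 t, h (u2 t)))
        \<and> (\<forall>t\<in>{a2<..<b2}. \<delta> t = \<psi> (u2 t, k (u2 t)))
        \<and> c < 1 \<and> (\<forall>u\<in>{-1<..<1}. c \<le> \<bar>u\<bar> \<longrightarrow> k u = h u)
        \<and> card {u \<in> {-1<..<1}. h u = 0} = 2
        \<and> (\<forall>u\<in>{-1<..<1}. k u \<noteq> 0))"

definition doodle_equiv :: "curve \<Rightarrow> curve \<Rightarrow> bool" where
  "doodle_equiv = equivclp (\<lambda>\<gamma> \<delta>. isotopic \<gamma> \<delta> \<or> R1_move \<gamma> \<delta> \<or> R2_move \<gamma> \<delta>)"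


section \<open>Singular doodles and finite type invariants\<close>

text \<open>The linear order of the branches at a self-intersection point \<open>x\<close> is given by a list
  \<open>ord x\<close>; the values of \<open>ord\<close> elsewhere are irrelevant.\<close>

definition singular_doodle :: "curve \<Rightarrow> (real^3 \<Rightarrow> real list) \<Rightarrow> bool" where
  "singular_doodle \<gamma> ord \<longleftrightarrow> immersed_curve \<gamma> \<and> finite (self_intersections \<gamma>)
     \<and> (\<forall>x\<in>self_intersections \<gamma>. distinct_tangent_lines \<gamma> x
          \<and> distinct (ord x) \<and> set (ord x) = branches \<gamma> x)"

definition singular_points :: "curve \<Rightarrow> (real^3) set" where
  "singular_points \<gamma> = {x \<in> self_intersections \<gamma>. card (branches \<gamma> x) \<ge> 3}"

definition complexity :: "curve \<Rightarrow> nat" where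
  "complexity \<gamma> = (\<Sum>x\<in>singular_points \<gamma>. card (branches \<gamma> x) - 1)"

text \<open>A smooth deformation \<open>F\<close> of \<open>\<gamma>\<close> that moves only a small arc around \<open>t\<^sub>0\<close>, containing no
  other preimage of a self-intersection point, with initial velocity at \<open>t\<^sub>0\<close> a positive multiple
  of \<open>v\<^sub>\<bottom> = x \<times> v\<close>, where \<open>x = \<gamma> t\<^sub>0\<close> and \<open>v\<close> is the tangent vector at \<open>t\<^sub>0\<close>. Thus the branch is
  moved in the direction \<open>v\<^sub>\<bottom>\<close> for small \<open>s > 0\<close>, and in the direction \<open>- v\<^sub>\<bottom>\<close> for small
  \<open>s < 0\<close>.\<close>

definition moves_branch :: "curve \<Rightarrow> real \<Rightarrow> (real \<Rightarrow> curve) \<Rightarrow> bool" where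
  "moves_branch \<gamma> t0 F \<longleftrightarrow> smooth_on UNIV (\<lambda>(s, t). F s t) \<and> F 0 = \<gamma>
     \<and> (\<forall>s t. F s t \<in> S2 \<and> F s (t + 1) = F s t)
     \<and> (\<exists>a b. a < t0 \<and> t0 < b \<and> b < a + 1
          \<and> (\<forall>t\<in>{a..b}. t \<noteq> t0 \<longrightarrow> \<gamma> t \<notin> self_intersections \<gamma>)
          \<and> (\<forall>s t. t \<notin> periodic {a<..<b} \<longrightarrow> F s t = \<gamma> t))
     \<and> (\<exists>c>0. ((\<lambda>s. F s t0) has_vector_derivative c *\<^sub>R cross3 (\<gamma> t0) (tangent \<gamma> t0)) (at 0))"

text \<open>The order that is left after moving the last branch off \<open>x\<close>. The order of the two branches at
  a newly created double point is arbitrary.\<close>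

definition keeps_order ::
  "curve \<Rightarrow> (real^3 \<Rightarrow> real list) \<Rightarrow> real^3 \<Rightarrow> (real^3 \<Rightarrow> real list) \<Rightarrow> bool" where
  "keeps_order \<gamma> ord x ord' \<longleftrightarrow> ord' x = butlast (ord x)
     \<and> (\<forall>y\<in>self_intersections \<gamma>. y \<noteq> x \<longrightarrow> ord' y = ord y)"

lemma eventually_ex_mono [mono]:
  "(\<And>s. P s \<longrightarrow> Q s) \<Longrightarrow> eventually P F \<longrightarrow> eventually Q F"
  by (auto elim: eventually_mono)

text \<open>\<open>complete_resolution \<gamma> ord L\<close>: \<open>L\<close> is the complete resolution of the singular doodle
  \<open>(\<gamma>, ord)\<close>, as a linear combination of (the arrow diagrams of) doodles. A one-step resolution is
  the difference \<open>F s - F (-s)\<close> for all sufficiently small \<open>s > 0\<close>.\<close>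

inductive complete_resolution :: "curve \<Rightarrow> (real^3 \<Rightarrow> real list) \<Rightarrow> qd \<Rightarrow> bool" where
  nonsingular: "\<lbrakk>singular_doodle \<gamma> ord; singular_points \<gamma> = {}\<rbrakk>
     \<Longrightarrow> complete_resolution \<gamma> ord (diag (diagram_of \<gamma>))"
| one_step: "\<lbrakk>singular_doodle \<gamma> ord; x \<in> singular_points \<gamma>; moves_branch \<gamma> (last (ord x)) F;
     \<forall>\<^sub>F s in at_right 0. \<exists>ord'. keeps_order \<gamma> ord x ord' \<and> complete_resolution (F s) ord' L1;
     \<forall>\<^sub>F s in at_left 0. \<exists>ord'. keeps_order \<gamma> ord x ord' \<and> complete_resolution (F s) ord' L2\<rbrakk>
     \<Longrightarrow> complete_resolution \<gamma> ord (L1 - L2)"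

text \<open>Here \<open>f\<close> is a doodle invariant with values in a subspace \<open>V\<close> of \<open>quot U\<close>, already extended
  linearly to linear combinations of diagrams; doodles are identified with their arrow diagrams.\<close>

definition linear_map_into :: "alg set \<Rightarrow> alg set set \<Rightarrow> (qd \<Rightarrow> alg set) \<Rightarrow> bool" where
  "linear_map_into U V f \<longleftrightarrow> (\<forall>x. f x \<in> V) \<and> (\<forall>x y. f (x + y) = f x + f y)
     \<and> (\<forall>c x. f (qd_scale c x) = coset_scale U c (f x))"

definition doodle_invariant :: "alg set \<Rightarrow> alg set set \<Rightarrow> (qd \<Rightarrow> alg set) \<Rightarrow> bool" where
  "doodle_invariant U V f \<longleftrightarrow> linear_map_into U V f
     \<and> (\<forall>\<gamma> \<delta>. doodle \<gamma> \<and> doodle \<delta> \<and> doodle_equiv \<gamma> \<delta> \<longrightarrow>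
          f (diag (diagram_of \<gamma>)) = f (diag (diagram_of \<delta>)))"

definition finite_type_invariant ::
  "alg set \<Rightarrow> alg set set \<Rightarrow> nat \<Rightarrow> (qd \<Rightarrow> alg set) \<Rightarrow> bool" where
  "finite_type_invariant U V m f \<longleftrightarrow> doodle_invariant U V f
     \<and> (\<forall>\<gamma> ord L. singular_doodle \<gamma> ord \<and> complexity \<gamma> > m \<and> complete_resolution \<gamma> ord L
          \<longrightarrow> f L = U)"

end

theory Submission
  imports Defs
begin

text \<open>Invariance is a count of subdiagrams. An isotopy preserves orientations at crossings, since the
  relevant determinant never vanishes along it, so it does not change the arrow diagram; \<open>R\<^sub>1\<close> deletes an
  isolated arrow and \<open>R\<^sub>2\<close> deletes two adjacent opposite arrows, and the relations of \<open>\<A>\<close> make the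
  subdiagrams containing the deleted arrows cancel.

  For the order, let \<open>m\<close> branches meet at a singular point. Each branch other than the first two is moved
  off once, in either direction. By the inverse function theorem the moved branch crosses each remaining
  one exactly once near the point, and the direction of the move influences only where on the two branches
  the endpoints of the new arrows lie, never the direction of an arrow. So a subdiagram that contains no
  arrow joining some moved branch to an earlier one occurs twice with opposite signs. Every subdiagram that
  survives has at least one arrow for each moved branch, hence at least \<open>m - 2\<close> arrows for each singular
  point, and \<open>m - 1 \<le> 2 (m - 2)\<close> when \<open>m \<ge> 3\<close>.\<close>


section \<open>Linear algebra of arrow diagrams\<close>

text \<open>Two obstacles shape the proof. Diagrams are equal only up to a smooth diffeomorphism of
  the circle, so two resolutions whose endpoints have the same cyclic order are identified only
  after a diffeomorphism carrying one finite set of points to the other has been built; this is the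
  reason for the bump functions. And the branches are moved off one at a time, each by an amount
  that depends on the moves already made, so no formula for the final positions is available. The
  induction therefore carries just the order of the endpoints near each branch, encoded by real
  numbers computed from the original singular curve alone (\<open>key\<close>), and it claims this
  for every bound \<open>\<rho>\<close> on the displacement: the bound that the remaining moves must
  obey depends on the gaps between the crossings left by the move just made. The key of a pair of
  branches depends on the moves only through the sign at the later one of the two, which is what
  makes the cancellation visible.\<close>

lemma is_arrow_diagram_finite: "is_arrow_diagram A \<Longrightarrow> finite A"
  by (simp add: is_arrow_diagram_def)

text \<open>The support of a sum can be smaller than the union of the supports, so additivity of
  \<open>I_D\<close> is checked over a common finite index set.\<close>

lemma I_D_superset:
  assumes "finite K" "Poly_Mapping.keys x \<subseteq> K"
  shows "I_D x = (\<Sum>D\<in>K. qd_scale (Poly_Mapping.lookup x D) (subdiagram_sum D))"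
  unfolding I_D_def
  by (rule sum.mono_neutral_left) (use assms in \<open>auto simp: in_keys_iff\<close>)

lemma I_D_add: "I_D (x + y) = I_D x + I_D y"
proof -
  let ?K = "Poly_Mapping.keys x \<union> Poly_Mapping.keys y"
  have "I_D (x + y) = (\<Sum>D\<in>?K. qd_scale (Poly_Mapping.lookup (x + y) D) (subdiagram_sum D))"
    using Poly_Mapping.keys_add[of x y] by (intro I_D_superset) auto
  also have "\<dots> = I_D x + I_D y"
    by (simp add: I_D_superset[of ?K x] I_D_superset[of ?K y] lookup_add QD.scale_left_distrib sum.distrib)
  finally show ?thesis .
qed

lemma I_D_scale: "I_D (qd_scale c x) = qd_scale c (I_D x)"
proof -
  have "I_D (qd_scale c x) = (\<Sum>D\<in>Poly_Mapping.keys x.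
      qd_scale (Poly_Mapping.lookup (qd_scale c x) D) (subdiagram_sum D))"
    by (intro I_D_superset) (auto simp: in_keys_iff lookup_qd_scale)
  then show ?thesis by (simp add: I_D_def lookup_qd_scale QD.scale_sum_right)
qed

lemma I_alg_add: "I_alg (x + y) = I_alg x + I_alg y"
  by (simp add: I_alg_def I_D_add plus_alg.abs_eq)

lemma I_alg_scale: "I_alg (qd_scale c x) = alg_scale c (I_alg x)"
  by (simp add: I_alg_def I_D_scale alg_scale.abs_eq)

lemma I_alg_sum: "I_alg (\<Sum>i\<in>X. f i) = (\<Sum>i\<in>X. I_alg (f i))"
proof -
  have "I_alg 0 = 0" using I_alg_add[of 0 0] by simp
  then show ?thesis by (induction X rule: infinite_finite_induct) (auto simp: I_alg_add)
qed

lemma abs_alg_sum: "abs_alg (\<Sum>i\<in>X. f i) = (\<Sum>i\<in>X. abs_alg (f i))"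
  by (induction X rule: infinite_finite_induct) (auto simp: zero_alg.abs_eq simp flip: plus_alg.abs_eq)

text \<open>Meaningful only for sets that are arrow diagrams.\<close>

definition symb :: "(real \<times> real) set \<Rightarrow> alg" where
  "symb A = abs_alg (diag (abs_arrow_diagram A))"

lemma arrow_equiv_refl: "is_arrow_diagram A \<Longrightarrow> arrow_equiv A A"
  using map_prod_image_id[of A "circle_map (\<lambda>t. t)"] circle_map_id circle_diffeo_id
  by (auto simp: arrow_equiv_def intro!: exI[of _ "\<lambda>t. t"])

text \<open>Complementation in \<open>A\<close> exchanges the arrows deleted, over which
  \<open>I_D\<close> sums, with the arrows kept, which are easier to follow through a move.\<close>

lemma I_alg_diag:
  assumes "is_arrow_diagram A"
  shows "I_alg (diag (abs_arrow_diagram A)) = (\<Sum>S\<in>Pow A. symb S)"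
proof -
  have "I_D (diag (abs_arrow_diagram A)) = (\<Sum>S\<in>Pow A. diag (abs_arrow_diagram (A - S)))"
    using subdiagram_sum.abs_eq[of A] arrow_equiv_refl[OF assms] by (simp add: I_D_def)
  also have "\<dots> = (\<Sum>S\<in>Pow A. diag (abs_arrow_diagram S))"
    by (rule sum.reindex_bij_witness[of _ "\<lambda>S. A - S" "\<lambda>S. A - S"]) auto
  finally show ?thesis by (simp add: I_alg_def abs_alg_sum symb_def)
qed

lemma abs_alg_relation:
  assumes "x \<in> relations" shows "abs_alg x = 0"
proof -
  have "alg_equiv x 0" using assms by (simp add: alg_equiv_def QD.span_base)
  then show ?thesis unfolding zero_alg_def by (simp add: alg.abs_eq_iff)
qed

text \<open>Deleting arrows only removes endpoints from the arcs, so adjacency passes to every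
  subdiagram that still has both endpoints.\<close>

lemma adjacent_in_subset:
  assumes "adjacent_in A a b" "B \<subseteq> A" "a \<in> endpoints B" "b \<in> endpoints B"
  shows "adjacent_in B a b"
proof -
  have "endpoints B \<subseteq> endpoints A" using assms(2) by (auto simp: endpoints_def)
  then show ?thesis using assms by (auto simp: adjacent_in_def)
qed

text \<open>Every subdiagram containing \<open>e\<close> has \<open>e\<close> isolated and vanishes;
  the others are the subdiagrams of the diagram without \<open>e\<close>.\<close>

lemma I_alg_isolated:
  assumes A: "is_arrow_diagram A" and e: "isolated_arrow A e"
  shows "I_alg (diag (abs_arrow_diagram A)) = I_alg (diag (abs_arrow_diagram (A - {e})))"
proof -
  define B where "B = A - {e}"
  have eA: "e \<in> A" using e by (simp add: isolated_arrow_def)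
  have iA: "A = insert e B" "e \<notin> B" using eA by (auto simp: B_def)
  have fin: "finite B" using A is_arrow_diagram_finite by (simp add: B_def)
  have z: "symb (insert e S) = 0" if "S \<subseteq> B" for S
  proof -
    have sub: "insert e S \<subseteq> A" using that iA by auto
    have "is_arrow_diagram (insert e S)" using is_arrow_diagram_subset[OF A sub] .
    moreover have "isolated_arrow (insert e S) e"
      using e sub by (auto simp: isolated_arrow_def intro!: adjacent_in_subset[OF _ sub] simp: endpoints_def)
    ultimately have "diag (abs_arrow_diagram (insert e S)) \<in> relations"
      unfolding relations_def by blast
    then show ?thesis unfolding symb_def by (rule abs_alg_relation)
  qed
  have B: "is_arrow_diagram B" using is_arrow_diagram_subset[OF A] by (auto simp: B_def)
  have "I_alg (diag (abs_arrow_diagram A)) = (\<Sum>S\<in>Pow B. symb S) + (\<Sum>S\<in>insert e ` Pow B. symb S)"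
    unfolding I_alg_diag[OF A] using fin iA by (subst iA(1), subst Pow_insert, subst sum.union_disjoint) auto
  also have "(\<Sum>S\<in>insert e ` Pow B. symb S) = 0" using z by (intro sum.neutral) auto
  finally show ?thesis using I_alg_diag[OF B] by (simp add: B_def)
qed

text \<open>Grouped by its part \<open>S\<close> outside the two arrows, a subdiagram with both
  arrows cancels, by the second relation, against the two that have exactly one of them. What
  remains are the subdiagrams with neither.\<close>

lemma I_alg_adjacent_opposite:
  assumes A: "is_arrow_diagram A" and e: "adjacent_opposite_in A e e'"
  shows "I_alg (diag (abs_arrow_diagram A)) = I_alg (diag (abs_arrow_diagram (A - {e, e'})))"
proof -
  define B where "B = A - {e, e'}"
  have eA: "e \<in> A" "e' \<in> A" "e \<noteq> e'" using e by (simp_all add: adjacent_opposite_in_def)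
  have iA: "A = insert e (insert e' B)" "e \<notin> insert e' B" "e' \<notin> B" using eA by (auto simp: B_def)
  have fin: "finite B" using A is_arrow_diagram_finite by (simp add: B_def)
  have z: "symb (insert e (insert e' S)) + symb (insert e' S) + symb (insert e S) = 0" if "S \<subseteq> B" for S
  proof -
    let ?T = "insert e (insert e' S)"
    have sub: "?T \<subseteq> A" using that iA by auto
    have T: "is_arrow_diagram ?T" using is_arrow_diagram_subset[OF A sub] .
    obtain a b a' b' where ab: "adjacent_in A a a'" "adjacent_in A b b'"
      "e = (a, b) \<and> e' = (b', a') \<or> e = (b, a) \<and> e' = (a', b')"
      using e unfolding adjacent_opposite_in_def by blast
    then have "{a, b, a', b'} \<subseteq> endpoints ?T" by (auto simp: endpoints_def)
    then have "adjacent_in ?T a a'" "adjacent_in ?T b b'"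
      using ab sub adjacent_in_subset by auto
    then have "adjacent_opposite_in ?T e e'"
      using ab(3) eA(3) unfolding adjacent_opposite_in_def by blast
    then have "diag (abs_arrow_diagram ?T) + diag (abs_arrow_diagram (?T - {e}))
        + diag (abs_arrow_diagram (?T - {e'})) \<in> relations"
      using T unfolding relations_def by blast
    moreover have "?T - {e} = insert e' S" "?T - {e'} = insert e S" using that iA eA by auto
    ultimately have "diag (abs_arrow_diagram ?T) + diag (abs_arrow_diagram (insert e' S))
        + diag (abs_arrow_diagram (insert e S)) \<in> relations"
      by (simp only:)
    then show ?thesis unfolding symb_def by (simp add: plus_alg.abs_eq abs_alg_relation)
  qed
  have B: "is_arrow_diagram B" using is_arrow_diagram_subset[OF A] by (auto simp: B_def)
  have inj: "inj_on (insert x) (Pow Y)" if "x \<notin> Y" for x Y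
    using that by (auto simp: inj_on_def)
  \<comment> \<open>Splits the subsets of \<open>insert x Y\<close> by membership of
    \<open>x\<close>; used three times to reach sums over \<open>Pow B\<close>.\<close>
  have dup: "(\<Sum>S\<in>Pow (insert x Y). symb (f S)) = (\<Sum>S\<in>Pow Y. symb (f S)) + (\<Sum>S\<in>Pow Y. symb (f (insert x S)))"
    if "x \<notin> Y" "finite Y" for x Y f
    using that by (subst Pow_insert, subst sum.union_disjoint) (auto simp: sum.reindex inj)
  have "I_alg (diag (abs_arrow_diagram A)) = (\<Sum>S\<in>Pow (insert e (insert e' B)). symb S)"
    using I_alg_diag[OF A] iA(1) by simp
  also have "\<dots> = (\<Sum>S\<in>Pow B. symb S) + (\<Sum>S\<in>Pow B. symb (insert e' S))
      + ((\<Sum>S\<in>Pow B. symb (insert e S)) + (\<Sum>S\<in>Pow B. symb (insert e (insert e' S))))"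
    using iA fin dup[of e "insert e' B" "\<lambda>S. S"] dup[of e' B "\<lambda>S. S"] dup[of e' B "\<lambda>S. insert e S"]
    by simp
  also have "\<dots> = (\<Sum>S\<in>Pow B. symb S) + (\<Sum>S\<in>Pow B. symb (insert e (insert e' S)) + symb (insert e' S) + symb (insert e S))"
    by (simp add: sum.distrib algebra_simps)
  also have "(\<Sum>S\<in>Pow B. symb (insert e (insert e' S)) + symb (insert e' S) + symb (insert e S)) = 0"
    using z by (intro sum.neutral) auto
  finally show ?thesis using I_alg_diag[OF B] by (simp add: B_def)
qed

section \<open>The filtration by the number of arrows and the splitting\<close>

lemma symb_in_filt:
  assumes "is_arrow_diagram S" "k \<le> card S"
  shows "symb S \<in> filt k"
proof -
  have "num_arrows (abs_arrow_diagram S) = card S"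
    using num_arrows.abs_eq arrow_equiv_refl[OF assms(1)] by blast
  then show ?thesis unfolding filt_def symb_def
    using assms(2) by (intro Alg.span_base CollectI exI[of _ "abs_arrow_diagram S"]) auto
qed

lemma coset_filt: "a \<in> filt k \<Longrightarrow> a +o filt k = filt k"
proof
  assume a: "a \<in> filt k"
  show "a +o filt k \<subseteq> filt k"
    using a Alg.subspace_add[OF subspace_filt] by (auto simp: elt_set_plus_def)
  show "filt k \<subseteq> a +o filt k"
  proof
    fix b assume "b \<in> filt k"
    then have "b - a \<in> filt k" using a Alg.subspace_diff[OF subspace_filt] by blast
    then show "b \<in> a +o filt k" by (auto simp: elt_set_plus_def intro!: bexI[of _ "b - a"])
  qed
qed

lemma filt_plus_filt: "filt k + filt k = filt k"
  using coset_add_filt[of k k 0] by simp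

lemma I_n_add: "I_n n (x + y) = I_n n x + I_n n y"
  by (simp add: I_n_def I_alg_add set_plus_rearrange filt_plus_filt)

lemma I_n_scale: "I_n n (qd_scale c x) = coset_scale (filt (Suc n)) c (I_n n x)"
proof -
  let ?U = "filt (Suc n)"
  have 1: "alg_scale c ` (a +o ?U) = alg_scale c a +o (alg_scale c ` ?U)" for a
    by (auto simp: elt_set_plus_def Alg.scale_right_distrib image_def)
  have "alg_scale c ` ?U + ?U = ?U"
  proof
    show "alg_scale c ` ?U + ?U \<subseteq> ?U"
      using Alg.subspace_add[OF subspace_filt] Alg.subspace_scale[OF subspace_filt]
      by (auto simp: set_plus_def)
    have "0 \<in> alg_scale c ` ?U" using Alg.subspace_0[OF subspace_filt] by (auto intro: image_eqI[of _ _ 0])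
    then show "?U \<subseteq> alg_scale c ` ?U + ?U" using set_zero_plus2 by blast
  qed
  then show ?thesis
    by (simp add: I_n_def I_alg_scale coset_scale_def 1 set_plus_rearrange3)
qed

lemma split_iso_linear_map:
  assumes "linear_splitting \<sigma>"
  shows "linear_map_into (filt (Suc n)) (V_space n) (\<lambda>x. split_iso \<sigma> (I_bar x) n)"
proof -
  have A: "I_n n x \<in> A_space n" "I_n n x \<in> quot (filt (Suc n))" for x
    by (auto simp: I_n_def A_space_def quot_def)
  have l: "quot_linear (filt (Suc n)) (filt (Suc n)) (\<lambda>C. snd (\<sigma> n C))"
    and b: "bij_betw (\<sigma> n) (A_space n) (A_pred n \<times> V_space n)"
    using assms by (auto simp: linear_splitting_def)
  have "snd (\<sigma> n (I_n n x)) \<in> V_space n" for x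
    using bij_betwE[OF b] A(1)[of x] by fastforce
  then show ?thesis
    using l A(2) unfolding linear_map_into_def split_iso_def I_bar_def quot_linear_def
    by (simp add: I_n_add I_n_scale)
qed

text \<open>The coset \<open>filt (Suc n)\<close> is the zero of the quotient and lies in
  \<open>V_space n\<close>, where the second component of the splitting is the identity. Vanishing
  of the invariant is thus reduced to a statement about \<open>I_alg\<close>.\<close>

lemma split_iso_eq_0:
  assumes "linear_splitting \<sigma>" "I_alg x \<in> filt (Suc n)"
  shows "split_iso \<sigma> (I_bar x) n = filt (Suc n)"
proof -
  have I: "I_n n x = filt (Suc n)" using coset_filt[OF assms(2)] by (simp add: I_n_def)
  have "filt (Suc n) = 0 +o filt (Suc n)" by simp
  then have "filt (Suc n) \<in> A_space n" unfolding A_space_def quot_def by (rule range_eqI)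
  moreover have "proj n (filt (Suc n)) = filt n"
    using coset_add_filt[of n "Suc n" 0] by (simp add: proj_def)
  ultimately have "filt (Suc n) \<in> V_space n" by (simp add: V_space_def)
  then have "\<sigma> n (filt (Suc n)) = (filt n, filt (Suc n))"
    using assms(1) unfolding linear_splitting_def by blast
  then show ?thesis by (simp add: split_iso_def I_bar_def I)
qed

lemma split_iso_cong:
  "I_alg x = I_alg y \<Longrightarrow> split_iso \<sigma> (I_bar x) n = split_iso \<sigma> (I_bar y) n"
  by (simp add: split_iso_def I_bar_def I_n_def)


section \<open>Interpolation by circle diffeomorphisms\<close>

lemma ck_on_Suc_real:
  fixes f :: "real \<Rightarrow> real"
  assumes "\<And>x. (f has_real_derivative f' x) (at x)" "ck_on k UNIV f'"
  shows "ck_on (Suc k) UNIV f"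
proof -
  have "(f has_derivative (\<lambda>v. f' x * v)) (at x)" for x
    using assms(1) by (simp add: has_field_derivative_def)
  moreover have "ck_on k UNIV (\<lambda>x. f' x * v)" for v
    using assms(2) by (intro ck_on_mult ck_on_const)
  ultimately show ?thesis by (auto intro!: exI[of _ "\<lambda>x v. f' x * v"])
qed

lemma ck_on_real_deriv:
  fixes f :: "real \<Rightarrow> real"
  assumes "ck_on (Suc k) UNIV f" "\<And>x. (f has_real_derivative f' x) (at x)"
  shows "ck_on k UNIV f'"
proof -
  from assms(1) obtain D where D: "\<forall>x. (f has_derivative D x) (at x)" "\<forall>v. ck_on k UNIV (\<lambda>x. D x v)"
    by auto
  have "D x = (\<lambda>v. f' x * v)" for x
    using D(1) assms(2)[of x] has_derivative_unique unfolding has_field_derivative_def by blast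
  then show ?thesis using D(2)[rule_format, of 1] by simp
qed

text \<open>All derivatives of the flat function \<open>exp (- 1 / t)\<close> are combinations of these.\<close>

definition flat :: "nat \<Rightarrow> real \<Rightarrow> real" where
  "flat n t = (if t > 0 then inverse t ^ n * exp (- inverse t) else 0)"

text \<open>With \<open>x = 1 / t\<close> the right limit is that of \<open>x ^ n / exp x\<close> at
  infinity; on the left the function vanishes.\<close>

lemma flat_limit: "((\<lambda>t. flat n t) \<longlongrightarrow> 0) (at 0)"
proof -
  have "((\<lambda>x::real. x ^ n / exp x) \<longlongrightarrow> 0) at_top"
    by (rule tendsto_power_div_exp_0)
  then have "((\<lambda>t::real. inverse t ^ n / exp (inverse t)) \<longlongrightarrow> 0) (at_right 0)"
    by (rule filterlim_compose) (rule filterlim_inverse_at_top_right)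
  then have "((\<lambda>t. flat n t) \<longlongrightarrow> 0) (at_right 0)"
    by (rule Lim_transform_eventually)
       (auto simp: flat_def exp_minus divide_inverse eventually_at_filter)
  moreover have "((\<lambda>t. flat n t) \<longlongrightarrow> 0) (at_left 0)"
    by (rule Lim_transform_eventually[OF tendsto_const])
       (auto simp: flat_def eventually_at_filter)
  ultimately show ?thesis using filterlim_split_at by blast
qed

lemma flat_deriv: "(flat n has_real_derivative (flat (n + 2) t - real n * flat (n + 1) t)) (at t)"
proof -
  consider "t > 0" | "t < 0" | "t = 0" by linarith
  then show ?thesis
  proof cases
    case 1
    have "((\<lambda>t. inverse t ^ n * exp (- inverse t)) has_real_derivative
        (flat (n + 2) t - real n * flat (n + 1) t)) (at t)"
      using 1 by (auto intro!: derivative_eq_intros simp: flat_def field_simps power2_eq_square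
          split: nat.splits) (metis One_nat_def Suc_pred gr0I power_Suc)
    then show ?thesis
      by (rule has_field_derivative_transform_within_open[of _ _ _ "{0<..}"])
        (use 1 in \<open>auto simp: flat_def\<close>)
  next
    case 2
    have "((\<lambda>t. 0) has_real_derivative 0) (at t)" by simp
    then have "(flat n has_real_derivative 0) (at t)"
      by (rule has_field_derivative_transform_within_open[of _ _ _ "{..<0}"])
        (use 2 in \<open>auto simp: flat_def\<close>)
    then show ?thesis using 2 by (simp add: flat_def)
  next
    case 3
    \<comment> \<open>The difference quotient of \<open>flat n\<close> at 0 is
      \<open>flat (Suc n)\<close>.\<close>
    have "((\<lambda>h. flat (Suc n) h) \<longlongrightarrow> 0) (at 0)" by (rule flat_limit)
    then have "((\<lambda>h. (flat n (0 + h) - flat n 0) / h) \<longlongrightarrow> 0) (at 0)"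
      by (rule Lim_transform_eventually)
        (auto simp: flat_def eventually_at_filter divide_inverse)
    then show ?thesis using 3 by (simp add: DERIV_def flat_def)
  qed
qed

lemma ck_on_flat: "ck_on k UNIV (flat n)"
proof (induction k arbitrary: n)
  case 0
  have "continuous_on UNIV (flat n)"
    by (rule DERIV_continuous_on) (rule flat_deriv[THEN DERIV_subset], simp)
  then show ?case by simp
next
  case (Suc k)
  have "ck_on k UNIV (\<lambda>t. flat (n + 2) t + (- real n) * flat (n + 1) t)"
    by (intro ck_on_add ck_on_mult ck_on_const Suc)
  then have "ck_on k UNIV (\<lambda>t. flat (n + 2) t - real n * flat (n + 1) t)" by simp
  then show ?case by (rule ck_on_Suc_real[OF flat_deriv])
qed

lemma ck_on_sin_cos: "ck_on k UNIV (\<lambda>t::real. sin t) \<and> ck_on k UNIV (\<lambda>t::real. cos t)"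
proof (induction k)
  case 0
  then show ?case by (auto intro: continuous_intros)
next
  case (Suc k)
  have "ck_on (Suc k) UNIV (\<lambda>t::real. sin t)"
    by (rule ck_on_Suc_real[of _ cos]) (use Suc in \<open>auto intro: DERIV_sin\<close>)
  moreover have "ck_on k UNIV (\<lambda>t::real. (- 1) * sin t)"
    using Suc by (intro ck_on_mult ck_on_const) auto
  then have "ck_on (Suc k) UNIV (\<lambda>t::real. cos t)"
    by (intro ck_on_Suc_real[of _ "\<lambda>t. (-1) * sin t"]) (auto intro!: derivative_eq_intros)
  ultimately show ?case by blast
qed

text \<open>The reciprocal occurs in its own derivative, so its class is raised by
  induction.\<close>

lemma ck_on_inverse:
  fixes f :: "real \<Rightarrow> real"
  assumes "\<And>x. f x \<noteq> 0"
  shows "ck_on k UNIV f \<Longrightarrow> ck_on k UNIV (\<lambda>x. inverse (f x))"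
proof (induction k)
  case 0
  then show ?case using assms by (auto intro: continuous_intros)
next
  case (Suc k)
  from Suc.prems obtain D where D: "\<forall>x. (f has_derivative D x) (at x)" "\<forall>v. ck_on k UNIV (\<lambda>x. D x v)"
    by auto
  have fk: "ck_on k UNIV (\<lambda>x. inverse (f x))" using Suc ck_on_Suc_imp by blast
  have "(f has_real_derivative D x 1) (at x)" for x
  proof -
    have "D x = (*) (D x 1)"
    proof
      fix v
      have "linear (D x)" using D(1) has_derivative_linear by blast
      from linear_scale[OF this, of v 1] show "D x v = D x 1 * v" by (simp add: mult.commute)
    qed
    then show ?thesis using D(1) by (metis has_field_derivative_def)
  qed
  then have d: "((\<lambda>x. inverse (f x)) has_real_derivative
      (- 1) * ((inverse (f x) * inverse (f x)) * D x 1)) (at x)" for x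
    by (auto intro!: derivative_eq_intros simp: assms power2_eq_square)
  have "ck_on k UNIV (\<lambda>x. (- 1) * ((inverse (f x) * inverse (f x)) * D x 1))"
    using D(2) by (intro ck_on_mult fk ck_on_const) auto
  then show ?case by (rule ck_on_Suc_real[OF d])
qed

text \<open>Bootstrapping: the derivative of the inverse is \<open>inverse (f' (inv f y))\<close>,
  which is of class \<open>k\<close> as soon as \<open>inv f\<close> is.\<close>

lemma ck_on_inv_fun:
  fixes f f' :: "real \<Rightarrow> real"
  assumes f: "\<And>k. ck_on k UNIV f" and d: "\<And>x. (f has_real_derivative f' x) (at x)"
    and pos: "\<And>x. f' x > 0" and b: "bij f"
  shows "ck_on k UNIV (inv f)"
proof (induction k)
  have fi: "f (inv f y) = y" for y using b by (simp add: bij_is_surj surj_f_inv_f)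
  have inv: "inv f (f x) = x" for x using b by (simp add: bij_is_inj)
  have cf: "continuous_on UNIV f" using f[of 0] by simp
  have ci: "isCont (inv f) y" for y
  proof -
    have "isCont (inv f) (f (inv f y))"
      by (rule isCont_inverse_function[of 1]) (use inv cf in \<open>auto simp: continuous_on_eq_continuous_at\<close>)
    then show ?thesis by (simp add: fi)
  qed
  have d': "(inv f has_real_derivative inverse (f' (inv f y))) (at y)" for y
    by (rule DERIV_inverse_function[where f = f and a = "y - 1" and b = "y + 1"])
       (use d pos[of "inv f y"] fi ci in auto)
  {
    case 0
    show ?case using ci by (simp add: continuous_on_eq_continuous_at)
  next
    case (Suc k)
    have f'k: "ck_on k UNIV f'" using ck_on_real_deriv[OF f[of "Suc k"] d] .
    have "ck_on k UNIV (\<lambda>y. f' (inv f y))"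
      using ck_on_compose[OF Suc f'k] .
    then have "ck_on k UNIV (\<lambda>y. inverse (f' (inv f y)))"
      by (rule ck_on_inverse[rotated]) (metis pos less_irrefl)
    then show ?case by (rule ck_on_Suc_real[OF d'])
  }
qed

text \<open>For \<open>0 < r \<le> 1/2\<close> the argument of \<open>flat 0\<close> is positive
  exactly at circular distance less than \<open>r\<close> from \<open>m\<close>, so this is a smooth
  1-periodic bump around \<open>m\<close>.\<close>

definition ring_bump :: "real \<Rightarrow> real \<Rightarrow> real \<Rightarrow> real" where
  "ring_bump m r t = flat 0 (cos (2 * pi * (t - m)) - cos (2 * pi * r))"

lemma ck_on_ring_bump: "ck_on k UNIV (ring_bump m r)"
proof -
  have "ck_on k UNIV (\<lambda>t. 2 * pi * (t + - m))"
    by (intro ck_on_add ck_on_mult ck_on_const ck_on_id)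
  from ck_on_compose[OF this, of cos] have "ck_on k UNIV (\<lambda>t. cos (2 * pi * (t + - m)))"
    by (simp add: ck_on_sin_cos)
  from ck_on_add[OF this ck_on_const, of "- cos (2 * pi * r)"]
  have "ck_on k UNIV (\<lambda>t. flat 0 (cos (2 * pi * (t + - m)) + - cos (2 * pi * r)))"
    by (rule ck_on_compose[OF _ ck_on_flat])
  then show ?thesis by (simp add: ring_bump_def[abs_def])
qed

text \<open>The derivative of \<open>flat 0\<close> is \<open>flat 2\<close>: the other term of
  \<open>flat_deriv\<close> has the factor \<open>n = 0\<close>.\<close>

definition ring_bump' :: "real \<Rightarrow> real \<Rightarrow> real \<Rightarrow> real" where
  "ring_bump' m r t = flat 2 (cos (2 * pi * (t - m)) - cos (2 * pi * r)) * (- sin (2 * pi * (t - m)) * (2 * pi))"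

lemma ring_bump_deriv: "(ring_bump m r has_real_derivative ring_bump' m r t) (at t)"
proof -
  have "(flat 0 has_real_derivative flat 2 z) (at z)" for z
    using flat_deriv[of 0 z] by (simp add: numeral_2_eq_2)
  moreover have "((\<lambda>t. cos (2 * pi * (t - m)) - cos (2 * pi * r)) has_real_derivative
      - sin (2 * pi * (t - m)) * (2 * pi)) (at t)"
    by (auto intro!: derivative_eq_intros)
  ultimately show ?thesis
    unfolding ring_bump_def[abs_def] ring_bump'_def by (rule DERIV_chain2)
qed

text \<open>The difference of cosines stays in \<open>{-2..2}\<close>, where the continuous function
  \<open>flat 2\<close> is bounded.\<close>

lemma ring_bump_deriv_bounded:
  obtains K where "K > 0" "\<And>t. \<bar>ring_bump' m r t\<bar> \<le> K"
proof -
  have "continuous_on UNIV (flat 2)" using ck_on_flat[of 0 2] by simp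
  then have "compact (flat 2 ` {-2..2})"
    by (intro compact_continuous_image) (auto intro: continuous_on_subset)
  then obtain C where C: "C > 0" "\<And>z. z \<in> {-2..2} \<Longrightarrow> \<bar>flat 2 z\<bar> \<le> C"
    using compact_imp_bounded bounded_pos by (metis imageI real_norm_def)
  have "\<bar>ring_bump' m r t\<bar> \<le> C * (1 * (2 * pi))" for t
  proof -
    have "cos (2 * pi * (t - m)) - cos (2 * pi * r) \<in> {-2..2}"
      using cos_le_one[of "2 * pi * (t - m)"] cos_le_one[of "2 * pi * r"]
        cos_ge_minus_one[of "2 * pi * (t - m)"] cos_ge_minus_one[of "2 * pi * r"] unfolding atLeastAtMost_iff by linarith
    with C(2) show ?thesis
      unfolding ring_bump'_def abs_mult abs_minus_cancel by (intro mult_mono) (auto simp: C(1) less_imp_le)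
  qed
  then show ?thesis using that[of "C * (1 * (2 * pi))"] C(1) by simp
qed

lemma ring_bump_periodic: "ring_bump m r (t + 1) = ring_bump m r t"
proof -
  have "2 * pi * (t + 1 - m) = 2 * pi * (t - m) + 2 * pi" by (simp add: algebra_simps)
  then show ?thesis by (simp only: ring_bump_def cos_periodic)
qed

lemma ring_bump_pos: "0 < r \<Longrightarrow> r \<le> 1/2 \<Longrightarrow> ring_bump m r m > 0"
  using cos_monotone_0_pi[of 0 "2 * pi * r"] by (simp add: ring_bump_def flat_def)

lemma ring_bump_eq_0:
  assumes "0 < r" "r \<le> 1/2" "\<And>k::int. \<bar>t - m - of_int k\<bar> \<ge> r"
  shows "ring_bump m r t = 0"
proof -
  \<comment> \<open>Subtracting the nearest integer brings \<open>t - m\<close> to absolute value at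
    most 1/2, where the cosine decreases with the absolute value.\<close>
  define x where "x = t - m - of_int (round (t - m))"
  have x: "r \<le> \<bar>x\<bar>" "\<bar>x\<bar> \<le> 1/2"
    using assms(3)[of "round (t - m)"] of_int_round_abs_le[of "t - m"] by (auto simp: x_def abs_minus_commute)
  have "cos (2 * pi * (t - m)) = cos (2 * pi * x + 2 * pi * of_int (round (t - m)))"
    by (simp add: x_def algebra_simps)
  also have "\<dots> = cos (2 * pi * x)" by (simp add: cos_add)
  also have "\<dots> = cos (2 * pi * \<bar>x\<bar>)" by (cases "x \<ge> 0") auto
  also have "\<dots> \<le> cos (2 * pi * r)"
    using x assms(1) by (intro cos_monotone_0_pi_le) auto
  finally show ?thesis by (simp add: ring_bump_def flat_def)
qed

text \<open>The bound keeps the derivative \<open>1 + l * d t\<close> positive, which gives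
  monotonicity and smoothness of the inverse. Surjectivity follows from the intermediate value
  theorem, since the bump has values in \<open>{0..1}\<close> and points move by at most
  \<open>\<bar>l\<bar>\<close>.\<close>

lemma circle_diffeo_push:
  assumes "\<And>t. \<bar>l\<bar> * \<bar>ring_bump' m r t\<bar> < 1"
  shows "circle_diffeo (\<lambda>t. t + l * ring_bump m r t)"
proof -
  define f where "f = (\<lambda>t. t + l * ring_bump m r t)"
  define d where "d = ring_bump' m r"
  have d: "(f has_real_derivative (1 + l * d t)) (at t)" for t
    unfolding f_def d_def by (intro DERIV_add DERIV_ident DERIV_cmult ring_bump_deriv)
  have pos: "1 + l * d t > 0" for t
  proof -
    have "\<bar>l\<bar> * \<bar>d t\<bar> < 1" unfolding d_def by (rule assms)
    then have "\<bar>l * d t\<bar> < 1" by (simp only: abs_mult)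
    then show ?thesis by linarith
  qed
  have ck: "ck_on k UNIV f" for k
    unfolding f_def by (intro ck_on_add ck_on_mult ck_on_id ck_on_const ck_on_ring_bump)
  have mono: "strict_mono f"
    using DERIV_pos_imp_increasing[of _ _ f] d pos by (intro strict_monoI) blast
  have per: "f (t + 1) = f t + 1" for t by (simp add: f_def ring_bump_periodic)
  have bnd: "ring_bump m r t \<in> {0..1}" for t
    by (auto simp: ring_bump_def flat_def)
  have "surj f"
  proof (rule surjI[of f "\<lambda>y. SOME x. f x = y"])
    fix y
    have "f (y - \<bar>l\<bar>) \<le> y" "y \<le> f (y + \<bar>l\<bar>)"
    proof -
      have *: "\<bar>l * ring_bump m r t\<bar> \<le> \<bar>l\<bar>" for t
        using bnd[of t] by (simp add: abs_mult mult_left_le)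
      show "f (y - \<bar>l\<bar>) \<le> y" "y \<le> f (y + \<bar>l\<bar>)"
        using *[of "y - \<bar>l\<bar>"] *[of "y + \<bar>l\<bar>"] by (auto simp: f_def)
    qed
    moreover have "continuous_on {y - \<bar>l\<bar>..y + \<bar>l\<bar>} f"
      using ck[of 0] by (auto intro: continuous_on_subset)
    ultimately have "\<exists>x. f x = y" using IVT'[of f "y - \<bar>l\<bar>" y "y + \<bar>l\<bar>"] by auto
    then show "f (SOME x. f x = y) = y" by (rule someI_ex)
  qed
  then have "bij f" using mono strict_mono_imp_inj_on by (auto simp: bij_def)
  then have "ck_on k UNIV (inv f)" for k using ck_on_inv_fun[OF ck d pos] by blast
  then show ?thesis
    using \<open>bij f\<close> mono ck per by (auto simp: circle_diffeo_def smooth_on_UNIV_iff f_def[symmetric])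
qed

lemma circle_diffeo_move_near:
  assumes "0 < r" "r \<le> 1/2"
  obtains T where "open T" "x \<in> T" "\<And>y. y \<in> T \<Longrightarrow>
    \<exists>\<phi>. circle_diffeo \<phi> \<and> \<phi> x = y \<and> (\<forall>t. (\<forall>k::int. \<bar>t - x - of_int k\<bar> \<ge> r) \<longrightarrow> \<phi> t = t)"
proof -
  obtain K where K: "K > 0" "\<And>t. \<bar>ring_bump' x r t\<bar> \<le> K"
    using ring_bump_deriv_bounded by blast
  define b where "b = ring_bump x r x"
  have b: "b > 0" using assms by (simp add: b_def ring_bump_pos)
  \<comment> \<open>A push by \<open>l = (y - x) / b\<close> takes \<open>x\<close> to
    \<open>y\<close>; it is a diffeomorphism when \<open>\<bar>l\<bar> * K < 1\<close>, that is,
    within distance \<open>b / K\<close>.\<close>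
  define T where "T = {x - b / K <..< x + b / K}"
  have "\<exists>\<phi>. circle_diffeo \<phi> \<and> \<phi> x = y \<and> (\<forall>t. (\<forall>k::int. \<bar>t - x - of_int k\<bar> \<ge> r) \<longrightarrow> \<phi> t = t)"
    if "y \<in> T" for y
  proof (intro exI conjI allI impI)
    define l where "l = (y - x) / b"
    have "\<bar>y - x\<bar> < b / K" using that by (auto simp: T_def)
    then have "\<bar>l\<bar> * K < 1" using b K(1) by (simp add: l_def field_simps)
    then have "\<bar>l\<bar> * \<bar>ring_bump' x r t\<bar> < 1" for t
      using mult_left_mono[OF K(2)[of t], of "\<bar>l\<bar>"] by simp
    then show "circle_diffeo (\<lambda>t. t + l * ring_bump x r t)" by (rule circle_diffeo_push)
    show "x + l * ring_bump x r x = y" using b by (simp add: l_def b_def[symmetric])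
    show "t + l * ring_bump x r t = t" if "\<forall>k::int. \<bar>t - x - of_int k\<bar> \<ge> r" for t
      using ring_bump_eq_0[OF assms] that by simp
  qed
  moreover have "open T" "x \<in> T" using b K(1) by (auto simp: T_def)
  ultimately show ?thesis using that by blast
qed

text \<open>Allowing all integer shifts \<open>k\<close> makes the hypothesis say that the lifted
  points have the same order, coincidences included, hence the same cyclic order. Points are
  adjusted one at a time: once \<open>\<phi>\<close> is right on \<open>I\<close>, the image
  \<open>x\<close> of the new point has to be moved to its target \<open>y\<close> without
  disturbing the points already placed. Small pushes exist everywhere on the segment between
  \<open>x\<close> and \<open>y\<close>, and connectedness chains them together.\<close>

lemma circle_diffeo_interpolation:
  fixes p q :: "'i \<Rightarrow> real"
  assumes "finite I"
    and "\<And>i j k. i \<in> I \<Longrightarrow> j \<in> I \<Longrightarrow> p i < p j + of_int k \<longleftrightarrow> q i < q j + of_int k"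
  shows "\<exists>\<phi>. circle_diffeo \<phi> \<and> (\<forall>i\<in>I. \<phi> (p i) = q i)"
  using assms
proof (induction I rule: finite_induct)
  case empty
  then show ?case using circle_diffeo_id by blast
next
  case (insert i0 I)
  then obtain \<phi> where \<phi>: "circle_diffeo \<phi>" "\<And>i. i \<in> I \<Longrightarrow> \<phi> (p i) = q i" by auto
  have mono: "\<phi> a < \<phi> b \<longleftrightarrow> a < b" for a b
    using \<phi>(1) by (simp add: circle_diffeo_def strict_mono_less)
  define x where "x = \<phi> (p i0)"
  define y where "y = q i0"
  have xy1: "x < q j + of_int k \<longleftrightarrow> y < q j + of_int k" if "j \<in> I" for j k
    using insert.prems[of i0 j k] mono[of "p i0" "p j + of_int k"] \<phi>(2)[OF that] that
    by (simp add: circle_diffeo_add_int[OF \<phi>(1)] x_def y_def)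
  have xy2: "q j + of_int k < x \<longleftrightarrow> q j + of_int k < y" if "j \<in> I" for j k
  proof -
    have "q j + of_int k < x \<longleftrightarrow> \<phi> (p j + of_int k) < \<phi> (p i0)"
      using \<phi>(2)[OF that] by (simp add: circle_diffeo_add_int[OF \<phi>(1)] x_def)
    also have "\<dots> \<longleftrightarrow> p j < p i0 + of_int (- k)" by (auto simp: mono)
    also have "\<dots> \<longleftrightarrow> q j < q i0 + of_int (- k)" using insert.prems[of j i0 "-k"] that by blast
    finally show ?thesis by (auto simp: y_def)
  qed
  define R where "R a b \<longleftrightarrow> (\<exists>\<phi>. circle_diffeo \<phi> \<and> \<phi> a = b \<and> (\<forall>j\<in>I. \<phi> (q j) = q j))" for a b
  have "R x y"
  proof (cases "\<exists>j\<in>I. \<exists>k::int. x = q j + of_int k")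
    case True
    then obtain j k where "j \<in> I" "x = q j + of_int k" by blast
    \<comment> \<open>Equal comparisons from both sides force \<open>y\<close> to be the same
      translate.\<close>
    then have "x = y" using xy1[of j k] xy2[of j k] by auto
    then show ?thesis unfolding R_def using circle_diffeo_id by auto
  next
    case False
    define S where "S = {min x y..max x y}"
    \<comment> \<open>A translate of a placed point on the segment would separate \<open>x\<close>
      from \<open>y\<close>, or be \<open>y\<close> itself, contrary to \<open>xy1\<close> and
      \<open>xy2\<close>.\<close>
    have avoid: "a \<noteq> q j + of_int k" if "a \<in> S" "j \<in> I" for a j k
    proof
      assume "a = q j + of_int k"
      then have "min x y \<le> q j + of_int k" "q j + of_int k \<le> max x y" using that by (auto simp: S_def)
      moreover have "x \<noteq> q j + of_int k" using False that by blast
      ultimately show False using xy1[OF that(2), of k] xy2[OF that(2), of k] by linarith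
    qed
    show ?thesis
    proof (rule connected_equivalence_relation[of S])
      show "connected S" "x \<in> S" "y \<in> S" by (auto simp: S_def)
      show "R a b \<Longrightarrow> R b c \<Longrightarrow> R a c" for a b c
        unfolding R_def using circle_diffeo_compose by (metis comp_apply)
      show "R b a" if ab: "R a b" for a b
      proof -
        obtain \<psi> where \<psi>: "circle_diffeo \<psi>" "\<psi> a = b" "\<forall>j\<in>I. \<psi> (q j) = q j"
          using ab unfolding R_def by blast
        then have "inj \<psi>" by (simp add: circle_diffeo_def bij_is_inj)
        then show ?thesis
          unfolding R_def using \<psi> circle_diffeo_inv[OF \<psi>(1)] by (metis inv_f_f)
      qed
      fix a assume a: "a \<in> S"
      have "\<forall>\<^sub>F r in at_right 0. \<forall>k::int. \<bar>q j - a - of_int k\<bar> \<ge> r" if "j \<in> I" for j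
      proof -
        \<comment> \<open>The distance from \<open>q j - a\<close> to the nearest integer.\<close>
        define d where "d = min (frac (q j - a)) (1 - frac (q j - a))"
        have "frac (q j - a) \<noteq> 0"
        proof
          assume "frac (q j - a) = 0"
          then have "a = q j + of_int (- \<lfloor>q j - a\<rfloor>)" by (simp add: frac_def)
          then show False using avoid[OF a that] by blast
        qed
        then have "d > 0" using frac_ge_0[of "q j - a"] frac_lt_1[of "q j - a"] by (simp add: d_def)
        have "\<bar>q j - a - of_int k\<bar> \<ge> d" for k :: int
        proof -
          have "q j - a - of_int k = frac (q j - a) + of_int (\<lfloor>q j - a\<rfloor> - k)"
            by (simp add: frac_def)
          moreover consider "\<lfloor>q j - a\<rfloor> - k \<ge> 0" | "\<lfloor>q j - a\<rfloor> - k \<le> -1" by linarith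
          then have "of_int (\<lfloor>q j - a\<rfloor> - k) \<ge> (0::real) \<or> of_int (\<lfloor>q j - a\<rfloor> - k) \<le> (-1::real)"
            by cases (simp_all flip: of_int_diff)
          ultimately show ?thesis
            using frac_ge_0[of "q j - a"] frac_lt_1[of "q j - a"] unfolding d_def by linarith
        qed
        then show ?thesis
          unfolding eventually_at_right_field
          using \<open>d > 0\<close> by (intro exI[of _ d]) (auto intro: order.trans[OF less_imp_le])
      qed
      then have "\<forall>\<^sub>F r in at_right 0. (\<forall>j\<in>I. \<forall>k::int. \<bar>q j - a - of_int k\<bar> \<ge> r)"
        using insert.hyps(1) by (simp add: eventually_ball_finite)
      moreover have "\<forall>\<^sub>F r in at_right (0::real). r \<le> 1/2 \<and> r > 0"
        unfolding eventually_at_right_field by (intro exI[of _ "1/2"]) auto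
      ultimately have "\<forall>\<^sub>F r in at_right 0. (\<forall>j\<in>I. \<forall>k::int. \<bar>q j - a - of_int k\<bar> \<ge> r) \<and> r \<le> 1/2 \<and> r > 0"
        by eventually_elim auto
      then obtain r where r: "\<forall>j\<in>I. \<forall>k::int. \<bar>q j - a - of_int k\<bar> \<ge> r" "0 < r" "r \<le> 1/2"
        using eventually_happens trivial_limit_at_right_real by blast
      obtain T where T: "open T" "a \<in> T" "\<And>y. y \<in> T \<Longrightarrow>
        \<exists>\<phi>. circle_diffeo \<phi> \<and> \<phi> a = y \<and> (\<forall>t. (\<forall>k::int. \<bar>t - a - of_int k\<bar> \<ge> r) \<longrightarrow> \<phi> t = t)"
        using circle_diffeo_move_near[OF r(2,3), of a] by metis
      show "\<exists>T. openin (top_of_set S) T \<and> a \<in> T \<and> (\<forall>x\<in>T. R a x)"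
      proof (intro exI[of _ "S \<inter> T"] conjI ballI)
        show "openin (top_of_set S) (S \<inter> T)" using T(1) by blast
        show "a \<in> S \<inter> T" using a T(2) by simp
        show "R a z" if "z \<in> S \<inter> T" for z
        proof -
          have "z \<in> T" using that by simp
          then obtain \<psi> where "circle_diffeo \<psi>" "\<psi> a = z"
            "\<forall>t. (\<forall>k::int. \<bar>t - a - of_int k\<bar> \<ge> r) \<longrightarrow> \<psi> t = t"
            using T(3) by blast
          then show ?thesis using r(1) unfolding R_def by blast
        qed
      qed
    qed
  qed
  then obtain \<psi> where \<psi>: "circle_diffeo \<psi>" "\<psi> x = y" "\<forall>j\<in>I. \<psi> (q j) = q j" by (auto simp: R_def)
  then show ?case
    using \<phi>(2) by (intro exI[of _ "\<psi> \<circ> \<phi>"] conjI ballI circle_diffeo_compose[OF \<phi>(1) \<psi>(1)])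
      (auto simp: x_def y_def)
qed


section \<open>Crossings and isotopies\<close>

text \<open>On a set that is not open the derivative is the one of an extension, so the
  neighbourhood \<open>W\<close> and the extension are part of the result.\<close>

lemma smooth_on_imp_C1:
  assumes "smooth_on S f"
  obtains W g g' where "open W" "S \<subseteq> W" "\<And>x. x \<in> S \<Longrightarrow> g x = f x"
    "\<And>x. x \<in> W \<Longrightarrow> (g has_derivative g' x) (at x)" "\<And>v. continuous_on W (\<lambda>x. g' x v)"
proof -
  obtain W g where Wg: "open W" "S \<subseteq> W" "\<And>k. ck_on k W g" "\<And>x. x \<in> S \<Longrightarrow> g x = f x"
    using assms unfolding smooth_on_def by blast
  from Wg(3)[of "Suc 0"] obtain g' where
    "\<forall>x\<in>W. (g has_derivative g' x) (at x)" "\<forall>v. continuous_on W (\<lambda>x. g' x v)" by auto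
  then show ?thesis using that[of W g g'] Wg by simp
qed

lemma smooth_on_open_C1:
  assumes "smooth_on S f" "open S"
  obtains f' where "\<And>x. x \<in> S \<Longrightarrow> (f has_derivative f' x) (at x)" "\<And>v. continuous_on S (\<lambda>x. f' x v)"
proof -
  obtain W g g' where Wg: "open W" "S \<subseteq> W" "\<And>x. x \<in> S \<Longrightarrow> g x = f x"
    "\<And>x. x \<in> W \<Longrightarrow> (g has_derivative g' x) (at x)" "\<And>v. continuous_on W (\<lambda>x. g' x v)"
    by (rule smooth_on_imp_C1[OF assms(1)]) blast
  have "(f has_derivative g' x) (at x)" if "x \<in> S" for x
    by (rule has_derivative_transform_within_open[OF Wg(4) assms(2) that])
       (use Wg that in auto)
  moreover have "continuous_on S (\<lambda>x. g' x v)" for v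
    using Wg(2,5) continuous_on_subset by blast
  ultimately show ?thesis using that by blast
qed

lemma has_derivative_along_curve:
  assumes "(f has_derivative f') (at (c t))" "(c has_vector_derivative v) (at t)"
  shows "((\<lambda>t. f (c t)) has_vector_derivative f' v) (at t)"
proof -
  have "linear f'" using assms(1) by (rule has_derivative_linear)
  have "((\<lambda>t. f (c t)) has_derivative (\<lambda>h. f' (h *\<^sub>R v))) (at t)"
    using has_derivative_compose[OF assms(2)[unfolded has_vector_derivative_def] assms(1)] .
  then show ?thesis
    by (simp add: has_vector_derivative_def linear_scale[OF \<open>linear f'\<close>])
qed

lemma immersed_curve_deriv:
  assumes "immersed_curve \<gamma>"
  shows "(\<gamma> has_vector_derivative tangent \<gamma> t) (at t)"
proof -
  have "smooth_on UNIV \<gamma>" using assms by (simp add: immersed_curve_def)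
  then obtain g' where "(\<gamma> has_derivative g') (at t)"
    using smooth_on_open_C1[of UNIV \<gamma>] by (metis UNIV_I open_UNIV)
  then show ?thesis
    by (meson differentiableI vector_derivative_works)
qed

lemma periodic_of_int:
  fixes f :: "real \<Rightarrow> 'a"
  assumes "\<And>t. f (t + 1) = f t"
  shows "f (t + of_int k) = f t"
proof (induction k rule: int_induct[of _ 0])
  case (step1 i)
  then show ?case using assms[of "t + of_int i"] by (simp add: add.assoc)
next
  case (step2 i)
  then show ?case using assms[of "t + of_int (i - 1)"] by (simp add: algebra_simps)
qed simp

lemma immersed_curve_of_int: "immersed_curve \<gamma> \<Longrightarrow> \<gamma> (t + of_int k) = \<gamma> t"
  by (rule periodic_of_int) (simp add: immersed_curve_def)

lemma tangent_of_int:
  assumes "immersed_curve \<gamma>"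
  shows "tangent \<gamma> (t + of_int k) = tangent \<gamma> t"
proof -
  have "((\<lambda>u. \<gamma> (u + of_int k)) has_vector_derivative tangent \<gamma> (t + of_int k)) (at t)"
  proof -
    have "((\<lambda>u. u + of_int k) has_vector_derivative 1) (at t)"
      by (auto intro!: derivative_eq_intros)
    from vector_diff_chain_at[OF this, of \<gamma>, OF immersed_curve_deriv[OF assms]]
    show ?thesis by (simp add: comp_def)
  qed
  then have "(\<gamma> has_vector_derivative tangent \<gamma> (t + of_int k)) (at t)"
    by (simp add: immersed_curve_of_int[OF assms])
  then show ?thesis using vector_derivative_at by metis
qed

lemma immersed_curve_frac: "immersed_curve \<gamma> \<Longrightarrow> \<gamma> (frac t) = \<gamma> t"
  using immersed_curve_of_int[of \<gamma> t "- \<lfloor>t\<rfloor>"] by (simp add: frac_def)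

lemma tangent_frac: "immersed_curve \<gamma> \<Longrightarrow> tangent \<gamma> (frac t) = tangent \<gamma> t"
  using tangent_of_int[of \<gamma> t "- \<lfloor>t\<rfloor>"] by (simp add: frac_def)

lemma sphere_curve_deriv_orthogonal:
  fixes c :: curve
  assumes "(c has_vector_derivative v) (at t)" "\<And>t. c t \<in> S2"
  shows "c t \<bullet> v = 0"
proof -
  have "((\<lambda>t. c t \<bullet> c t) has_vector_derivative (c t \<bullet> v + v \<bullet> c t)) (at t)"
    using bounded_bilinear.has_vector_derivative[OF bounded_bilinear_inner assms(1) assms(1)] .
  moreover have "(\<lambda>t. c t \<bullet> c t) = (\<lambda>t. 1)"
    using assms(2) by (auto simp: norm_eq_1)
  ultimately have "((\<lambda>t. 1) has_vector_derivative (c t \<bullet> v + v \<bullet> c t)) (at t)" by simp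
  then have "c t \<bullet> v + v \<bullet> c t = 0"
    using vector_derivative_unique_at has_vector_derivative_const by blast
  then show ?thesis by (simp add: inner_commute)
qed

lemma tangent_orthogonal: "immersed_curve \<gamma> \<Longrightarrow> \<gamma> t \<bullet> tangent \<gamma> t = 0"
  by (rule sphere_curve_deriv_orthogonal) (auto simp: immersed_curve_deriv immersed_curve_def)

text \<open>Both vectors are orthogonal to the unit vector \<open>x\<close>, so their cross product
  is parallel to \<open>x\<close> and vanishes with its component along \<open>x\<close>.\<close>

lemma triple_product_nonzero_iff:
  fixes x v w :: "real^3"
  assumes "x \<in> S2" "x \<bullet> v = 0" "x \<bullet> w = 0"
  shows "x \<bullet> cross3 v w \<noteq> 0 \<longleftrightarrow> \<not> collinear {0, v, w}"
proof -
  have "cross3 x (cross3 v w) = 0" using assms by (simp add: Lagrange)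
  moreover have "x \<noteq> 0" using assms(1) by auto
  ultimately have "x \<bullet> cross3 v w = 0 \<longleftrightarrow> cross3 v w = 0"
    using norm_and_cross_eq_0[of x "cross3 v w"] by auto
  then show ?thesis by (simp add: cross_eq_0)
qed

text \<open>When the two parameters have the same image, this is the signed area spanned by the
  tangent vectors in the tangent plane, oriented by the outward normal.\<close>

definition orient :: "curve \<Rightarrow> real \<Rightarrow> real \<Rightarrow> real" where
  "orient \<gamma> s t = \<gamma> s \<bullet> cross3 (tangent \<gamma> s) (tangent \<gamma> t)"

text \<open>Symmetric and free of orientation, so that it also serves singular curves, where a
  parameter can cross several others.\<close>

definition crossing :: "curve \<Rightarrow> real \<Rightarrow> real \<Rightarrow> bool" where
  "crossing \<gamma> s t \<longleftrightarrow> s \<in> {0..<1} \<and> t \<in> {0..<1} \<and> s \<noteq> t \<and> \<gamma> s = \<gamma> t"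

lemma arrows_iff: "(s, t) \<in> arrows \<gamma> \<longleftrightarrow> crossing \<gamma> s t \<and> orient \<gamma> s t > 0"
  by (auto simp: arrows_def orient_def crossing_def)

lemma crossing_sym: "crossing \<gamma> s t \<Longrightarrow> crossing \<gamma> t s"
  by (auto simp: crossing_def)

lemma orient_swap: "\<gamma> s = \<gamma> t \<Longrightarrow> orient \<gamma> t s = - orient \<gamma> s t"
  by (simp add: orient_def cross_skew[of "tangent \<gamma> t"])

lemma crossing_branches:
  "crossing \<gamma> s t \<longleftrightarrow> (\<exists>x\<in>self_intersections \<gamma>. s \<in> branches \<gamma> x \<and> t \<in> branches \<gamma> x \<and> s \<noteq> t)"
  by (auto simp: crossing_def self_intersections_def branches_def)

lemma self_intersectionI: "crossing \<gamma> s t \<Longrightarrow> \<gamma> s \<in> self_intersections \<gamma>"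
  by (auto simp: crossing_def self_intersections_def branches_def)

lemma orient_nonzero:
  assumes "immersed_curve \<gamma>" "\<forall>x\<in>self_intersections \<gamma>. distinct_tangent_lines \<gamma> x" "crossing \<gamma> s t"
  shows "orient \<gamma> s t \<noteq> 0"
proof -
  have "\<gamma> s = \<gamma> t" "\<gamma> s \<in> S2" using assms by (auto simp: crossing_def immersed_curve_def)
  moreover have "\<not> collinear {0, tangent \<gamma> s, tangent \<gamma> t}"
    using assms(2,3) self_intersectionI[OF assms(3)]
    by (auto simp: distinct_tangent_lines_def crossing_def branches_def)
  moreover have "\<gamma> s \<bullet> tangent \<gamma> s = 0" "\<gamma> s \<bullet> tangent \<gamma> t = 0"
    using tangent_orthogonal[OF assms(1)] \<open>\<gamma> s = \<gamma> t\<close> by metis+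
  ultimately show ?thesis
    unfolding orient_def using triple_product_nonzero_iff by blast
qed

lemma doodle_immersed: "doodle \<gamma> \<Longrightarrow> immersed_curve \<gamma>"
  by (simp add: doodle_def)

lemma doodle_orient_nonzero: "doodle \<gamma> \<Longrightarrow> crossing \<gamma> s t \<Longrightarrow> orient \<gamma> s t \<noteq> 0"
  by (rule orient_nonzero) (auto simp: doodle_def)

lemma doodle_crossing_unique:
  assumes "doodle \<gamma>" "crossing \<gamma> s t" "crossing \<gamma> s u"
  shows "t = u"
proof (rule ccontr)
  assume "t \<noteq> u"
  have x: "\<gamma> s \<in> self_intersections \<gamma>" using assms(2) by (rule self_intersectionI)
  have c: "card (branches \<gamma> (\<gamma> s)) = 2" using assms(1) x by (simp add: doodle_def)
  then have "finite (branches \<gamma> (\<gamma> s))" by (intro card_ge_0_finite) simp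
  moreover have "{s, t, u} \<subseteq> branches \<gamma> (\<gamma> s)" using assms by (auto simp: crossing_def branches_def)
  moreover have "card {s, t, u} = 3" using assms \<open>t \<noteq> u\<close> by (auto simp: crossing_def)
  ultimately show False using card_mono[of "branches \<gamma> (\<gamma> s)" "{s, t, u}"] c by simp
qed

lemma finite_crossing_params:
  assumes "finite (self_intersections \<gamma>)" "\<And>x. x \<in> self_intersections \<gamma> \<Longrightarrow> finite (branches \<gamma> x)"
  shows "finite {s. \<exists>t. crossing \<gamma> s t}"
  by (rule finite_subset[of _ "\<Union>x\<in>self_intersections \<gamma>. branches \<gamma> x"])
     (use assms in \<open>auto simp: crossing_branches\<close>)

lemma finite_arrows:
  assumes "finite {s. \<exists>t. crossing \<gamma> s t}" shows "finite (arrows \<gamma>)"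
proof (rule finite_subset)
  show "arrows \<gamma> \<subseteq> {s. \<exists>t. crossing \<gamma> s t} \<times> {s. \<exists>t. crossing \<gamma> s t}"
  proof clarify
    fix s t assume "(s, t) \<in> arrows \<gamma>"
    then have "crossing \<gamma> s t" "crossing \<gamma> t s" by (simp_all add: arrows_iff crossing_sym)
    then show "s \<in> {s. \<exists>t. crossing \<gamma> s t} \<and> t \<in> {s. \<exists>t. crossing \<gamma> s t}" by blast
  qed
qed (use assms in auto)

text \<open>At a double point each parameter has exactly one partner, and the antisymmetry of
  \<open>orient\<close> allows an arrow in only one direction; so distinct arrows have disjoint
  endpoints.\<close>

lemma is_arrow_diagram_arrows:
  assumes "doodle \<gamma>" shows "is_arrow_diagram (arrows \<gamma>)"
proof -
  have "finite (branches \<gamma> x)" if "x \<in> self_intersections \<gamma>" for x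
    using assms that by (metis card.infinite doodle_def zero_neq_numeral)
  then have "finite (arrows \<gamma>)"
    using assms by (intro finite_arrows finite_crossing_params) (auto simp: doodle_def)
  moreover have "endpoints (arrows \<gamma>) \<subseteq> {0..<1}"
    by (auto simp: endpoints_def arrows_def)
  moreover have "a \<noteq> b" if "(a, b) \<in> arrows \<gamma>" for a b
    using that by (auto simp: arrows_def)
  moreover have "{a, b} \<inter> {c, d} = {}"
    if "(a, b) \<in> arrows \<gamma>" "(c, d) \<in> arrows \<gamma>" "(a, b) \<noteq> (c, d)" for a b c d
  proof -
    have ab: "crossing \<gamma> a b" "crossing \<gamma> b a" and cd: "crossing \<gamma> c d" "crossing \<gamma> d c"
      using that by (auto simp: arrows_iff crossing_sym)
    have ge: "\<gamma> a = \<gamma> b" using ab by (simp add: crossing_def)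
    have "orient \<gamma> b a = - orient \<gamma> a b" by (rule orient_swap[OF ge])
    then have no: "(b, a) \<noteq> (c, d)" using that(1,2) by (auto simp: arrows_iff)
    note u = doodle_crossing_unique[OF assms]
    have "a = c \<Longrightarrow> b = d" "a = d \<Longrightarrow> b = c" "b = c \<Longrightarrow> a = d" "b = d \<Longrightarrow> a = c"
      using u[of a b d] u[of a b c] u[of b a d] u[of b a c] ab cd by blast+
    then have "a \<noteq> c" "a \<noteq> d" "b \<noteq> c" "b \<noteq> d" using that(3) no by blast+
    then show ?thesis by simp
  qed
  ultimately show ?thesis unfolding is_arrow_diagram_def by blast
qed

section \<open>Isotopies of the sphere\<close>

lemma abs_arrow_diagram_eqI: "arrow_equiv A B \<Longrightarrow> abs_arrow_diagram A = abs_arrow_diagram B"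
  by (metis Quotient3_arrow_diagram Quotient3_rel)

lemma crossing_frac:
  assumes "immersed_curve \<gamma>" "\<gamma> s = \<gamma> t" "frac s \<noteq> frac t"
  shows "crossing \<gamma> (frac s) (frac t)"
  using assms by (simp add: crossing_def immersed_curve_frac frac_lt_1)

lemma orient_frac: "immersed_curve \<gamma> \<Longrightarrow> orient \<gamma> (frac s) (frac t) = orient \<gamma> s t"
  by (simp add: orient_def immersed_curve_frac tangent_frac)

text \<open>Along the isotopy the determinant \<open>m r\<close> of the two transported tangents is
  continuous in \<open>r\<close> and never zero, because the derivative of the smooth inverse of
  stage \<open>r\<close> brings them back to two independent vectors. Hence its sign at time 1 is
  that at time 0.\<close>

lemma sphere_isotopy_orient:
  assumes H: "sphere_isotopy H" and \<gamma>: "immersed_curve \<gamma>" and e: "\<gamma> s = \<gamma> t"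
    and nz: "orient \<gamma> s t \<noteq> 0"
  obtains D where "\<And>u. ((\<lambda>u. H (1, \<gamma> u)) has_vector_derivative D (tangent \<gamma> u)) (at u) \<or> \<gamma> u \<noteq> \<gamma> s"
    "sgn (H (1, \<gamma> s) \<bullet> cross3 (D (tangent \<gamma> s)) (D (tangent \<gamma> t))) = sgn (orient \<gamma> s t)"
proof -
  have sm: "smooth_on ({0..1} \<times> S2) H" using H by (simp add: sphere_isotopy_def)
  obtain W g g' where Wg: "open W" "{0..1} \<times> S2 \<subseteq> W" "\<And>x. x \<in> {0..1} \<times> S2 \<Longrightarrow> g x = H x"
    "\<And>x. x \<in> W \<Longrightarrow> (g has_derivative g' x) (at x)" "\<And>v. continuous_on W (\<lambda>x. g' x v)"
    by (rule smooth_on_imp_C1[OF sm]) blast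
  have S: "\<gamma> u \<in> S2" for u using \<gamma> by (simp add: immersed_curve_def)
  have gH: "g (r, \<gamma> u) = H (r, \<gamma> u)" if "r \<in> {0..1}" for r u using Wg(3) that S by auto
  define x where "x = \<gamma> s"
  \<comment> \<open>The derivative in the space directions at the common image \<open>x\<close> of
    the two parameters; one linear map serves both branches.\<close>
  define D where "D r v = g' (r, x) (0, v)" for r v
  have dv: "((\<lambda>u. H (r, \<gamma> u)) has_vector_derivative D r (tangent \<gamma> u)) (at u)"
    if "r \<in> {0..1}" "\<gamma> u = x" for r u
  proof -
    have "((\<lambda>u. (r, \<gamma> u)) has_vector_derivative (0, tangent \<gamma> u)) (at u)"
      using immersed_curve_deriv[OF \<gamma>] by (intro has_vector_derivative_Pair) auto
    moreover have "(r, \<gamma> u) \<in> W" using Wg(2) that S by auto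
    ultimately have "((\<lambda>u. g (r, \<gamma> u)) has_vector_derivative g' (r, \<gamma> u) (0, tangent \<gamma> u)) (at u)"
      using has_derivative_along_curve[of g "g' (r, \<gamma> u)" "\<lambda>u. (r, \<gamma> u)" u "(0, tangent \<gamma> u)"]
        Wg(4)[of "(r, \<gamma> u)"] by simp
    then show ?thesis using gH[OF that(1)] by (simp add: D_def that(2))
  qed
  define m where "m r = H (r, x) \<bullet> cross3 (D r (tangent \<gamma> s)) (D r (tangent \<gamma> t))" for r
  have HS: "H (r, y) \<in> S2" if "r \<in> {0..1}" "y \<in> S2" for r y
  proof -
    have "bij_betw (\<lambda>x. H (r, x)) S2 S2" using H that(1) by (simp add: sphere_isotopy_def)
    then show ?thesis using that(2) bij_betwE by blast
  qed
  have m0: "m r \<noteq> 0" if r: "r \<in> {0..1}" for r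
  proof -
    have o: "H (r, x) \<bullet> D r (tangent \<gamma> u) = 0" if "\<gamma> u = x" for u
      using sphere_curve_deriv_orthogonal[OF dv[OF r that]] HS[OF r S] that by auto
    have "smooth_on S2 (inv_into S2 (\<lambda>x. H (r, x)))"
      and bij: "bij_betw (\<lambda>x. H (r, x)) S2 S2"
      using H r by (auto simp: sphere_isotopy_def)
    then obtain W' k k' where k: "S2 \<subseteq> W'" "\<And>y. y \<in> S2 \<Longrightarrow> k y = inv_into S2 (\<lambda>x. H (r, x)) y"
      "\<And>y. y \<in> W' \<Longrightarrow> (k has_derivative k' y) (at y)"
      by - (rule smooth_on_imp_C1, assumption, blast)
    have inv: "k (H (r, \<gamma> u)) = \<gamma> u" for u
      using k(2)[OF HS[OF r S]] inv_into_f_f[OF bij_betw_imp_inj_on[OF bij] S] by simp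
    \<comment> \<open>The derivative, at the moved point, of an extension of the inverse of stage
      \<open>r\<close>; it undoes \<open>D r\<close> on the tangents of the curve.\<close>
    define L where "L = k' (H (r, x))"
    have "H (r, x) \<in> W'" using k(1) HS[OF r S] by (auto simp: x_def)
    then have L: "linear L" unfolding L_def using k(3) has_derivative_linear by blast
    have LD: "L (D r (tangent \<gamma> u)) = tangent \<gamma> u" if "\<gamma> u = x" for u
    proof -
      have "((\<lambda>u. k (H (r, \<gamma> u))) has_vector_derivative k' (H (r, \<gamma> u)) (D r (tangent \<gamma> u))) (at u)"
        by (rule has_derivative_along_curve[OF _ dv[OF r that]]) (use k(1,3) HS[OF r S] in blast)
      then show ?thesis
        using immersed_curve_deriv[OF \<gamma>, of u] vector_derivative_unique_at
        by (simp add: inv that L_def) blast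
    qed
    have "\<not> collinear {0, D r (tangent \<gamma> s), D r (tangent \<gamma> t)}"
    proof
      assume "collinear {0, D r (tangent \<gamma> s), D r (tangent \<gamma> t)}"
      then have "collinear {0, L (D r (tangent \<gamma> s)), L (D r (tangent \<gamma> t))}"
        unfolding collinear_lemma by (auto simp: linear_0[OF L] linear_scale[OF L])
      then have "collinear {0, tangent \<gamma> s, tangent \<gamma> t}"
        using LD[of s] LD[of t] e by (simp add: x_def)
      moreover have "\<gamma> s \<bullet> tangent \<gamma> t = 0" using tangent_orthogonal[OF \<gamma>, of t] e by simp
      ultimately show False
        using nz triple_product_nonzero_iff[OF S tangent_orthogonal[OF \<gamma>]]
        unfolding orient_def by blast
    qed
    then show ?thesis
      unfolding m_def
      using triple_product_nonzero_iff[of "H (r, x)"] HS[OF r S] o[of s] o[of t] e by (simp add: x_def)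
  qed
  have cW: "continuous_on {0..1} (\<lambda>r. (r, x))" and sW: "(\<lambda>r. (r, x)) ` {0..1} \<subseteq> W"
    using Wg(2) S by (auto intro!: continuous_intros simp: x_def)
  have cD: "continuous_on {0..1} (\<lambda>r. D r v)" for v
    unfolding D_def using continuous_on_compose2[OF Wg(5) cW sW] .
  have "continuous_on W g"
    using Wg(4) has_derivative_continuous has_derivative_at_withinI
    by (intro has_derivative_continuous_on) blast
  then have "continuous_on {0..1} (\<lambda>r. g (r, x))"
    using continuous_on_compose2[OF _ cW sW] by blast
  then have cH: "continuous_on {0..1} (\<lambda>r. H (r, x))"
    by (rule continuous_on_cong[THEN iffD1, rotated 2]) (auto simp: gH x_def)
  have cm: "continuous_on {0..1} m"
    unfolding m_def[abs_def] by (intro continuous_on_inner cH continuous_on_cross cD)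
  have "sgn (m 1) = sgn (m 0)"
  proof (rule ccontr)
    assume "sgn (m 1) \<noteq> sgn (m 0)"
    then have "(m 0 \<le> 0 \<and> 0 \<le> m 1) \<or> (m 1 \<le> 0 \<and> 0 \<le> m 0)"
      using m0[of 0] m0[of 1] by (auto simp: sgn_if split: if_splits)
    then have "\<exists>r\<ge>0. r \<le> 1 \<and> m r = 0"
      using IVT'[of m 0 0 1] IVT2'[of m 1 0 0] cm by auto
    then show False using m0 by auto
  qed
  moreover have "m 0 = orient \<gamma> s t"
  proof -
    have H0: "H (0, y) = y" if "y \<in> S2" for y using H that by (simp add: sphere_isotopy_def)
    have "D 0 (tangent \<gamma> u) = tangent \<gamma> u" if "\<gamma> u = x" for u
    proof -
      have "((\<lambda>u. H (0, \<gamma> u)) has_vector_derivative D 0 (tangent \<gamma> u)) (at u)"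
        using dv[of 0 u] that by simp
      then have "(\<gamma> has_vector_derivative D 0 (tangent \<gamma> u)) (at u)" by (simp only: H0[OF S])
      then show ?thesis using immersed_curve_deriv[OF \<gamma>] by (rule vector_derivative_unique_at)
    qed
    then show ?thesis using H0[OF S] e by (simp add: m_def orient_def x_def)
  qed
  ultimately show ?thesis
    using that[of "D 1"] dv[of 1] by (simp add: m_def x_def) blast
qed

text \<open>A strictly increasing function has no negative derivative. Strict positivity is
  recovered at crossings from the nonvanishing of \<open>orient\<close> for the reparametrized
  curve.\<close>

lemma circle_diffeo_deriv:
  assumes "circle_diffeo \<phi>"
  obtains \<phi>' where "\<And>t. (\<phi> has_real_derivative \<phi>' t) (at t)" "\<And>t. \<phi>' t \<ge> 0"
proof -
  have "smooth_on UNIV \<phi>" using assms by (simp add: circle_diffeo_def)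
  then obtain D where D: "\<And>t. (\<phi> has_derivative D t) (at t)"
    by (rule smooth_on_open_C1) auto
  have "\<exists>d. (\<phi> has_real_derivative d) (at t)" for t
    using D[of t] by (meson differentiableI real_differentiable_def)
  then obtain \<phi>' where d: "\<And>t. (\<phi> has_real_derivative \<phi>' t) (at t)" by metis
  moreover have "\<phi>' t \<ge> 0" for t
  proof (rule ccontr)
    assume "\<not> \<phi>' t \<ge> 0"
    then obtain r where "r > 0" "\<forall>h>0. h < r \<longrightarrow> \<phi> (t + h) < \<phi> t"
      using DERIV_neg_dec_right[OF d] by (auto simp: not_le)
    then have "\<phi> (t + r / 2) < \<phi> t" by simp
    moreover have "\<phi> t < \<phi> (t + r / 2)"
      using assms \<open>r > 0\<close> by (simp add: circle_diffeo_def strict_mono_less)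
    ultimately show False by simp
  qed
  ultimately show ?thesis using that by blast
qed

text \<open>The last stage of the isotopy is injective, so \<open>\<phi>\<close> matches the
  crossings of \<open>\<delta>\<close> with those of \<open>\<gamma>\<close>. Tangents of
  \<open>\<delta>\<close> are transported tangents times the derivative of \<open>\<phi>\<close>, so
  the signs agree, and \<open>\<phi>\<close> itself is the equivalence of the two arrow
  sets.\<close>

lemma isotopic_diagram:
  assumes "isotopic \<gamma> \<delta>" shows "diagram_of \<gamma> = diagram_of \<delta>"
proof -
  obtain H \<phi> where dg: "doodle \<gamma>" and dd: "doodle \<delta>" and H: "sphere_isotopy H"
    and \<phi>: "circle_diffeo \<phi>" and \<delta>: "\<And>t. \<delta> t = H (1, \<gamma> (\<phi> t))"
    using assms by (auto simp: isotopic_def)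
  note ig = doodle_immersed[OF dg] and id = doodle_immersed[OF dd]
  obtain \<phi>' where \<phi>': "\<And>t. (\<phi> has_real_derivative \<phi>' t) (at t)" "\<And>t. \<phi>' t \<ge> 0"
    using circle_diffeo_deriv[OF \<phi>] by blast
  have bij: "bij_betw (\<lambda>x. H (1, x)) S2 S2" using H by (simp add: sphere_isotopy_def)
  have S: "\<gamma> t \<in> S2" for t using ig by (simp add: immersed_curve_def)
  have eq: "\<delta> s = \<delta> t \<longleftrightarrow> \<gamma> (\<phi> s) = \<gamma> (\<phi> t)" for s t
    using bij S unfolding \<delta> by (metis bij_betw_imp_inj_on inj_onD)
  have cm: "circle_map \<phi> s \<in> {0..<1}" for s by (simp add: circle_map_def frac_lt_1)
  have inj: "circle_map \<phi> s \<noteq> circle_map \<phi> t" if "s \<in> {0..<1}" "t \<in> {0..<1}" "s \<noteq> t" for s t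
    using circle_map_inv[OF \<phi>] that by metis
  have cr: "crossing \<gamma> (circle_map \<phi> s) (circle_map \<phi> t)" if "crossing \<delta> s t" for s t
    using that eq inj cm by (auto simp: crossing_def circle_map_def immersed_curve_frac[OF ig])
  have sg: "sgn (orient \<delta> s t) = sgn (orient \<gamma> (circle_map \<phi> s) (circle_map \<phi> t))"
    if c: "crossing \<delta> s t" for s t
  proof -
    have g: "\<gamma> (\<phi> s) = \<gamma> (\<phi> t)" using c eq by (simp add: crossing_def)
    have o: "orient \<gamma> (circle_map \<phi> s) (circle_map \<phi> t) = orient \<gamma> (\<phi> s) (\<phi> t)"
      by (simp add: circle_map_def orient_frac[OF ig])
    have "orient \<gamma> (\<phi> s) (\<phi> t) \<noteq> 0"
      using doodle_orient_nonzero[OF dg cr[OF c]] o by simp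
    then obtain D where D: "\<And>u. ((\<lambda>u. H (1, \<gamma> u)) has_vector_derivative D (tangent \<gamma> u)) (at u) \<or> \<gamma> u \<noteq> \<gamma> (\<phi> s)"
      "sgn (H (1, \<gamma> (\<phi> s)) \<bullet> cross3 (D (tangent \<gamma> (\<phi> s))) (D (tangent \<gamma> (\<phi> t)))) = sgn (orient \<gamma> (\<phi> s) (\<phi> t))"
      using sphere_isotopy_orient[OF H ig g] by blast
    have tan: "tangent \<delta> u = \<phi>' u *\<^sub>R D (tangent \<gamma> (\<phi> u))" if "\<gamma> (\<phi> u) = \<gamma> (\<phi> s)" for u
    proof -
      have "((\<lambda>u. H (1, \<gamma> u)) has_vector_derivative D (tangent \<gamma> (\<phi> u))) (at (\<phi> u))"
        using D(1)[of "\<phi> u"] that by auto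
      moreover have "(\<phi> has_vector_derivative \<phi>' u) (at u)"
        using \<phi>'(1) by (simp add: has_real_derivative_iff_has_vector_derivative)
      ultimately have "(\<delta> has_vector_derivative \<phi>' u *\<^sub>R D (tangent \<gamma> (\<phi> u))) (at u)"
        using vector_diff_chain_at[of \<phi> "\<phi>' u" u "\<lambda>u. H (1, \<gamma> u)"] by (simp add: \<delta>[abs_def] comp_def)
      then show ?thesis by (rule vector_derivative_at)
    qed
    have *: "orient \<delta> s t = (\<phi>' s * \<phi>' t) * (H (1, \<gamma> (\<phi> s)) \<bullet> cross3 (D (tangent \<gamma> (\<phi> s))) (D (tangent \<gamma> (\<phi> t))))"
      unfolding orient_def \<delta> tan[OF refl] tan[OF g[symmetric]]
      by (simp add: cross_mult_left cross_mult_right)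
    then have "\<phi>' s * \<phi>' t \<noteq> 0" using doodle_orient_nonzero[OF dd c] by auto
    moreover have "\<phi>' s * \<phi>' t \<ge> 0" using \<phi>'(2) by simp
    ultimately have "sgn (\<phi>' s * \<phi>' t) = 1" unfolding sgn_1_pos by linarith
    then show ?thesis unfolding * using D(2) o by (simp only: sgn_mult[of "\<phi>' s * \<phi>' t"])
  qed
  define f where "f = map_prod (circle_map \<phi>) (circle_map \<phi>)"
  have "arrows \<gamma> = f ` arrows \<delta>"
  proof
    show "f ` arrows \<delta> \<subseteq> arrows \<gamma>"
      using cr sg by (auto simp: f_def arrows_iff) (metis sgn_1_pos)
    show "arrows \<gamma> \<subseteq> f ` arrows \<delta>"
    proof
      fix e assume e: "e \<in> arrows \<gamma>"
      obtain a b where ab: "e = (a, b)" "crossing \<gamma> a b" "orient \<gamma> a b > 0"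
        using e by (cases e) (auto simp: arrows_iff)
      define s where "s = circle_map (inv \<phi>) a"
      define t where "t = circle_map (inv \<phi>) b"
      have "inv (inv \<phi>) = \<phi>" using \<phi> by (simp add: circle_diffeo_def inv_inv_eq)
      then have st: "circle_map \<phi> s = a" "circle_map \<phi> t = b"
        using circle_map_inv[OF circle_diffeo_inv[OF \<phi>]] ab(2) by (simp_all add: s_def t_def crossing_def)
      then have "\<gamma> (\<phi> s) = \<gamma> (\<phi> t)"
        using ab(2) by (auto simp: crossing_def circle_map_def immersed_curve_frac[OF ig])
      then have "crossing \<delta> s t"
        using st ab(2) eq by (auto simp: crossing_def s_def t_def circle_map_def frac_lt_1)
      then show "e \<in> f ` arrows \<delta>"
        using sg[of s t] st ab(1,3)
        by (intro image_eqI[of _ _ "(s, t)"]) (auto simp: f_def arrows_iff sgn_1_pos)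
    qed
  qed
  then have "arrow_equiv (arrows \<delta>) (arrows \<gamma>)"
    using is_arrow_diagram_arrows dg dd \<phi> unfolding arrow_equiv_def f_def by blast
  then show ?thesis unfolding diagram_of_def by (metis abs_arrow_diagram_eqI)
qed


section \<open>The moves \<open>R\<^sub>1\<close> and \<open>R\<^sub>2\<close>\<close>

lemma periodic_iff: "t \<in> periodic J \<longleftrightarrow> (\<exists>k::int. t - of_int k \<in> J)"
proof
  assume "t \<in> periodic J"
  then obtain u k where "t = u + of_int k" "u \<in> J" by (auto simp: periodic_def)
  then show "\<exists>k::int. t - of_int k \<in> J" by (intro exI[of _ k]) simp
next
  assume "\<exists>k::int. t - of_int k \<in> J"
  then obtain k :: int where "t - of_int k \<in> J" by blast
  then show "t \<in> periodic J"
    unfolding periodic_def by (intro CollectI exI[of _ "t - of_int k"] exI[of _ k]) simp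
qed

lemma periodic_add_of_int: "t + of_int k \<in> periodic J \<longleftrightarrow> t \<in> periodic J"
proof
  assume "t + of_int k \<in> periodic J"
  then obtain m :: int where "t + of_int k - of_int m \<in> J" unfolding periodic_iff by blast
  then show "t \<in> periodic J" unfolding periodic_iff by (intro exI[of _ "m - k"]) (simp add: algebra_simps)
next
  assume "t \<in> periodic J"
  then obtain m :: int where "t - of_int m \<in> J" unfolding periodic_iff by blast
  then show "t + of_int k \<in> periodic J" unfolding periodic_iff by (intro exI[of _ "m + k"]) simp
qed

lemma periodic_frac: "frac t \<in> periodic J \<longleftrightarrow> t \<in> periodic J"
  using periodic_add_of_int[of t "- \<lfloor>t\<rfloor>"] by (simp add: frac_def)

lemma periodic_mono: "J \<subseteq> K \<Longrightarrow> periodic J \<subseteq> periodic K"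
  by (auto simp: periodic_def)

lemma periodic_lift:
  assumes "t \<in> periodic J"
  obtains u where "u \<in> J" "frac u = frac t" "\<exists>k::int. t = u + of_int k"
proof -
  obtain u k where u: "u \<in> J" "t = u + of_int k" using assms by (auto simp: periodic_def)
  moreover have "frac u = frac t" using u(2) by (simp add: frac_def)
  ultimately show ?thesis using that by blast
qed

lemma frac_eq_of_int: "frac (u :: real) = frac t \<longleftrightarrow> (\<exists>k::int. u = t + of_int k)"
proof
  assume "frac u = frac t"
  then have "u = t + of_int (\<lfloor>u\<rfloor> - \<lfloor>t\<rfloor>)" by (simp add: frac_def)
  then show "\<exists>k::int. u = t + of_int k" by blast
qed (auto simp: frac_def)

lemma frac_eq_near:
  fixes u t :: real
  assumes "frac u = frac t" "\<bar>u - t\<bar> < 1" shows "u = t"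
proof -
  obtain k :: int where k: "u = t + of_int k" using assms(1) frac_eq_of_int by blast
  then have "\<bar>of_int k :: real\<bar> < 1" using assms(2) by simp
  then have "k = 0" by linarith
  then show ?thesis using k by simp
qed

text \<open>The translates of \<open>{a..b}\<close> leave open gaps because
  \<open>b < a + 1\<close>. An open neighbourhood is what the comparison of tangents
  requires.\<close>

lemma open_compl_periodic:
  assumes "a \<le> b" "b < a + 1" "t \<notin> periodic {a..b}"
  obtains T where "open T" "t \<in> T" "T \<inter> periodic {a..b} = {}"
proof -
  \<comment> \<open>Subtracting \<open>m\<close> brings \<open>t\<close> into
    \<open>{b..<b + 1}\<close>, right after one translate of the arc.\<close>
  define m where "m = \<lfloor>t - b\<rfloor>"
  define u where "u = t - of_int m"
  have u: "b \<le> u" "u < b + 1" by (auto simp: u_def m_def) linarith+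
  have "u - of_int k \<notin> {a..b}" for k :: int
  proof
    assume "u - of_int k \<in> {a..b}"
    then have "t - of_int (m + k) \<in> {a..b}" by (simp add: u_def algebra_simps)
    then show False using assms(3) periodic_iff by blast
  qed
  from this[of 0] this[of 1] u assms(1) have u': "b < u" "u < a + 1" by auto
  define T where "T = {b + of_int m<..<a + 1 + of_int m}"
  have "v \<notin> periodic {a..b}" if "v \<in> T" for v
  proof
    assume "v \<in> periodic {a..b}"
    then obtain k :: int where k: "v - of_int k \<in> {a..b}" unfolding periodic_iff by blast
    then have "of_int k > (of_int m :: real)" "of_int k < (of_int (m + 1) :: real)"
      using that by (auto simp: T_def)
    then have "m < k" "k < m + 1" by (simp_all only: of_int_less_iff)
    then show False by linarith
  qed
  moreover have "t \<in> T" using u' by (auto simp: T_def u_def)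
  moreover have "open T" by (simp add: T_def)
  ultimately show ?thesis using that[of T] by blast
qed

lemma tangent_cong_open:
  assumes "immersed_curve \<gamma>" "open T" "t \<in> T" "\<And>u. u \<in> T \<Longrightarrow> \<delta> u = \<gamma> u"
  shows "tangent \<delta> t = tangent \<gamma> t"
proof -
  have "(\<delta> has_vector_derivative tangent \<gamma> t) (at t)"
    by (rule has_vector_derivative_transform_within_open[OF immersed_curve_deriv[OF assms(1)] assms(2,3)])
       (simp add: assms(4))
  then show ?thesis by (rule vector_derivative_at)
qed

lemma tangent_cong_periodic:
  assumes "immersed_curve \<gamma>" "\<And>t. t \<notin> periodic {a..b} \<Longrightarrow> \<delta> t = \<gamma> t"
    "a \<le> b" "b < a + 1" "t \<notin> periodic {a..b}"
  shows "tangent \<delta> t = tangent \<gamma> t"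
proof -
  obtain T where "open T" "t \<in> T" "T \<inter> periodic {a..b} = {}"
    using open_compl_periodic[OF assms(3-5)] .
  then show ?thesis using assms(2) by (intro tangent_cong_open[OF assms(1)]) auto
qed

text \<open>\<open>circle_arc\<close> works with representatives in \<open>{0..<1}\<close>, so the
  cases are whether the floors of \<open>s\<close> and \<open>t\<close> agree or differ by
  one.\<close>

lemma circle_arc_subset:
  assumes "s < t" "t < s + 1"
  shows "circle_arc (frac s) (frac t) \<subseteq> frac ` {s<..<t}"
proof
  fix v assume v: "v \<in> circle_arc (frac s) (frac t)"
  have v01: "0 \<le> v" "v < 1"
  proof -
    have "frac s < v \<and> v < frac t \<or> frac s < v \<and> v < 1 \<or> 0 \<le> v \<and> v < frac t"
      using v by (auto simp: circle_arc_def split: if_splits)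
    then show "0 \<le> v" "v < 1"
      using frac_ge_0[of s] frac_lt_1[of s] frac_ge_0[of t] frac_lt_1[of t] by linarith+
  qed
  have fl: "\<lfloor>t\<rfloor> = \<lfloor>s\<rfloor> \<or> \<lfloor>t\<rfloor> = \<lfloor>s\<rfloor> + 1" using assms by linarith
  have st: "s = frac s + of_int \<lfloor>s\<rfloor>" "t = frac t + of_int \<lfloor>t\<rfloor>" by (simp_all add: frac_def)
  have img: "v \<in> frac ` {s<..<t}" if "s < v + of_int k" "v + of_int k < t" for k :: int
    using that v01 by (intro image_eqI[of _ _ "v + of_int k"]) (simp_all add: frac_eq)
  show "v \<in> frac ` {s<..<t}"
  proof (cases "frac s < frac t")
    case True
    then have "\<lfloor>t\<rfloor> = \<lfloor>s\<rfloor>" using fl st assms by auto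
    then show ?thesis using img[of "\<lfloor>s\<rfloor>"] v True st by (auto simp: circle_arc_def)
  next
    case False
    then have ft: "\<lfloor>t\<rfloor> = \<lfloor>s\<rfloor> + 1" using fl st assms by auto
    from v False consider "frac s < v" | "v < frac t" by (auto simp: circle_arc_def)
    then show ?thesis
    proof cases
      case 1
      have "v + of_int \<lfloor>s\<rfloor> < t" using v01 st(2) ft frac_ge_0[of t] by linarith
      moreover have "s < v + of_int \<lfloor>s\<rfloor>" using 1 st(1) by linarith
      ultimately show ?thesis using img by blast
    next
      case 2
      have "v + of_int \<lfloor>t\<rfloor> < t" using 2 st(2) by linarith
      moreover have "s < v + of_int \<lfloor>t\<rfloor>" using v01 st(1) ft frac_lt_1[of s] by linarith
      ultimately show ?thesis using img by blast
    qed
  qed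
qed

text \<open>Moves are described on an interval of parameters that may contain an integer; this
  transfers adjacency from there to the representatives in \<open>{0..<1}\<close>.\<close>

lemma adjacent_inI:
  assumes "frac s \<in> endpoints A" "frac t \<in> endpoints A" "s \<noteq> t" "\<bar>s - t\<bar> < 1"
    "\<And>u. min s t < u \<Longrightarrow> u < max s t \<Longrightarrow> frac u \<notin> endpoints A"
  shows "adjacent_in A (frac s) (frac t)"
proof -
  have "frac s \<noteq> frac t" using frac_eq_near assms(3,4) by blast
  moreover have "circle_arc (frac s) (frac t) \<inter> endpoints A = {} \<or> circle_arc (frac t) (frac s) \<inter> endpoints A = {}"
  proof (cases "s < t")
    case True
    then have "circle_arc (frac s) (frac t) \<subseteq> frac ` {s<..<t}" using assms(4) by (intro circle_arc_subset) auto
    then show ?thesis using assms(5) True by fastforce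
  next
    case False
    then have "circle_arc (frac t) (frac s) \<subseteq> frac ` {t<..<s}" using assms(3,4) by (intro circle_arc_subset) auto
    then show ?thesis using assms(5) False by fastforce
  qed
  ultimately show ?thesis using assms(1,2) by (simp add: adjacent_in_def)
qed

lemma endpoints_arrows:
  assumes "doodle \<gamma>"
  shows "endpoints (arrows \<gamma>) = {s. \<exists>t. crossing \<gamma> s t}"
proof
  show "endpoints (arrows \<gamma>) \<subseteq> {s. \<exists>t. crossing \<gamma> s t}"
  proof
    fix s assume "s \<in> endpoints (arrows \<gamma>)"
    then obtain t where "(s, t) \<in> arrows \<gamma> \<or> (t, s) \<in> arrows \<gamma>" unfolding endpoints_def by fastforce
    then have "crossing \<gamma> s t \<or> crossing \<gamma> t s" by (auto simp: arrows_iff)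
    then show "s \<in> {s. \<exists>t. crossing \<gamma> s t}" using crossing_sym by blast
  qed
  show "{s. \<exists>t. crossing \<gamma> s t} \<subseteq> endpoints (arrows \<gamma>)"
  proof
    fix s assume "s \<in> {s. \<exists>t. crossing \<gamma> s t}"
    then obtain t where c: "crossing \<gamma> s t" by blast
    have "orient \<gamma> t s = - orient \<gamma> s t" using c by (intro orient_swap) (simp add: crossing_def)
    then have "(s, t) \<in> arrows \<gamma> \<or> (t, s) \<in> arrows \<gamma>"
      using doodle_orient_nonzero[OF assms c] c crossing_sym[OF c] by (auto simp: arrows_iff)
    then show "s \<in> endpoints (arrows \<gamma>)" by (force simp: endpoints_def)
  qed
qed

text \<open>Outside the disc the two curves have the same values and tangents, so the arrow sets
  agree literally there. Inside, the only arrow joins the two parameters of the crossing, both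
  lifted into the single arc \<open>{a<..<b}\<close>; an endpoint between them would be a further
  parameter of a crossing in the disc, so the arrow is isolated.\<close>

lemma R1_move_I_alg:
  assumes "R1_move \<gamma> \<delta>"
  shows "I_alg (diag (diagram_of \<gamma>)) = I_alg (diag (diagram_of \<delta>))"
proof -
  obtain \<psi> a b a' b' where dg: "doodle \<gamma>" and dd: "doodle \<delta>" and ab: "a < a'" "a' < b'" "b' < b" "b \<le> a + 1"
    and gU: "{t. \<gamma> t \<in> \<psi> ` square} = periodic {a<..<b}"
    and dU: "{t. \<delta> t \<in> \<psi> ` square} = periodic {a<..<b}"
    and eq': "\<forall>t. t \<notin> periodic {a'..b'} \<longrightarrow> \<delta> t = \<gamma> t"
    and one: "card (self_intersections \<gamma> \<inter> \<psi> ` square) = 1"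
    and none: "self_intersections \<delta> \<inter> \<psi> ` square = {}"
    using assms unfolding R1_move_def by (elim conjE exE) (rule that)
  have eq: "\<And>t. t \<notin> periodic {a'..b'} \<Longrightarrow> \<delta> t = \<gamma> t" using eq' by blast
  define U where "U = \<psi> ` square"
  have gU': "\<gamma> u \<in> U \<longleftrightarrow> u \<in> periodic {a<..<b}" for u
    using gU unfolding U_def by blast
  have dU': "\<delta> u \<in> U \<longleftrightarrow> u \<in> periodic {a<..<b}" for u
    using dU unfolding U_def by blast
  note ig = doodle_immersed[OF dg] and id = doodle_immersed[OF dd]
  obtain x where x: "self_intersections \<gamma> \<inter> U = {x}"
    using one by (auto simp: U_def card_1_singleton_iff)
  then have xs: "x \<in> self_intersections \<gamma>" "x \<in> U" by auto
  then have "card (branches \<gamma> x) = 2" using dg by (simp add: doodle_def)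
  then obtain s0 t0 where st0: "branches \<gamma> x = {s0, t0}" "s0 \<noteq> t0" by (auto simp: card_2_iff)
  then have c0: "crossing \<gamma> s0 t0" using xs by (auto simp: crossing_branches)
  have "orient \<gamma> t0 s0 = - orient \<gamma> s0 t0"
    using c0 by (intro orient_swap) (simp add: crossing_def)
  then have "(s0, t0) \<in> arrows \<gamma> \<or> (t0, s0) \<in> arrows \<gamma>"
    using doodle_orient_nonzero[OF dg c0] c0 crossing_sym[OF c0] by (auto simp: arrows_iff)
  then obtain s t where e: "(s, t) \<in> arrows \<gamma>" and st: "branches \<gamma> x = {s, t}"
    using st0 by blast
  have cst: "crossing \<gamma> s t" using e by (simp add: arrows_iff)
  have inU: "{u, v} = {s, t}" if "crossing \<gamma> u v" "\<gamma> u \<in> U" for u v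
  proof -
    have "\<gamma> u = x" using self_intersectionI[OF that(1)] that(2) x by blast
    then have "u \<in> branches \<gamma> x" "v \<in> branches \<gamma> x" "u \<noteq> v" using that(1) by (auto simp: crossing_def branches_def)
    then show ?thesis using st by auto
  qed
  have "s \<in> branches \<gamma> x" "t \<in> branches \<gamma> x" using st by simp_all
  then have stU: "\<gamma> s \<in> U" "\<gamma> t \<in> U" using xs(2) by (simp_all add: branches_def)
  have out: "u \<notin> periodic {a'..b'}" if "\<gamma> u \<notin> U \<or> \<delta> u \<notin> U" for u
  proof -
    have "u \<notin> periodic {a<..<b}" using that gU' dU' by blast
    moreover have "{a'..b'} \<subseteq> {a<..<b}" using ab by auto
    ultimately show ?thesis using periodic_mono by blast
  qed
  have UU: "\<gamma> u \<in> U \<longleftrightarrow> \<delta> u \<in> U" for u using gU' dU' by blast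
  have ot: "crossing \<delta> u v \<longleftrightarrow> crossing \<gamma> u v" "orient \<delta> u v = orient \<gamma> u v"
    if "\<gamma> u \<notin> U" "\<gamma> v \<notin> U" for u v
  proof -
    have "\<delta> w = \<gamma> w \<and> tangent \<delta> w = tangent \<gamma> w" if "\<gamma> w \<notin> U" for w
    proof
      have w: "w \<notin> periodic {a'..b'}" using that out by blast
      then show "\<delta> w = \<gamma> w" by (rule eq)
      show "tangent \<delta> w = tangent \<gamma> w"
        by (rule tangent_cong_periodic[OF ig eq]) (use ab w in auto)
    qed
    then have "\<delta> u = \<gamma> u" "\<delta> v = \<gamma> v" "tangent \<delta> u = tangent \<gamma> u" "tangent \<delta> v = tangent \<gamma> v"
      using that by blast+
    then show "crossing \<delta> u v \<longleftrightarrow> crossing \<gamma> u v" "orient \<delta> u v = orient \<gamma> u v"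
      by (simp_all add: crossing_def orient_def)
  qed
  have "arrows \<delta> = arrows \<gamma> - {(s, t)}"
  proof (rule set_eqI, clarify)
    fix u v
    show "(u, v) \<in> arrows \<delta> \<longleftrightarrow> (u, v) \<in> arrows \<gamma> - {(s, t)}"
    proof (cases "\<gamma> u \<in> U")
      case True
      have "\<not> crossing \<delta> u v" using True UU none self_intersectionI unfolding U_def by blast
      then have "(u, v) \<notin> arrows \<delta>" by (simp add: arrows_iff)
      moreover have "(u, v) = (s, t)" if "(u, v) \<in> arrows \<gamma>"
      proof (rule ccontr)
        assume "(u, v) \<noteq> (s, t)"
        have "crossing \<gamma> u v" using that by (simp add: arrows_iff)
        from inU[OF this True] \<open>(u, v) \<noteq> (s, t)\<close> have "u = t" "v = s" by (auto simp: doubleton_eq_iff)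
        then have "orient \<gamma> t s > 0" using that by (simp add: arrows_iff)
        moreover have "orient \<gamma> t s = - orient \<gamma> s t" using cst by (intro orient_swap) (simp add: crossing_def)
        ultimately show False using e by (simp add: arrows_iff)
      qed
      ultimately show ?thesis by blast
    next
      case False
      show ?thesis
      proof (cases "\<gamma> v \<in> U")
        case True
        then have "\<gamma> u \<noteq> \<gamma> v" "\<delta> u \<noteq> \<delta> v" using False UU by metis+
        then show ?thesis by (auto simp: arrows_iff crossing_def)
      next
        case v: False
        have "(u, v) \<noteq> (s, t)" using False stU by blast
        then show ?thesis using ot[OF False v] by (simp add: arrows_iff)
      qed
    qed
  qed
  moreover have "isolated_arrow (arrows \<gamma>) (s, t)"
  proof -
    have "s \<in> periodic {a<..<b}" "t \<in> periodic {a<..<b}" using stU gU' by blast+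
    then obtain s' t' where s': "s' \<in> {a<..<b}" "frac s' = frac s" and t': "t' \<in> {a<..<b}" "frac t' = frac t"
      by (metis periodic_lift)
    have fr: "frac s = s" "frac t = t" using cst by (auto simp: crossing_def frac_eq)
    have ne: "s' \<noteq> t'" using s' t' fr cst by (auto simp: crossing_def)
    have "adjacent_in (arrows \<gamma>) (frac s') (frac t')"
    proof (rule adjacent_inI)
      show "frac s' \<in> endpoints (arrows \<gamma>)" "frac t' \<in> endpoints (arrows \<gamma>)"
        using endpoints_arrows[OF dg] cst crossing_sym[OF cst] s'(2) t'(2) fr by auto
      show "s' \<noteq> t'" by fact
      show "\<bar>s' - t'\<bar> < 1" using s' t' ab by auto
      fix u assume u: "min s' t' < u" "u < max s' t'"
      show "frac u \<notin> endpoints (arrows \<gamma>)"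
      proof
        assume "frac u \<in> endpoints (arrows \<gamma>)"
        then obtain w where w: "crossing \<gamma> (frac u) w" using endpoints_arrows[OF dg] by auto
        have "u \<in> {a<..<b}" using u s' t' by auto
        then have "u \<in> periodic {a<..<b}" unfolding periodic_iff by (intro exI[of _ 0]) simp
        then have "\<gamma> (frac u) \<in> U" using gU' by (simp add: immersed_curve_frac[OF ig])
        from inU[OF w this] have "frac u = frac s' \<or> frac u = frac t'" using fr s' t' by auto
        moreover have "\<bar>u - s'\<bar> < 1" "\<bar>u - t'\<bar> < 1" using \<open>u \<in> {a<..<b}\<close> s' t' ab by auto
        ultimately have "u = s' \<or> u = t'" using frac_eq_near by blast
        then show False using u by auto
      qed
    qed
    then show ?thesis using e s' t' fr by (simp add: isolated_arrow_def)
  qed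
  ultimately show ?thesis
    using I_alg_isolated[OF is_arrow_diagram_arrows[OF dg]] by (simp add: diagram_of_def)
qed

section \<open>Signs on intervals and in charts\<close>

lemma sgn_constant_on_interval:
  fixes f :: "real \<Rightarrow> real"
  assumes "a \<le> b" "continuous_on {a..b} f" "\<And>x. x \<in> {a..b} \<Longrightarrow> f x \<noteq> 0"
  shows "sgn (f a) = sgn (f b)"
proof (rule ccontr)
  assume "sgn (f a) \<noteq> sgn (f b)"
  moreover have "f a \<noteq> 0" "f b \<noteq> 0" using assms by auto
  ultimately have "(f a \<le> 0 \<and> 0 \<le> f b) \<or> (f b \<le> 0 \<and> 0 \<le> f a)"
    by (auto simp: sgn_if split: if_splits)
  then have "\<exists>x\<ge>a. x \<le> b \<and> f x = 0"
    using IVT'[of f a 0 b] IVT2'[of f b 0 a] assms(1,2) by auto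
  then show False using assms(3) by auto
qed

lemma sgn_constant_on_open_interval:
  fixes f :: "real \<Rightarrow> real"
  assumes "continuous_on {a<..<b} f" "\<And>x. x \<in> {a<..<b} \<Longrightarrow> f x \<noteq> 0" "x \<in> {a<..<b}" "y \<in> {a<..<b}"
  shows "sgn (f x) = sgn (f y)"
proof -
  have *: "sgn (f x) = sgn (f y)" if "x \<in> {a<..<b}" "y \<in> {a<..<b}" "x \<le> y" for x y
  proof (rule sgn_constant_on_interval[OF that(3)])
    have sub: "{x..y} \<subseteq> {a<..<b}" using that by auto
    show "continuous_on {x..y} f" using assms(1) sub by (rule continuous_on_subset)
    show "f z \<noteq> 0" if "z \<in> {x..y}" for z using assms(2) sub that by blast
  qed
  show ?thesis
  proof (cases "x \<le> y")
    case True
    then show ?thesis by (rule *[OF assms(3,4)])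
  next
    case False
    then show ?thesis using *[OF assms(4,3)] by simp
  qed
qed

lemma sgn_eq_mult_pos:
  fixes a b :: real
  assumes "sgn a = sgn b" "a \<noteq> 0" shows "a * b > 0"
  using assms by (cases a "0::real" rule: linorder_cases; cases b "0::real" rule: linorder_cases)
    (auto simp: mult_neg_neg)

lemma smooth_on_real_deriv:
  fixes f :: "real \<Rightarrow> real"
  assumes "smooth_on S f" "open S"
  obtains d where "\<And>x. x \<in> S \<Longrightarrow> (f has_real_derivative d x) (at x)" "continuous_on S d"
proof -
  obtain f' where f': "\<And>x. x \<in> S \<Longrightarrow> (f has_derivative f' x) (at x)" "\<And>v. continuous_on S (\<lambda>x. f' x v)"
    by (rule smooth_on_open_C1[OF assms]) blast
  have "(f has_real_derivative f' x 1) (at x)" if "x \<in> S" for x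
  proof -
    have "f' x = (*) (f' x 1)"
    proof
      fix v
      have "linear (f' x)" using f'(1)[OF that] has_derivative_linear by blast
      from linear_scale[OF this, of v 1] show "f' x v = f' x 1 * v" by (simp add: mult.commute)
    qed
    then show ?thesis using f'(1)[OF that] by (metis has_field_derivative_def)
  qed
  then show ?thesis using that[of "\<lambda>x. f' x 1"] f'(2)[of 1] by blast
qed

text \<open>The factor \<open>\<sigma>\<close> treats increasing and decreasing parametrizations
  alike.\<close>

lemma deriv_nonzero_strict_mono:
  fixes u d :: "real \<Rightarrow> real"
  assumes d: "\<And>t. t \<in> {a<..<b} \<Longrightarrow> (u has_real_derivative d t) (at t)" "continuous_on {a<..<b} d"
    "\<And>t. t \<in> {a<..<b} \<Longrightarrow> d t \<noteq> 0"
  obtains \<sigma> :: real where "\<sigma> = 1 \<or> \<sigma> = -1" "\<And>t. t \<in> {a<..<b} \<Longrightarrow> \<sigma> * d t > 0"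
    "\<And>s t. s \<in> {a<..<b} \<Longrightarrow> t \<in> {a<..<b} \<Longrightarrow> s < t \<Longrightarrow> \<sigma> * u s < \<sigma> * u t"
proof (cases "a < b")
  case False
  then show ?thesis using that[of 1] by auto
next
  case True
  define m where "m = (a + b) / 2"
  have m: "m \<in> {a<..<b}" using True by (auto simp: m_def)
  define \<sigma> where "\<sigma> = sgn (d m)"
  have 1: "\<sigma> = 1 \<or> \<sigma> = -1" using d(3)[OF m] by (auto simp: \<sigma>_def sgn_if)
  have 2: "\<sigma> * d t > 0" if "t \<in> {a<..<b}" for t
  proof -
    have "\<sigma> = sgn (d t)" unfolding \<sigma>_def using sgn_constant_on_open_interval[OF d(2,3) m that] .
    then show ?thesis using d(3)[OF that] by (simp add: sgn_if)
  qed
  have 3: "\<sigma> * u s < \<sigma> * u t" if "s \<in> {a<..<b}" "t \<in> {a<..<b}" "s < t" for s t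
  proof (rule DERIV_pos_imp_increasing[OF that(3)])
    fix x assume "s \<le> x" "x \<le> t"
    then have x: "x \<in> {a<..<b}" using that by auto
    show "\<exists>y. ((\<lambda>t. \<sigma> * u t) has_real_derivative y) (at x) \<and> 0 < y"
      using DERIV_cmult[OF d(1)[OF x], of \<sigma>] 2[OF x] by blast
  qed
  show ?thesis using that[OF 1 2 3] .
qed

text \<open>The triple product is the Jacobian of the chart with respect to the orientation of the
  sphere. The partial derivatives are tangent to the sphere and independent, so it cannot vanish;
  its sign is left open because a chart may reverse orientation.\<close>

lemma sphere_chart_derivative:
  assumes "sphere_chart \<psi>"
  obtains D where "\<And>p. p \<in> square \<Longrightarrow> (\<psi> has_derivative D p) (at p)"
    "\<And>v. continuous_on square (\<lambda>p. D p v)" "\<And>p. p \<in> square \<Longrightarrow> linear (D p)"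
    "\<And>p. p \<in> square \<Longrightarrow> \<psi> p \<bullet> cross3 (D p (1, 0)) (D p (0, 1)) \<noteq> 0"
proof -
  have op: "open square" unfolding square_def by (intro open_Times open_greaterThanLessThan)
  have sm: "smooth_on square \<psi>" using assms by (simp add: sphere_chart_def)
  obtain D where D: "\<And>p. p \<in> square \<Longrightarrow> (\<psi> has_derivative D p) (at p)"
    "\<And>v. continuous_on square (\<lambda>p. D p v)"
    by (rule smooth_on_open_C1[OF sm op]) blast
  have lin: "linear (D p)" if "p \<in> square" for p using D(1)[OF that] has_derivative_linear by blast
  have "\<psi> p \<bullet> cross3 (D p (1, 0)) (D p (0, 1)) \<noteq> 0" if p: "p \<in> square" for p
  proof -
    have S: "\<psi> q \<in> S2" if "q \<in> square" for q using assms that by (auto simp: sphere_chart_def)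
    have orth: "\<psi> p \<bullet> D p v = 0" for v
    proof -
      have "((\<lambda>q. \<psi> q \<bullet> \<psi> q) has_derivative (\<lambda>v. \<psi> p \<bullet> D p v + D p v \<bullet> \<psi> p)) (at p)"
        using has_derivative_inner[OF D(1)[OF p] D(1)[OF p]] .
      then have "((\<lambda>q. 1::real) has_derivative (\<lambda>v. \<psi> p \<bullet> D p v + D p v \<bullet> \<psi> p)) (at p)"
        by (rule has_derivative_transform_within_open[OF _ op p]) (use S in \<open>auto simp: norm_eq_1\<close>)
      then have "(\<lambda>v. \<psi> p \<bullet> D p v + D p v \<bullet> \<psi> p) = (\<lambda>v. 0)"
        using has_derivative_unique has_derivative_const by blast
      then have "\<psi> p \<bullet> D p v + D p v \<bullet> \<psi> p = 0" by metis
      then show ?thesis by (simp add: inner_commute)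
    qed
    have "D p = frechet_derivative \<psi> (at p)" using frechet_derivative_at[OF D(1)[OF p]] .
    then have inj: "inj (D p)" using assms p by (simp add: sphere_chart_def)
    have eq: "x = y" if "D p x = D p y" for x y using inj that by (simp add: inj_eq)
    have "\<not> collinear {0, D p (1, 0), D p (0, 1)}"
    proof
      assume "collinear {0, D p (1, 0), D p (0, 1)}"
      then consider "D p (1, 0) = 0" | "D p (0, 1) = 0" | c where "D p (0, 1) = c *\<^sub>R D p (1, 0)"
        unfolding collinear_lemma by blast
      then show False
      proof cases
        case 1
        then have "D p (1, 0) = D p 0" using linear_0[OF lin[OF p]] by simp
        from eq[OF this] show False by (simp add: zero_prod_def)
      next
        case 2
        then have "D p (0, 1) = D p 0" using linear_0[OF lin[OF p]] by simp
        from eq[OF this] show False by (simp add: zero_prod_def)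
      next
        case 3
        then have "D p (0, 1) = D p (c *\<^sub>R (1, 0))" using linear_scale[OF lin[OF p], of c "(1, 0)"] by simp
        from eq[OF this] show False by simp
      qed
    qed
    then show ?thesis using triple_product_nonzero_iff[OF S[OF p] orth orth] by blast
  qed
  then show ?thesis using that D lin by blast
qed

lemma tangent_in_chart:
  assumes "(\<psi> has_derivative D) (at (c t))" "(c has_vector_derivative v) (at t)" "open T" "t \<in> T"
    "\<And>u. u \<in> T \<Longrightarrow> \<gamma> u = \<psi> (c u)"
  shows "tangent \<gamma> t = D v"
proof -
  have "((\<lambda>u. \<psi> (c u)) has_vector_derivative D v) (at t)"
    by (rule has_derivative_along_curve[OF assms(1,2)])
  then have "(\<gamma> has_vector_derivative D v) (at t)"
    by (rule has_vector_derivative_transform_within_open[OF _ assms(3,4)]) (simp add: assms(5))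
  then show ?thesis by (rule vector_derivative_at)
qed

text \<open>If both slopes had the same sign, the function would have opposite signs just after
  \<open>z1\<close> and just before \<open>z2\<close>, and so another zero in between.\<close>

lemma consecutive_zeros_deriv:
  fixes h :: "real \<Rightarrow> real"
  assumes z: "z1 < z2" "{z1..z2} \<subseteq> S" "h z1 = 0" "h z2 = 0" and cont: "continuous_on S h"
    and nz: "\<And>z. z1 < z \<Longrightarrow> z < z2 \<Longrightarrow> h z \<noteq> 0"
    and d: "(h has_real_derivative d1) (at z1)" "(h has_real_derivative d2) (at z2)" "d1 \<noteq> 0" "d2 \<noteq> 0"
  shows "d1 * d2 < 0"
proof (rule ccontr)
  assume "\<not> d1 * d2 < 0"
  then have pos: "d1 * d2 > 0" using d by (metis linorder_neqE_linordered_idom mult_eq_0_iff)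
  define g where "g x = sgn d1 * h x" for x
  have "0 < d1 \<and> 0 < d2 \<or> d1 < 0 \<and> d2 < 0" using pos by (simp only: zero_less_mult_iff)
  then have p: "sgn d1 * d1 > 0" "sgn d1 * d2 > 0" by (elim disjE; simp)+
  have d': "(g has_real_derivative sgn d1 * d1) (at z1)" "(g has_real_derivative sgn d1 * d2) (at z2)"
    unfolding g_def[abs_def] using d(1,2) by (auto intro: DERIV_cmult)
  obtain r1 where r1: "r1 > 0" "\<And>k. k > 0 \<Longrightarrow> k < r1 \<Longrightarrow> g z1 < g (z1 + k)"
    using DERIV_pos_inc_right[OF d'(1) p(1)] by blast
  obtain r2 where r2: "r2 > 0" "\<And>k. k > 0 \<Longrightarrow> k < r2 \<Longrightarrow> g (z2 - k) < g z2"
    using DERIV_pos_inc_left[OF d'(2) p(2)] by blast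
  \<comment> \<open>A third of the smallest length keeps \<open>z1 + k\<close> to the left of
    \<open>z2 - k\<close> and both within the ranges of \<open>r1\<close> and
    \<open>r2\<close>.\<close>
  define k where "k = min (min r1 r2) (z2 - z1) / 3"
  have k: "k > 0" "k < r1" "k < r2" "k < (z2 - z1) / 2" using r1(1) r2(1) z(1) by (auto simp: k_def min_def)
  have "g (z2 - k) \<le> 0" "0 \<le> g (z1 + k)" using r1(2)[of k] r2(2)[of k] k z(3,4) by (auto simp: g_def)
  moreover have "continuous_on {z1 + k..z2 - k} g"
  proof -
    have sub: "{z1 + k..z2 - k} \<subseteq> S" using z(2) k(1) by (intro order.trans[OF _ z(2)]) auto
    show ?thesis unfolding g_def[abs_def] by (intro continuous_intros continuous_on_subset[OF cont sub])
  qed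
  moreover have "z1 + k \<le> z2 - k" using k(4) by (simp add: field_simps)
  ultimately obtain x where "z1 + k \<le> x" "x \<le> z2 - k" "g x = 0"
    using IVT2'[of g "z2 - k" 0 "z1 + k"] by blast
  then show False using nz[of x] k d(3) by (auto simp: g_def sgn_zero_iff)
qed

text \<open>At a zero \<open>z\<close> of \<open>h\<close> the determinant of the two strands is the
  product of the derivatives of their coordinates \<open>u1\<close> and \<open>u2\<close>, of
  \<open>h' z\<close> and of the Jacobian of the chart. All factors but \<open>h'\<close> have the
  same sign at both zeros, while \<open>h'\<close> changes sign, so the two arrows run in opposite
  directions between the strands. No other crossing lies in the disc, which gives adjacency.\<close>

lemma R2_move_I_alg:
  assumes "R2_move \<gamma> \<delta>"
  shows "I_alg (diag (diagram_of \<gamma>)) = I_alg (diag (diagram_of \<delta>))"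
proof -
  obtain \<psi> a1 b1 a2 b2 u1 u2 h k c where dg: "doodle \<gamma>" and dd: "doodle \<delta>" and chart: "sphere_chart \<psi>"
    and ab: "a1 < b1" "b1 \<le> a2" "a2 < b2" "b2 \<le> a1 + 1"
    and gU: "{t. \<gamma> t \<in> \<psi> ` square} = periodic ({a1<..<b1} \<union> {a2<..<b2})"
    and eq': "\<forall>t. t \<notin> periodic {a2<..<b2} \<longrightarrow> \<delta> t = \<gamma> t"
    and u1: "smooth_on {a1<..<b1} u1" "bij_betw u1 {a1<..<b1} {-1<..<1}"
    and u2: "smooth_on {a2<..<b2} u2" "bij_betw u2 {a2<..<b2} {-1<..<1}"
    and h: "smooth_on {-1<..<1} h" "h ` {-1<..<1} \<subseteq> {-1<..<1}"
    and k: "smooth_on {-1<..<1} k" "k ` {-1<..<1} \<subseteq> {-1<..<1}"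
    and g1: "\<forall>t\<in>{a1<..<b1}. \<gamma> t = \<psi> (u1 t, 0)"
    and g2: "\<forall>t\<in>{a2<..<b2}. \<gamma> t = \<psi> (u2 t, h (u2 t))"
    and d2: "\<forall>t\<in>{a2<..<b2}. \<delta> t = \<psi> (u2 t, k (u2 t))"
    and c: "c < 1" "\<forall>u\<in>{-1<..<1}. c \<le> \<bar>u\<bar> \<longrightarrow> k u = h u"
    and zeros: "card {u \<in> {-1<..<1}. h u = 0} = 2"
    and kz: "\<forall>u\<in>{-1<..<1}. k u \<noteq> 0"
    using assms unfolding R2_move_def by (elim conjE exE) (rule that)
  define U where "U = \<psi> ` square"
  define I1 where "I1 = {a1<..<b1}"
  define I2 where "I2 = {a2<..<b2}"
  note ig = doodle_immersed[OF dg] and id = doodle_immersed[OF dd]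
  have gU': "\<gamma> t \<in> U \<longleftrightarrow> t \<in> periodic (I1 \<union> I2)" for t
    using gU unfolding U_def I1_def I2_def by blast
  have inj: "inj_on \<psi> square" using chart by (simp add: sphere_chart_def)
  have u1r: "u1 t \<in> {-1<..<1}" if "t \<in> I1" for t using u1(2) that bij_betwE unfolding I1_def by blast
  have u2r: "u2 t \<in> {-1<..<1}" if "t \<in> I2" for t using u2(2) that bij_betwE unfolding I2_def by blast
  have u1i: "s = t" if "s \<in> I1" "t \<in> I1" "u1 s = u1 t" for s t
    using u1(2) that unfolding I1_def bij_betw_def by (blast dest: inj_onD)
  have u2i: "s = t" if "s \<in> I2" "t \<in> I2" "u2 s = u2 t" for s t
    using u2(2) that unfolding I2_def bij_betw_def by (blast dest: inj_onD)
  have near: "\<bar>s - t\<bar> < 1" if "s \<in> I1 \<union> I2" "t \<in> I1 \<union> I2" for s t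
    using that ab by (auto simp: I1_def I2_def)
  have disj: "I1 \<inter> I2 = {}" using ab by (auto simp: I1_def I2_def)
  have sq: "(u, v) \<in> square \<longleftrightarrow> u \<in> {-1<..<1} \<and> v \<in> {-1<..<1}" for u v by (simp add: square_def)
  have \<psi>eq: "(u, v) = (u', v')" if "\<psi> (u, v) = \<psi> (u', v')" "(u, v) \<in> square" "(u', v') \<in> square" for u v u' v'
    using inj that by (rule inj_onD)
  obtain z1 z2 where z12: "{u \<in> {-1<..<1}. h u = 0} = {z1, z2}" "z1 < z2"
  proof -
    obtain x y where "{u \<in> {-1<..<1}. h u = 0} = {x, y}" "x \<noteq> y" using zeros card_2_iff by metis
    then show ?thesis using that[of x y] that[of y x] by (cases "x < y") (auto simp: insert_commute)
  qed
  have zr: "z1 \<in> {-1<..<1}" "h z1 = 0" "z2 \<in> {-1<..<1}" "h z2 = 0" using z12(1) by blast+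
  have hz: "z = z1 \<or> z = z2" if "z \<in> {-1<..<1}" "h z = 0" for z using z12(1) that by blast

  obtain D where D: "\<And>p. p \<in> square \<Longrightarrow> (\<psi> has_derivative D p) (at p)"
    "\<And>v. continuous_on square (\<lambda>p. D p v)" "\<And>p. p \<in> square \<Longrightarrow> linear (D p)"
    "\<And>p. p \<in> square \<Longrightarrow> \<psi> p \<bullet> cross3 (D p (1, 0)) (D p (0, 1)) \<noteq> 0"
    by (rule sphere_chart_derivative[OF chart]) blast
  obtain u1' where u1': "\<And>t. t \<in> I1 \<Longrightarrow> (u1 has_real_derivative u1' t) (at t)" "continuous_on I1 u1'"
    unfolding I1_def by (rule smooth_on_real_deriv[OF u1(1)]) auto
  obtain u2' where u2': "\<And>t. t \<in> I2 \<Longrightarrow> (u2 has_real_derivative u2' t) (at t)" "continuous_on I2 u2'"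
    unfolding I2_def by (rule smooth_on_real_deriv[OF u2(1)]) auto
  obtain h' where h': "\<And>u. u \<in> {-1<..<1} \<Longrightarrow> (h has_real_derivative h' u) (at u)"
    by (rule smooth_on_real_deriv[OF h(1)]) auto
  have op: "open I1" "open I2" by (auto simp: I1_def I2_def)
  have sq1: "(u1 t, 0) \<in> square" if "t \<in> I1" for t using u1r[OF that] by (simp add: sq)
  have sq2: "(u2 t, h (u2 t)) \<in> square" if "t \<in> I2" for t using u2r[OF that] h(2) sq by blast
  have sq3: "(u2 t, k (u2 t)) \<in> square" if "t \<in> I2" for t using u2r[OF that] k(2) sq by blast
  have tan1: "tangent \<gamma> t = u1' t *\<^sub>R D (u1 t, 0) (1, 0)" if t: "t \<in> I1" for t
  proof -
    have "((\<lambda>t. (u1 t, 0::real)) has_vector_derivative (u1' t, 0)) (at t)"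
      using u1'(1)[OF t] by (intro has_vector_derivative_Pair) (auto simp: has_real_derivative_iff_has_vector_derivative)
    from tangent_in_chart[OF D(1)[OF sq1[OF t]] this op(1) t]
    have "tangent \<gamma> t = D (u1 t, 0) (u1' t, 0)" using g1 by (simp add: I1_def)
    also have "(u1' t, 0) = u1' t *\<^sub>R (1, 0)" by simp
    finally show ?thesis using linear_scale[OF D(3)[OF sq1[OF t]]] by metis
  qed
  have tan2: "tangent \<gamma> t = u2' t *\<^sub>R (D (u2 t, h (u2 t)) (1, 0) + h' (u2 t) *\<^sub>R D (u2 t, h (u2 t)) (0, 1))"
    if t: "t \<in> I2" for t
  proof -
    have "((\<lambda>t. h (u2 t)) has_real_derivative h' (u2 t) * u2' t) (at t)"
      by (rule DERIV_chain2[OF h'[OF u2r[OF t]] u2'(1)[OF t]])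
    then have "((\<lambda>t. (u2 t, h (u2 t))) has_vector_derivative (u2' t, h' (u2 t) * u2' t)) (at t)"
      using u2'(1)[OF t] by (intro has_vector_derivative_Pair) (auto simp: has_real_derivative_iff_has_vector_derivative)
    from tangent_in_chart[OF D(1)[OF sq2[OF t]] this op(2) t]
    have "tangent \<gamma> t = D (u2 t, h (u2 t)) (u2' t, h' (u2 t) * u2' t)" using g2 by (simp add: I2_def)
    also have "(u2' t, h' (u2 t) * u2' t) = u2' t *\<^sub>R ((1, 0) + h' (u2 t) *\<^sub>R (0, 1))" by simp
    finally show ?thesis
      by (simp only: linear_scale[OF D(3)[OF sq2[OF t]]] linear_add[OF D(3)[OF sq2[OF t]]])
  qed
  have tnz: "tangent \<gamma> t \<noteq> 0" for t using ig by (simp add: immersed_curve_def)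
  have u1'nz: "u1' t \<noteq> 0" if "t \<in> I1" for t using tan1[OF that] tnz[of t] by auto
  have u2'nz: "u2' t \<noteq> 0" if "t \<in> I2" for t using tan2[OF that] tnz[of t] by auto
  obtain \<sigma>2 where \<sigma>2: "\<sigma>2 = 1 \<or> \<sigma>2 = -1" "\<And>s t. s \<in> I2 \<Longrightarrow> t \<in> I2 \<Longrightarrow> s < t \<Longrightarrow> \<sigma>2 * u2 s < \<sigma>2 * u2 t"
    unfolding I2_def by (rule deriv_nonzero_strict_mono[of a2 b2 u2 u2'])
      (use u2' u2'nz in \<open>auto simp: I2_def\<close>)

  \<comment> \<open>The Jacobian along the axis, on which all the crossings in the disc lie.\<close>
  define J where "J u = \<psi> (u, 0) \<bullet> cross3 (D (u, 0) (1, 0)) (D (u, 0) (0, 1))" for u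
  have orient12: "orient \<gamma> t1 t2 = u1' t1 * u2' t2 * (h' z * J z)"
    if "t1 \<in> I1" "t2 \<in> I2" "u1 t1 = z" "u2 t2 = z" "h z = 0" for t1 t2 z
    using that g1 unfolding orient_def tan1[OF that(1)] tan2[OF that(2)] J_def
    by (simp add: I1_def cross_mult_left cross_mult_right cross_add_right)
  have J0: "J u \<noteq> 0" if "u \<in> {-1<..<1}" for u using D(4)[of "(u, 0)"] that by (simp add: sq J_def)
  have contJ: "continuous_on {-1<..<1} J"
  proof -
    have c1: "continuous_on {-1<..<1} (\<lambda>u. (u, 0::real))" by (intro continuous_intros)
    have im: "(\<lambda>u. (u, 0::real)) ` {-1<..<1} \<subseteq> square" by (auto simp: square_def)
    have "continuous_on square \<psi>"
      using D(1) has_derivative_at_withinI by (intro has_derivative_continuous_on) blast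
    then have "continuous_on {-1<..<1} (\<lambda>u. \<psi> (u, 0))" using continuous_on_compose2[OF _ c1 im] by blast
    moreover have "continuous_on {-1<..<1} (\<lambda>u. D (u, 0) v)" for v
      using continuous_on_compose2[OF D(2) c1 im] .
    ultimately show ?thesis unfolding J_def[abs_def] by (intro continuous_on_inner continuous_on_cross)
  qed
  \<comment> \<open>\<open>S1\<close> and \<open>S2'\<close> give the parameters of the two strands
    over a given first coordinate.\<close>
  define S1 where "S1 = inv_into I1 u1"
  define S2' where "S2' = inv_into I2 u2"
  have S1: "S1 z \<in> I1" "u1 (S1 z) = z" if "z \<in> {-1<..<1}" for z
    using u1(2) that unfolding S1_def I1_def bij_betw_def by (metis inv_into_into, metis f_inv_into_f)
  have S2': "S2' z \<in> I2" "u2 (S2' z) = z" if "z \<in> {-1<..<1}" for z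
    using u2(2) that unfolding S2'_def I2_def bij_betw_def by (metis inv_into_into, metis f_inv_into_f)
  have frac_ne: "frac s \<noteq> frac t" if "s \<in> I1 \<union> I2" "t \<in> I1 \<union> I2" "s \<noteq> t" for s t
    using frac_eq_near near[OF that(1,2)] that(3) by blast
  define o12 where "o12 z = orient \<gamma> (S1 z) (S2' z)" for z
  have cz: "crossing \<gamma> (frac (S1 z)) (frac (S2' z))" if "z \<in> {-1<..<1}" "h z = 0" for z
  proof (rule crossing_frac[OF ig])
    have "\<gamma> (S1 z) = \<psi> (u1 (S1 z), 0)" using g1 S1(1)[OF that(1)] unfolding I1_def by blast
    moreover have "\<gamma> (S2' z) = \<psi> (u2 (S2' z), h (u2 (S2' z)))" using g2 S2'(1)[OF that(1)] unfolding I2_def by blast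
    ultimately show "\<gamma> (S1 z) = \<gamma> (S2' z)" using S1(2)[OF that(1)] S2'(2)[OF that(1)] that(2) by simp
    show "frac (S1 z) \<noteq> frac (S2' z)" using S1(1)[OF that(1)] S2'(1)[OF that(1)] disj by (intro frac_ne) auto
  qed
  have o12nz: "o12 z \<noteq> 0" if "z \<in> {-1<..<1}" "h z = 0" for z
    using doodle_orient_nonzero[OF dg cz[OF that]] by (simp add: o12_def orient_frac[OF ig])
  have o12eq: "o12 z = u1' (S1 z) * u2' (S2' z) * (h' z * J z)" if "z \<in> {-1<..<1}" "h z = 0" for z
    unfolding o12_def using S1[OF that(1)] S2'[OF that(1)] that(2) by (intro orient12) auto
  have "o12 z1 * o12 z2 < 0"
  proof -
    have nz: "h' z1 \<noteq> 0" "h' z2 \<noteq> 0" using o12nz o12eq zr by force+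
    have "h' z1 * h' z2 < 0"
    proof (rule consecutive_zeros_deriv[OF z12(2), of "{-1<..<1}" h])
      show "{z1..z2} \<subseteq> {-1<..<1}" using zr by auto
      show "continuous_on {-1<..<1} h"
        by (rule DERIV_continuous_on) (use h' DERIV_subset in blast)
      show "h z \<noteq> 0" if "z1 < z" "z < z2" for z
      proof
        assume "h z = 0"
        moreover have "z \<in> {-1<..<1}" using that zr by auto
        ultimately show False using hz[of z] that by auto
      qed
    qed (use h' zr nz in auto)
    moreover have "J z1 * J z2 > 0"
      using sgn_constant_on_open_interval[OF contJ J0 zr(1,3)] J0[OF zr(1)] by (rule sgn_eq_mult_pos)
    moreover have "u1' (S1 z1) * u1' (S1 z2) > 0"
      using S1(1)[OF zr(1)] S1(1)[OF zr(3)] u1'nz u1'(2) unfolding I1_def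
      by (intro sgn_eq_mult_pos sgn_constant_on_open_interval[of a1 b1 u1']) auto
    moreover have "u2' (S2' z1) * u2' (S2' z2) > 0"
      using S2'(1)[OF zr(1)] S2'(1)[OF zr(3)] u2'nz u2'(2) unfolding I2_def
      by (intro sgn_eq_mult_pos sgn_constant_on_open_interval[of a2 b2 u2']) auto
    ultimately have "(h' z1 * h' z2) * ((J z1 * J z2) * ((u1' (S1 z1) * u1' (S1 z2)) * (u2' (S2' z1) * u2' (S2' z2)))) < 0"
      by (rule mult_neg_pos[OF _ mult_pos_pos[OF _ mult_pos_pos]])
    then show ?thesis using o12eq[OF zr(1,2)] o12eq[OF zr(3,4)] by (simp add: mult_ac)
  qed
  \<comment> \<open>The zeros are named so that the arrow at \<open>z\<close> starts on the first
    strand and the one at \<open>z'\<close> on the second.\<close>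
  then obtain z z' where zz: "{z1, z2} = {z, z'}" "o12 z > 0" "o12 z' < 0"
    by (cases "o12 z1 > 0") (auto simp: mult_less_0_iff insert_commute)
  have zzr: "z \<in> {-1<..<1}" "h z = 0" "z' \<in> {-1<..<1}" "h z' = 0" using zz(1) z12(1) by blast+
  have hzz: "y = z \<or> y = z'" if "y \<in> {-1<..<1}" "h y = 0" for y using zz(1) hz[OF that] by blast
  define e where "e = (frac (S1 z), frac (S2' z))"
  define e' where "e' = (frac (S2' z'), frac (S1 z'))"
  have eA: "e \<in> arrows \<gamma>"
    unfolding e_def using cz[OF zzr(1,2)] zz(2) by (simp add: arrows_iff orient_frac[OF ig] o12_def)
  have e'A: "e' \<in> arrows \<gamma>"
  proof -
    have "\<gamma> (frac (S1 z')) = \<gamma> (frac (S2' z'))" using cz[OF zzr(3,4)] by (simp add: crossing_def)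
    from orient_swap[of \<gamma> "frac (S1 z')" "frac (S2' z')", OF this] show ?thesis
      unfolding e'_def using crossing_sym[OF cz[OF zzr(3,4)]] zz(3) by (simp add: arrows_iff orient_frac[OF ig] o12_def)
  qed
  have per: "t \<in> periodic J" if "t \<in> J" for t J unfolding periodic_iff using that by (intro exI[of _ 0]) simp
  have eU: "\<gamma> (fst e) \<in> U" "\<gamma> (fst e') \<in> U"
    using S1(1) S2'(1) zzr per by (auto simp: e_def e'_def immersed_curve_frac[OF ig] gU')
  \<comment> \<open>Only points of different strands can meet, since each strand is injective in its
    first coordinate.\<close>
  have gx: "(\<exists>y. y \<in> {-1<..<1} \<and> h y = 0 \<and> (s = S1 y \<and> t = S2' y \<or> s = S2' y \<and> t = S1 y))"
    if "s \<in> I1 \<union> I2" "t \<in> I1 \<union> I2" "s \<noteq> t" "\<gamma> s = \<gamma> t" for s t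
  proof -
    have mixed: "\<exists>y. y \<in> {-1<..<1} \<and> h y = 0 \<and> s = S1 y \<and> t = S2' y"
      if st: "s \<in> I1" "t \<in> I2" "\<gamma> s = \<gamma> t" for s t
    proof -
      have "\<psi> (u1 s, 0) = \<psi> (u2 t, h (u2 t))" using g1 g2 st unfolding I1_def I2_def by metis
      from \<psi>eq[OF this sq1[OF st(1)] sq2[OF st(2)]] have "u1 s = u2 t" "h (u2 t) = 0" by auto
      moreover have "s = S1 (u1 s)" using u1i[OF st(1) S1(1)] S1(2) u1r[OF st(1)] by metis
      moreover have "t = S2' (u2 t)" using u2i[OF st(2) S2'(1)] S2'(2) u2r[OF st(2)] by metis
      ultimately show ?thesis using u2r[OF st(2)] by metis
    qed
    have "\<not> (s \<in> I1 \<and> t \<in> I1)"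
    proof
      assume st: "s \<in> I1 \<and> t \<in> I1"
      then have "\<psi> (u1 s, 0) = \<psi> (u1 t, 0)" using g1 that(4) unfolding I1_def by metis
      from \<psi>eq[OF this] show False using sq1 u1i st that(3) by blast
    qed
    moreover have "\<not> (s \<in> I2 \<and> t \<in> I2)"
    proof
      assume st: "s \<in> I2 \<and> t \<in> I2"
      then have "\<psi> (u2 s, h (u2 s)) = \<psi> (u2 t, h (u2 t))" using g2 that(4) unfolding I2_def by metis
      from \<psi>eq[OF this] show False using sq2 u2i st that(3) by blast
    qed
    ultimately show ?thesis using that mixed[of s t] mixed[of t s] by (metis Un_iff)
  qed
  have inU: "\<exists>y\<in>{z, z'}. u = frac (S1 y) \<and> v = frac (S2' y) \<or> u = frac (S2' y) \<and> v = frac (S1 y)"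
    if cr: "crossing \<gamma> u v" "\<gamma> u \<in> U" for u v
  proof -
    have "\<gamma> v \<in> U" using cr by (simp add: crossing_def)
    then have "u \<in> periodic (I1 \<union> I2)" "v \<in> periodic (I1 \<union> I2)" using cr(2) gU' by blast+
    then obtain s t where s: "s \<in> I1 \<union> I2" "frac s = frac u" and t: "t \<in> I1 \<union> I2" "frac t = frac v"
      by (metis periodic_lift)
    have fr: "frac u = u" "frac v = v" using cr by (auto simp: crossing_def frac_eq)
    have "\<gamma> s = \<gamma> t" using s(2) t(2) fr cr immersed_curve_frac[OF ig] by (metis crossing_def)
    moreover have "s \<noteq> t" using s(2) t(2) fr cr by (auto simp: crossing_def)
    ultimately obtain y where "y \<in> {-1<..<1} \<and> h y = 0 \<and> (s = S1 y \<and> t = S2' y \<or> s = S2' y \<and> t = S1 y)"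
      using gx[OF s(1) t(1)] by blast
    then show ?thesis using s(2) t(2) fr hzz[of y] by auto
  qed

  \<comment> \<open>\<open>c\<close> may be negative, while \<open>c'\<close> and
    \<open>- c'\<close> always lie in the open interval. Off the closed arc between the
    corresponding parameters, sorted as \<open>p\<close> and \<open>q\<close> because
    \<open>u2\<close> may decrease, the curves agree; such a closed arc inside the disc makes their
    tangents agree at all parameters outside the disc.\<close>
  define c' where "c' = max c 0"
  have c': "0 \<le> c'" "c' < 1" "c \<le> c'" using c(1) by (auto simp: c'_def)
  define p where "p = min (S2' c') (S2' (- c'))"
  define q where "q = max (S2' c') (S2' (- c'))"
  have Sc: "S2' c' \<in> I2" "S2' (- c') \<in> I2" "u2 (S2' c') = c'" "u2 (S2' (- c')) = - c'" using c' S2' by auto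
  have pq: "p \<in> I2" "q \<in> I2" "p \<le> q" using Sc by (auto simp: p_def q_def min_def max_def)
  have eq: "\<delta> t = \<gamma> t" if "t \<notin> periodic {p..q}" for t
  proof (cases "t \<in> periodic I2")
    case False
    then show ?thesis using eq' unfolding I2_def by blast
  next
    case True
    then obtain s where s: "s \<in> I2" "frac s = frac t" by (metis periodic_lift)
    then have "s \<notin> {p..q}" using that per[of s "{p..q}"] periodic_frac[of s "{p..q}"] periodic_frac[of t "{p..q}"] by auto
    then have "s < p \<or> q < s" by auto
    then have "c' < \<bar>u2 s\<bar>"
    proof
      assume "s < p"
      then have "\<sigma>2 * u2 s < \<sigma>2 * c'" "\<sigma>2 * u2 s < \<sigma>2 * (- c')"
        using \<sigma>2(2)[OF s(1) Sc(1)] \<sigma>2(2)[OF s(1) Sc(2)] Sc(3,4) by (auto simp: p_def)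
      then show ?thesis using \<sigma>2(1) c'(1) by auto
    next
      assume "q < s"
      then have "\<sigma>2 * c' < \<sigma>2 * u2 s" "\<sigma>2 * (- c') < \<sigma>2 * u2 s"
        using \<sigma>2(2)[OF Sc(1) s(1)] \<sigma>2(2)[OF Sc(2) s(1)] Sc(3,4) by (auto simp: q_def)
      then show ?thesis using \<sigma>2(1) c'(1) by auto
    qed
    then have "k (u2 s) = h (u2 s)" using c(2) c'(3) u2r[OF s(1)] by auto
    then have "\<delta> s = \<gamma> s" using g2 d2 s(1) unfolding I2_def by metis
    then show ?thesis using s(2) immersed_curve_frac[OF ig] immersed_curve_frac[OF id] by metis
  qed
  have dU': "\<delta> t \<in> U \<longleftrightarrow> t \<in> periodic (I1 \<union> I2)" for t
  proof (cases "t \<in> periodic I2")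
    case True
    then obtain s where s: "s \<in> I2" "frac s = frac t" by (metis periodic_lift)
    then have "\<delta> t = \<delta> s" using immersed_curve_frac[OF id] by metis
    also have "\<delta> s \<in> U" using d2 s(1) sq3[OF s(1)] unfolding U_def I2_def by auto
    finally show ?thesis using True periodic_mono[of I2 "I1 \<union> I2"] by auto
  next
    case False
    then have "\<delta> t = \<gamma> t" using eq' unfolding I2_def by blast
    then show ?thesis using gU' by simp
  qed
  have noneU: False if cr: "crossing \<delta> u v" "\<delta> u \<in> U" for u v
  proof -
    have "\<delta> v \<in> U" using cr by (simp add: crossing_def)
    then have "u \<in> periodic (I1 \<union> I2)" "v \<in> periodic (I1 \<union> I2)" using cr(2) dU' by blast+
    then obtain s t where s: "s \<in> I1 \<union> I2" "frac s = frac u" and t: "t \<in> I1 \<union> I2" "frac t = frac v"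
      by (metis periodic_lift)
    have fr: "frac u = u" "frac v = v" using cr by (auto simp: crossing_def frac_eq)
    have st: "\<delta> s = \<delta> t" using s(2) t(2) fr cr immersed_curve_frac[OF id] by (metis crossing_def)
    have ne: "s \<noteq> t" using s(2) t(2) fr cr by (auto simp: crossing_def)
    \<comment> \<open>The first strand does not move, as its arc is disjoint from all translates of
      the second.\<close>
    have d1: "\<delta> r = \<psi> (u1 r, 0)" if "r \<in> I1" for r
    proof -
      have "r \<notin> periodic I2"
      proof
        assume "r \<in> periodic I2"
        then obtain w where "w \<in> I2" "frac w = frac r" by (metis periodic_lift)
        then show False using frac_ne[of w r] that disj by auto
      qed
      then show ?thesis using eq' g1 that unfolding I1_def I2_def by metis
    qed
    have d2': "\<delta> r = \<psi> (u2 r, k (u2 r))" if "r \<in> I2" for r using d2 that unfolding I2_def by blast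
    have mixed: False if "s \<in> I1" "t \<in> I2" "\<delta> s = \<delta> t" for s t
    proof -
      have "\<psi> (u1 s, 0) = \<psi> (u2 t, k (u2 t))" using d1[OF that(1)] d2'[OF that(2)] that(3) by simp
      from \<psi>eq[OF this sq1[OF that(1)] sq3[OF that(2)]] show False using kz u2r[OF that(2)] by auto
    qed
    have "\<not> (s \<in> I1 \<and> t \<in> I1)"
    proof
      assume "s \<in> I1 \<and> t \<in> I1"
      then show False using \<psi>eq[of "u1 s" 0 "u1 t" 0] sq1 d1 u1i st ne by (metis fst_conv)
    qed
    moreover have "\<not> (s \<in> I2 \<and> t \<in> I2)"
    proof
      assume "s \<in> I2 \<and> t \<in> I2"
      then show False using \<psi>eq[of "u2 s" "k (u2 s)" "u2 t" "k (u2 t)"] sq3 d2' u2i st ne by (metis fst_conv)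
    qed
    ultimately show False using s(1) t(1) mixed[of s t] mixed[of t s] st by auto
  qed
  have ot: "crossing \<delta> u v \<longleftrightarrow> crossing \<gamma> u v" "orient \<delta> u v = orient \<gamma> u v"
    if "\<gamma> u \<notin> U" "\<gamma> v \<notin> U" for u v
  proof -
    have sub: "{p..q} \<subseteq> I1 \<union> I2" using pq by (auto simp: I2_def)
    have "\<delta> w = \<gamma> w \<and> tangent \<delta> w = tangent \<gamma> w" if "\<gamma> w \<notin> U" for w
    proof
      have w: "w \<notin> periodic {p..q}" using that gU' periodic_mono[OF sub] by blast
      then show "\<delta> w = \<gamma> w" by (rule eq)
      show "tangent \<delta> w = tangent \<gamma> w"
        by (rule tangent_cong_periodic[OF ig eq]) (use near[of p q] pq w in auto)
    qed
    then have "\<delta> u = \<gamma> u" "\<delta> v = \<gamma> v" "tangent \<delta> u = tangent \<gamma> u" "tangent \<delta> v = tangent \<gamma> v"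
      using that by blast+
    then show "crossing \<delta> u v \<longleftrightarrow> crossing \<gamma> u v" "orient \<delta> u v = orient \<gamma> u v"
      by (simp_all add: crossing_def orient_def)
  qed
  have UU: "\<gamma> u \<in> U \<longleftrightarrow> \<delta> u \<in> U" for u using gU' dU' by blast
  have "arrows \<delta> = arrows \<gamma> - {e, e'}"
  proof (rule set_eqI, clarify)
    fix u v
    show "(u, v) \<in> arrows \<delta> \<longleftrightarrow> (u, v) \<in> arrows \<gamma> - {e, e'}"
    proof (cases "\<gamma> u \<in> U")
      case True
      have "(u, v) \<notin> arrows \<delta>" using True UU noneU by (auto simp: arrows_iff)
      moreover have "(u, v) = e \<or> (u, v) = e'" if "(u, v) \<in> arrows \<gamma>"
      proof (rule ccontr)
        assume ne: "\<not> ((u, v) = e \<or> (u, v) = e')"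
        have cr: "crossing \<gamma> u v" and or: "orient \<gamma> u v > 0" using that by (simp_all add: arrows_iff)
        have "\<gamma> v = \<gamma> u" using cr by (simp add: crossing_def)
        from orient_swap[of \<gamma> v u, OF this] have sw: "orient \<gamma> v u < 0" using or by simp
        from inU[OF cr True] ne have "(u, v) = (frac (S2' z), frac (S1 z)) \<or> (u, v) = (frac (S1 z'), frac (S2' z'))"
          by (auto simp: e_def e'_def)
        then have "orient \<gamma> v u = o12 z \<or> orient \<gamma> u v = o12 z'"
          by (auto simp: o12_def orient_frac[OF ig])
        then show False using or sw zz(2,3) by auto
      qed
      ultimately show ?thesis by blast
    next
      case False
      show ?thesis
      proof (cases "\<gamma> v \<in> U")
        case True
        then have "\<gamma> u \<noteq> \<gamma> v" "\<delta> u \<noteq> \<delta> v" using False UU by metis+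
        then show ?thesis by (auto simp: arrows_iff crossing_def)
      next
        case v: False
        have "(u, v) \<noteq> e" "(u, v) \<noteq> e'" using False eU by auto
        then show ?thesis using ot[OF False v] by (simp add: arrows_iff)
      qed
    qed
  qed
  moreover have "adjacent_opposite_in (arrows \<gamma>) e e'"
  proof -
    have ends: "frac (S1 y) \<in> endpoints (arrows \<gamma>)" "frac (S2' y) \<in> endpoints (arrows \<gamma>)" if "y \<in> {z, z'}" for y
      using endpoints_arrows[OF dg] cz[of y] crossing_sym[OF cz[of y]] zzr that by auto
    have nz: "z \<noteq> z'" using zz(2,3) by auto
    have adj: "adjacent_in (arrows \<gamma>) (frac s) (frac s')"
      if s: "s \<in> I" "s' \<in> I" "s \<noteq> s'" "I = I1 \<or> I = I2" "frac s \<in> endpoints (arrows \<gamma>)" "frac s' \<in> endpoints (arrows \<gamma>)"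
        and only: "\<And>w. w \<in> I \<Longrightarrow> w \<in> {S1 z, S1 z', S2' z, S2' z'} \<Longrightarrow> w = s \<or> w = s'" for s s' I
    proof (rule adjacent_inI[OF s(5,6,3)])
      show "\<bar>s - s'\<bar> < 1" using near s by auto
      fix w assume w: "min s s' < w" "w < max s s'"
      then have wI: "w \<in> I" using s by (auto simp: I1_def I2_def)
      then have wI': "w \<in> I1 \<union> I2" using s(4) by auto
      show "frac w \<notin> endpoints (arrows \<gamma>)"
      proof
        assume "frac w \<in> endpoints (arrows \<gamma>)"
        then obtain v where v: "crossing \<gamma> (frac w) v" using endpoints_arrows[OF dg] by auto
        have "\<gamma> (frac w) \<in> U" using per[OF wI'] by (simp add: gU' immersed_curve_frac[OF ig])
        from inU[OF v this] obtain y where y: "y \<in> {z, z'}" "frac w = frac (S1 y) \<or> frac w = frac (S2' y)" by blast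
        have "S1 y \<in> I1 \<union> I2" "S2' y \<in> I1 \<union> I2" using S1(1)[of y] S2'(1)[of y] y(1) zzr by auto
        then have "w = S1 y \<or> w = S2' y" using y(2) frac_ne[OF wI'] by blast
        then show False using only[OF wI] y(1) w by auto
      qed
    qed
    have i1: "S1 z \<in> I1" "S1 z' \<in> I1" and i2: "S2' z \<in> I2" "S2' z' \<in> I2" using S1 S2' zzr by auto
    have n1: "S1 z \<noteq> S1 z'" "S2' z \<noteq> S2' z'" using S1(2)[OF zzr(1)] S1(2)[OF zzr(3)] S2'(2)[OF zzr(1)] S2'(2)[OF zzr(3)] nz by metis+
    have a1: "adjacent_in (arrows \<gamma>) (frac (S1 z)) (frac (S1 z'))"
      by (rule adj[OF i1 n1(1)]) (use ends i2 disj in auto)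
    have a2: "adjacent_in (arrows \<gamma>) (frac (S2' z)) (frac (S2' z'))"
      by (rule adj[OF i2 n1(2)]) (use ends i1 disj in auto)
    have "S1 z \<noteq> S2' z'" using i1(1) i2(2) disj by (metis IntI empty_iff)
    then have "frac (S1 z) \<noteq> frac (S2' z')" using i1(1) i2(2) by (intro frac_ne UnI1 UnI2)
    then have "e \<noteq> e'" by (simp add: e_def e'_def)
    moreover have "\<exists>a b a' b'. adjacent_in (arrows \<gamma>) a a' \<and> adjacent_in (arrows \<gamma>) b b' \<and>
        (e = (a, b) \<and> e' = (b', a') \<or> e = (b, a) \<and> e' = (a', b'))"
      by (rule exI[of _ "frac (S1 z)"], rule exI[of _ "frac (S2' z)"], rule exI[of _ "frac (S1 z')"],
          rule exI[of _ "frac (S2' z')"]) (simp add: a1 a2 e_def e'_def)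
    ultimately show ?thesis using eA e'A unfolding adjacent_opposite_in_def by (intro conjI)
  qed
  ultimately show ?thesis
    using I_alg_adjacent_opposite[OF is_arrow_diagram_arrows[OF dg]] by (simp add: diagram_of_def)
qed

lemma doodle_equiv_I_alg:
  assumes "doodle_equiv \<gamma> \<delta>"
  shows "I_alg (diag (diagram_of \<gamma>)) = I_alg (diag (diagram_of \<delta>))"
  using assms unfolding doodle_equiv_def
proof (induction rule: equivclp_induct)
  case (step \<delta> \<epsilon>)
  have "I_alg (diag (diagram_of \<alpha>)) = I_alg (diag (diagram_of \<beta>))"
    if "isotopic \<alpha> \<beta> \<or> R1_move \<alpha> \<beta> \<or> R2_move \<alpha> \<beta>" for \<alpha> \<beta>
    using that isotopic_diagram R1_move_I_alg R2_move_I_alg by metis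
  then show ?case using step by metis
qed simp


section \<open>Moving one branch off a singular point\<close>

lemma eventually_nhds_continuous:
  assumes "isCont f z" "eventually P (nhds (f z))"
  shows "eventually (\<lambda>w. P (f w)) (nhds z)"
proof -
  have "filterlim f (nhds (f z)) (nhds z)"
    using assms(1) unfolding isCont_def tendsto_at_iff_tendsto_nhds .
  then show ?thesis using assms(2) unfolding filterlim_iff by blast
qed

text \<open>The tube lemma: finitely many product neighbourhoods cover
  \<open>{s0} \<times> K\<close>, and the intersection of their first factors works for all of
  \<open>K\<close>.\<close>

lemma eventually_nhds_compact:
  assumes "compact K" and loc: "\<And>z. z \<in> K \<Longrightarrow> \<forall>\<^sub>F x in nhds (s0, z). R (fst x) (snd x)"
  shows "\<forall>\<^sub>F s in nhds s0. \<forall>w\<in>K. R s w"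
proof -
  have "\<exists>A B. open A \<and> s0 \<in> A \<and> open B \<and> z \<in> B \<and> (\<forall>s\<in>A. \<forall>w\<in>B. R s w)" if z: "z \<in> K" for z
  proof -
    obtain W where W: "open W" "(s0, z) \<in> W" "\<And>x. x \<in> W \<Longrightarrow> R (fst x) (snd x)"
      using loc[OF z] unfolding eventually_nhds by blast
    obtain A B where AB: "open A" "open B" "(s0, z) \<in> A \<times> B" "A \<times> B \<subseteq> W"
      using open_prod_elim[OF W(1,2)] by metis
    have "R s w" if "s \<in> A" "w \<in> B" for s w
    proof -
      have "(s, w) \<in> W" using AB(4) that by blast
      from W(3)[OF this] show ?thesis by simp
    qed
    then show ?thesis using AB by blast
  qed
  then obtain A B where AB: "\<And>z. z \<in> K \<Longrightarrow> open (A z) \<and> s0 \<in> A z \<and> open (B z) \<and> z \<in> B z \<and> (\<forall>s\<in>A z. \<forall>w\<in>B z. R s w)"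
    by metis
  have opB: "\<And>z. z \<in> K \<Longrightarrow> open (B z)" and cov: "K \<subseteq> (\<Union>z\<in>K. B z)" using AB by auto
  obtain C where C: "C \<subseteq> K" "finite C" "K \<subseteq> (\<Union>z\<in>C. B z)"
    by (rule compactE_image[OF assms(1) opB cov]) auto
  have "eventually (\<lambda>s. \<forall>z\<in>C. s \<in> A z) (nhds s0)"
    using C AB by (subst eventually_ball_finite_distrib) (auto intro: eventually_nhds_in_open)
  then show ?thesis
  proof eventually_elim
    case (elim s)
    show ?case
    proof
      fix w assume "w \<in> K"
      then obtain z where z: "z \<in> C" "w \<in> B z" using C(3) by blast
      then show "R s w" using AB[of z] elim C(1) by blast
    qed
  qed
qed

text \<open>The inverse function theorem for a derivative given by its directional values. In finite
  dimension, continuity of these on a basis is continuity of the operator, and an injective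
  derivative has a left inverse.\<close>

lemma C1_inverse_function:
  fixes f :: "'a::euclidean_space \<Rightarrow> 'a"
  assumes U: "open U" "x0 \<in> U" and d: "\<And>x. x \<in> U \<Longrightarrow> (f has_derivative f' x) (at x)"
    and cont: "\<And>v. continuous_on U (\<lambda>x. f' x v)" and inj: "inj (f' x0)"
  obtains U' V g g' where "open U'" "U' \<subseteq> U" "x0 \<in> U'" "open V" "f x0 \<in> V" "homeomorphism U' V f g"
    "(g has_derivative g') (at (f x0))" "\<And>v. f' x0 (g' v) = v"
proof -
  have bl: "bounded_linear (f' x)" if "x \<in> U" for x using d[OF that] by (rule has_derivative_bounded_linear)
  have ap: "blinfun_apply (Blinfun (f' x)) = f' x" if "x \<in> U" for x
    using bl[OF that] by (rule bounded_linear_Blinfun_apply)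
  have c: "continuous_on U (\<lambda>x. Blinfun (f' x))"
  proof (rule continuous_on_blinfun_componentwise)
    fix i :: 'a assume "i \<in> Basis"
    show "continuous_on U (\<lambda>x. blinfun_apply (Blinfun (f' x)) i)"
      using cont[of i] by (rule continuous_on_cong[THEN iffD1, rotated 2]) (auto simp: ap)
  qed
  have lin: "linear (f' x0)" using bl[OF U(2)] by (rule bounded_linear.linear)
  obtain k where k: "linear k" "k \<circ> f' x0 = id" using linear_injective_left_inverse[OF lin inj] by blast
  have kb: "blinfun_apply (Blinfun k) = k" using k(1) by (intro bounded_linear_Blinfun_apply) (simp add: linear_conv_bounded_linear)
  have id: "Blinfun k o\<^sub>L Blinfun (f' x0) = id_blinfun"
    by (rule blinfun_eqI) (use k(2) in \<open>simp add: kb ap[OF U(2)] fun_eq_iff\<close>)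
  have d': "(f has_derivative blinfun_apply (Blinfun (f' x))) (at x)" if "x \<in> U" for x
    using d[OF that] by (simp add: ap[OF that])
  obtain U' V g g' where *: "open U'" "U' \<subseteq> U" "x0 \<in> U'" "open V" "f x0 \<in> V" "homeomorphism U' V f g"
    "\<And>y. y \<in> V \<Longrightarrow> (g has_derivative (g' y)) (at y)"
    "\<And>y. y \<in> V \<Longrightarrow> g' y = inv (blinfun_apply (Blinfun (f' (g y))))"
    "\<And>y. y \<in> V \<Longrightarrow> bij (blinfun_apply (Blinfun (f' (g y))))"
    by (rule inverse_function_theorem[OF U(1) d' c U(2) id]) blast+
  have g0: "g (f x0) = x0" using *(3,6) by (simp add: homeomorphism_def)
  have "g' (f x0) = inv (f' x0)" "bij (f' x0)" using *(8)[OF *(5)] *(9)[OF *(5)] by (simp_all add: g0 ap[OF U(2)])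
  then have "f' x0 (g' (f x0) v) = v" for v by (simp add: bij_is_surj surj_f_inv_f)
  then show ?thesis using that[OF *(1-6)] *(7)[OF *(5)] by blast
qed

lemma vec3_eq_axis_sum: "(y :: real^3) = y$1 *\<^sub>R axis 1 1 + y$2 *\<^sub>R axis 2 1 + y$3 *\<^sub>R axis 3 1"
  by (simp add: vec_eq_iff forall_3 axis_def)

lemma triple_swap: "v \<bullet> cross3 x w = - (x \<bullet> cross3 v w)" for v w x :: "real^3"
  by (simp add: cross3_def inner_vec_def sum_3 vec_eq_iff algebra_simps)

lemma triple_rotate: "w \<bullet> cross3 x v = x \<bullet> cross3 v w" for v w x :: "real^3"
  by (simp add: cross3_def inner_vec_def sum_3 vec_eq_iff algebra_simps)

text \<open>The equation \<open>G (s, q) = \<gamma> p\<close> on the sphere is turned into a square system by allowing a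
  third unknown \<open>l\<close> in \<open>G (s, q) = l *\<^sub>R \<gamma> p\<close>; near the solution \<open>l = 1\<close> is forced.\<close>

lemma crossing_continuation:
  fixes G :: "real \<times> real \<Rightarrow> real^3" and \<gamma> :: curve
  assumes dG: "\<And>z. (G has_derivative DG z) (at z)" and cG: "\<And>v. continuous_on UNIV (\<lambda>z. DG z v)"
    and d\<gamma>: "\<And>t. (\<gamma> has_vector_derivative \<gamma>' t) (at t)" and c\<gamma>: "continuous_on UNIV \<gamma>'"
    and S: "\<And>z. G z \<in> S2" "\<And>t. \<gamma> t \<in> S2" and e: "G (0, t0) = \<gamma> k"
    and nz: "\<gamma> k \<bullet> cross3 (DG (0, t0) (0, 1)) (\<gamma>' k) \<noteq> 0"
    and orth: "\<gamma> k \<bullet> DG (0, t0) (0, 1) = 0" "\<gamma> k \<bullet> \<gamma>' k = 0"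
  obtains P Q p' q' l' where "P 0 = k" "Q 0 = t0"
    "(P has_real_derivative p') (at 0)" "(Q has_real_derivative q') (at 0)"
    "DG (0, t0) (1, q') = p' *\<^sub>R \<gamma>' k + l' *\<^sub>R \<gamma> k"
    "\<forall>\<^sub>F s in nhds 0. G (s, Q s) = \<gamma> (P s)"
    "\<forall>\<^sub>F x in nhds (0, t0, k). case x of (s, q, p) \<Rightarrow> G (s, q) = \<gamma> p \<longrightarrow> q = Q s \<and> p = P s"
proof -
  \<comment> \<open>The first component keeps \<open>s\<close>, so that inverting \<open>f\<close>
    solves the equation for all small \<open>s\<close> at once; the vector unknown collects
    \<open>q\<close>, \<open>p\<close> and \<open>l\<close> in this order.\<close>
  define f where "f = (\<lambda>x :: real \<times> (real^3). (fst x, G (fst x, snd x $ 1) - (snd x $ 3) *\<^sub>R \<gamma> (snd x $ 2)))"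
  define f' where "f' = (\<lambda>(x :: real \<times> (real^3)) (v :: real \<times> (real^3)). (fst v, DG (fst x, snd x $ 1) (fst v, snd v $ 1)
    - ((snd x $ 3) *\<^sub>R ((snd v $ 2) *\<^sub>R \<gamma>' (snd x $ 2)) + (snd v $ 3) *\<^sub>R \<gamma> (snd x $ 2))))"
  define y0 :: "real^3" where "y0 = t0 *\<^sub>R axis 1 1 + k *\<^sub>R axis 2 1 + axis 3 1"
  have y0: "y0 $ 1 = t0" "y0 $ 2 = k" "y0 $ 3 = 1" by (simp_all add: y0_def axis_def)
  define x0 where "x0 = (0 :: real, y0)"
  have lDG: "linear (DG z)" for z using dG has_derivative_linear by blast
  have df: "(f has_derivative f' x) (at x)" for x
  proof -
    have comp: "((\<lambda>x :: real \<times> (real^3). snd x $ i) has_derivative (\<lambda>v. snd v $ i)) (at x)" for i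
      by (intro bounded_linear_imp_has_derivative bounded_linear_compose[OF bounded_linear_vec_nth bounded_linear_snd])
    have 1: "((\<lambda>x. G (fst x, snd x $ 1)) has_derivative (\<lambda>v. DG (fst x, snd x $ 1) (fst v, snd v $ 1))) (at x)"
      by (rule has_derivative_compose[OF _ dG, of "\<lambda>x. (fst x, snd x $ 1)"])
         (intro has_derivative_Pair has_derivative_fst has_derivative_ident comp)
    have 2: "((\<lambda>x. \<gamma> (snd x $ 2)) has_derivative (\<lambda>v. (snd v $ 2) *\<^sub>R \<gamma>' (snd x $ 2))) (at x)"
      by (rule has_derivative_compose[OF comp d\<gamma>[unfolded has_vector_derivative_def]])
    show ?thesis unfolding f_def f'_def
      by (intro has_derivative_Pair has_derivative_diff has_derivative_fst has_derivative_ident 1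
          has_derivative_scaleR[OF comp 2])
  qed
  have cf': "continuous_on UNIV (\<lambda>x. f' x v)" for v
  proof -
    have c1: "continuous_on UNIV (\<lambda>x :: real \<times> (real^3). DG (fst x, snd x $ 1) w)" for w
      by (rule continuous_on_compose2[OF cG, of _ "\<lambda>x. (fst x, snd x $ 1)"]) (auto intro!: continuous_intros)
    have c2: "continuous_on UNIV (\<lambda>x :: real \<times> (real^3). \<gamma>' (snd x $ 2))"
      by (rule continuous_on_compose2[OF c\<gamma>, of _ "\<lambda>x. snd x $ 2"]) (auto intro!: continuous_intros)
    have "continuous_on UNIV \<gamma>"
      using d\<gamma> by (meson continuous_at_imp_continuous_on has_vector_derivative_continuous)
    then have c3: "continuous_on UNIV (\<lambda>x :: real \<times> (real^3). \<gamma> (snd x $ 2))"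
      by (rule continuous_on_compose2[of _ _ _ "\<lambda>x. snd x $ 2"]) (auto intro!: continuous_intros)
    show ?thesis unfolding f'_def by (intro continuous_intros c1 c2 c3)
  qed
  have f'0: "f' x0 v = (fst v, DG (0, t0) (fst v, snd v $ 1) - ((snd v $ 2) *\<^sub>R \<gamma>' k + (snd v $ 3) *\<^sub>R \<gamma> k))" for v
    by (simp add: f'_def x0_def y0)
  \<comment> \<open>Pairing a kernel vector with \<open>cross3 (\<gamma> k) (\<gamma>' k)\<close>
    and with \<open>cross3 (\<gamma> k) (DG (0, t0) (0, 1))\<close> leaves one unknown each time,
    multiplied up to sign by the nonzero determinant \<open>o1\<close>.\<close>
  have "inj (f' x0)"
  proof -
    have lin: "linear (f' x0)" using df has_derivative_linear by blast
    show ?thesis unfolding linear_injective_0[OF lin]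
    proof (intro allI impI)
      fix v assume "f' x0 v = 0"
      then have v1: "fst v = 0" and E0: "DG (0, t0) (fst v, snd v $ 1) = (snd v $ 2) *\<^sub>R \<gamma>' k + (snd v $ 3) *\<^sub>R \<gamma> k"
        unfolding f'0 by (auto simp: zero_prod_def)
      have "DG (0, t0) (0, snd v $ 1) = (snd v $ 1) *\<^sub>R DG (0, t0) (0, 1)"
        using linear_scale[OF lDG[of "(0, t0)"], of "snd v $ 1" "(0, 1)"] by simp
      with E0 v1 have E: "(snd v $ 1) *\<^sub>R DG (0, t0) (0, 1) = (snd v $ 2) *\<^sub>R \<gamma>' k + (snd v $ 3) *\<^sub>R \<gamma> k"
        by simp
      define o1 where "o1 = \<gamma> k \<bullet> cross3 (DG (0, t0) (0, 1)) (\<gamma>' k)"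
      have cyc: "DG (0, t0) (0, 1) \<bullet> cross3 (\<gamma> k) (\<gamma>' k) = - o1" "\<gamma>' k \<bullet> cross3 (\<gamma> k) (DG (0, t0) (0, 1)) = o1"
        unfolding o1_def by (rule triple_swap triple_rotate)+
      have "(snd v $ 1) * (- o1) = 0"
        using arg_cong[OF E, of "\<lambda>w. w \<bullet> cross3 (\<gamma> k) (\<gamma>' k)"] by (simp add: inner_add_left cyc dot_cross_self)
      then have a: "snd v $ 1 = 0" using nz by (simp add: o1_def)
      have "(snd v $ 2) * o1 = 0"
        using arg_cong[OF E, of "\<lambda>w. w \<bullet> cross3 (\<gamma> k) (DG (0, t0) (0, 1))"]
        by (simp add: inner_add_left cyc dot_cross_self)
      then have b: "snd v $ 2 = 0" using nz by (simp add: o1_def)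
      have "\<gamma> k \<noteq> 0" using S(2)[of k] by auto
      then have c: "snd v $ 3 = 0" using E a b by simp
      have "snd v = 0" using vec3_eq_axis_sum[of "snd v"] a b c by simp
      then show "v = 0" using v1 by (simp add: prod_eq_iff)
    qed
  qed
  then obtain U V g g' where U: "open U" "x0 \<in> U" "open V" "f x0 \<in> V" "homeomorphism U V f g"
    "(g has_derivative g') (at (f x0))" "\<And>v. f' x0 (g' v) = v"
    by (rule C1_inverse_function[OF open_UNIV UNIV_I df cf', of x0]) blast
  have fx0: "f x0 = (0, 0)" by (simp add: f_def x0_def y0 e)
  have g0: "g (0, 0) = x0" using U(2,5) fx0 by (metis homeomorphism_def)
  define Y where "Y s = snd (g (s, 0))" for s
  define Q where "Q s = Y s $ 1" for s
  define P where "P s = Y s $ 2" for s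
  define l where "l s = Y s $ 3" for s
  have dY: "(Y has_vector_derivative snd (g' (1, 0))) (at 0)"
  proof -
    have "((\<lambda>s. (s, 0 :: real^3)) has_vector_derivative (1, 0)) (at 0)"
      by (intro has_vector_derivative_Pair) (auto intro!: derivative_eq_intros)
    from has_derivative_along_curve[of g g' "\<lambda>s. (s, 0)" 0 "(1, 0)", OF _ this]
    have "((\<lambda>s. g (s, 0)) has_vector_derivative g' (1, 0)) (at 0)" using U(6) fx0 by simp
    then have "((\<lambda>s. snd (g (s, 0))) has_vector_derivative snd (g' (1, 0))) (at 0)"
      by (rule bounded_linear.has_vector_derivative[OF bounded_linear_snd])
    then show ?thesis by (simp add: Y_def[abs_def])
  qed
  have comp: "((\<lambda>s. Y s $ i) has_real_derivative snd (g' (1, 0)) $ i) (at 0)" for i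
    unfolding has_real_derivative_iff_has_vector_derivative
    by (rule bounded_linear.has_vector_derivative[OF bounded_linear_vec_nth dY])
  have inV: "\<forall>\<^sub>F s in nhds 0. (s, 0) \<in> V"
  proof -
    have "eventually (\<lambda>x. x \<in> V) (nhds (0 :: real, 0 :: real^3))"
      using U(3,4) fx0 by (simp add: eventually_nhds_in_open)
    moreover have "isCont (\<lambda>s :: real. (s, 0 :: real^3)) 0" by (intro continuous_intros)
    ultimately show ?thesis using eventually_nhds_continuous[where f = "\<lambda>s. (s, 0)" and z = 0 and P = "\<lambda>x. x \<in> V"] by simp
  qed
  have gs: "g (s, 0) = (s, Y s)" "G (s, Q s) = l s *\<^sub>R \<gamma> (P s)" if "(s, 0) \<in> V" for s
  proof -
    have "f (g (s, 0)) = (s, 0)" using U(5) that by (metis homeomorphism_def)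
    then have "fst (g (s, 0)) = s" "G (fst (g (s, 0)), Q s) - l s *\<^sub>R \<gamma> (P s) = 0"
      by (auto simp: f_def Y_def Q_def P_def l_def)
    then show "g (s, 0) = (s, Y s)" "G (s, Q s) = l s *\<^sub>R \<gamma> (P s)"
      by (simp_all add: Y_def prod_eq_iff)
  qed
  \<comment> \<open>Both \<open>G\<close> and \<open>\<gamma>\<close> lie on the unit sphere, so
    \<open>\<bar>l s\<bar> = 1\<close>.\<close>
  have l1: "l s = 1" if "(s, 0) \<in> V" "l s > 0" for s
    using gs(2)[OF that(1)] S(1)[of "(s, Q s)"] S(2)[of "P s"] that(2) by auto
  have Y0: "Y 0 = y0" by (simp add: Y_def g0 x0_def)
  have "\<forall>\<^sub>F s in nhds 0. l s > 0"
  proof -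
    have "isCont l 0" using comp[of 3] unfolding l_def[abs_def] by (rule DERIV_isCont)
    moreover have "eventually (\<lambda>r. r > 0) (nhds (l 0))"
      using eventually_nhds_in_open[of "{0<..}" "l 0"] by (simp add: l_def Y0 y0)
    ultimately show ?thesis by (rule eventually_nhds_continuous)
  qed
  with inV have cross: "\<forall>\<^sub>F s in nhds 0. G (s, Q s) = \<gamma> (P s)"
  proof eventually_elim
    case (elim s)
    then show ?case using gs(2)[of s] l1[of s] by simp
  qed
  have uniq: "\<forall>\<^sub>F x in nhds (0, t0, k). case x of (s, q, p) \<Rightarrow> G (s, q) = \<gamma> p \<longrightarrow> q = Q s \<and> p = P s"
  proof -
    \<comment> \<open>A solution near the given one, completed by \<open>l = 1\<close>, lies in the
      set where \<open>g\<close> inverts \<open>f\<close>.\<close>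
    define m where "m = (\<lambda>x :: real \<times> real \<times> real. (fst x, fst (snd x) *\<^sub>R axis 1 1 + snd (snd x) *\<^sub>R axis 2 1 + axis 3 1 :: real^3))"
    have m0: "m (0, t0, k) = x0" by (simp add: m_def x0_def y0_def)
    have "eventually (\<lambda>x. x \<in> U) (nhds (m (0, t0, k)))"
      using U(1,2) by (simp add: m0 eventually_nhds_in_open)
    moreover have "isCont m (0, t0, k)" unfolding m_def by (intro continuous_intros)
    ultimately have "\<forall>\<^sub>F x in nhds (0, t0, k). m x \<in> U"
      using eventually_nhds_continuous[where f = m and z = "(0, t0, k)" and P = "\<lambda>x. x \<in> U"] by simp
    then show ?thesis
    proof eventually_elim
      case (elim x)
      obtain s q p where x: "x = (s, q, p)" by (cases x)
      have mx: "fst (m x) = s" "snd (m x) $ 1 = q" "snd (m x) $ 2 = p" "snd (m x) $ 3 = 1"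
        by (simp_all add: m_def x axis_def)
      have "q = Q s \<and> p = P s" if "G (s, q) = \<gamma> p"
      proof -
        have "f (m x) = (s, 0)" using that by (simp add: f_def mx)
        moreover have "g (f (m x)) = m x" using U(5) elim by (simp add: homeomorphism_def)
        ultimately have "Y s = snd (m x)" by (simp add: Y_def)
        then show ?thesis using mx by (simp add: Q_def P_def)
      qed
      then show ?case by (simp add: x)
    qed
  qed
  have "f' x0 (g' (1, 0)) = (1, 0)" by (rule U(7))
  then have "fst (g' (1, 0)) = 1"
    "DG (0, t0) (1, snd (g' (1, 0)) $ 1) = (snd (g' (1, 0)) $ 2) *\<^sub>R \<gamma>' k + (snd (g' (1, 0)) $ 3) *\<^sub>R \<gamma> k"
    unfolding f'0 by auto
  then have E: "DG (0, t0) (1, snd (g' (1, 0)) $ 1) = (snd (g' (1, 0)) $ 2) *\<^sub>R \<gamma>' k + (snd (g' (1, 0)) $ 3) *\<^sub>R \<gamma> k"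
    by blast
  have dP: "(P has_real_derivative snd (g' (1, 0)) $ 2) (at 0)"
    and dQ: "(Q has_real_derivative snd (g' (1, 0)) $ 1) (at 0)"
    using comp unfolding P_def[abs_def] Q_def[abs_def] by blast+
  have PQ0: "P 0 = k" "Q 0 = t0" by (simp_all add: P_def Q_def Y0 y0)
  show ?thesis by (rule that[OF PQ0 dP dQ E cross uniq])
qed

text \<open>Everything about the move of one branch that does not involve the orders of the
  branches. Of the singular doodle it keeps the immersion, the transversality of the crossings and
  the finiteness of their parameters.\<close>

locale branch_move =
  fixes \<gamma> :: curve and t0 :: real and F :: "real \<Rightarrow> curve" and a b c :: real
  assumes imm: "immersed_curve \<gamma>"
    and fin: "finite {s. \<exists>t. crossing \<gamma> s t}"
    and transversal: "\<And>s t. crossing \<gamma> s t \<Longrightarrow> orient \<gamma> s t \<noteq> 0"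
    and t0: "t0 \<in> {0..<1}"
    and smooth: "smooth_on UNIV (\<lambda>(s, t). F s t)" and F0: "F 0 = \<gamma>"
    and FS: "\<And>s t. F s t \<in> S2" and Fper: "\<And>s t. F s (t + 1) = F s t"
    and ab: "a < t0" "t0 < b" "b < a + 1"
    and only: "\<And>t. t \<in> {a..b} \<Longrightarrow> t \<noteq> t0 \<Longrightarrow> \<gamma> t \<notin> self_intersections \<gamma>"
    and Fout: "\<And>s t. t \<notin> periodic {a<..<b} \<Longrightarrow> F s t = \<gamma> t"
    and c: "c > 0" "((\<lambda>s. F s t0) has_vector_derivative c *\<^sub>R cross3 (\<gamma> t0) (tangent \<gamma> t0)) (at 0)"
begin

definition "others = {k. crossing \<gamma> t0 k}"

text \<open>The cotangent of the oriented angle from the moved branch to the branch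
  \<open>k\<close>, as a dot product divided by a determinant. Up to the factor \<open>c\<close> it
  is the rate at which the crossing with \<open>k\<close> slides along the moved branch.\<close>

definition "rel_cot k = (tangent \<gamma> t0 \<bullet> tangent \<gamma> k) / orient \<gamma> t0 k"

lemma F_of_int: "F s (t + of_int m) = F s t"
  by (rule periodic_of_int[of "F s", OF Fper])

lemma F_frac: "F s (frac t) = F s t"
  using F_of_int[of s t "- \<lfloor>t\<rfloor>"] by (simp add: frac_def)

lemma frac_t0: "frac t0 = t0"
  using t0 by (simp add: frac_eq)

lemma crossing_not_in_arc:
  assumes "crossing \<gamma> u v" "u \<noteq> t0" shows "u \<notin> periodic {a..b}"
proof
  assume "u \<in> periodic {a..b}"
  then obtain w where w: "w \<in> {a..b}" "frac w = frac u" by (metis periodic_lift)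
  have u: "frac u = u" using assms(1) by (auto simp: crossing_def frac_eq)
  have "\<gamma> w = \<gamma> u" using w(2) immersed_curve_frac[OF imm] by metis
  then have "\<gamma> w \<in> self_intersections \<gamma>" using self_intersectionI[OF assms(1)] by simp
  then have "w = t0" using only[OF w(1)] by blast
  then show False using w(2) u frac_t0 assms(2) by simp
qed

text \<open>The moving arc has no parameter of a self-intersection other than \<open>t0\<close>, so
  every other crossing parameter has a neighbourhood on which nothing moves.\<close>

lemma crossing_near_fixed:
  assumes "crossing \<gamma> u v" "u \<noteq> t0"
  obtains T where "open T" "u \<in> T" "\<And>s t. t \<in> T \<Longrightarrow> F s t = \<gamma> t"
proof -
  obtain T where T: "open T" "u \<in> T" "T \<inter> periodic {a..b} = {}"
    using open_compl_periodic[OF _ ab(3) crossing_not_in_arc[OF assms]] ab by auto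
  have "{a<..<b} \<subseteq> {a..b}" by auto
  then have "F s t = \<gamma> t" if "t \<in> T" for s t
    using T(3) that periodic_mono by (intro Fout) blast
  then show ?thesis using that T by blast
qed

lemma crossing_fixed:
  assumes "crossing \<gamma> u v" "u \<noteq> t0"
  shows "F s u = \<gamma> u" "tangent (F s) u = tangent \<gamma> u"
proof -
  obtain T where T: "open T" "u \<in> T" "\<And>s t. t \<in> T \<Longrightarrow> F s t = \<gamma> t"
    using crossing_near_fixed[OF assms] by blast
  then show "F s u = \<gamma> u" by blast
  show "tangent (F s) u = tangent \<gamma> u" by (rule tangent_cong_open[OF imm T(1,2)]) (rule T(3))
qed

text \<open>One choice of the derivative, so that its values and its continuity refer to the same
  function.\<close>

definition "DF = (SOME D. (\<forall>z. ((\<lambda>(s, t). F s t) has_derivative D z) (at z)) \<and> (\<forall>v. continuous_on UNIV (\<lambda>z. D z v)))"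

lemma DF: "((\<lambda>(s, t). F s t) has_derivative DF z) (at z)" "continuous_on UNIV (\<lambda>z. DF z v)"
proof -
  have "\<exists>D. (\<forall>z. ((\<lambda>(s, t). F s t) has_derivative D z) (at z)) \<and> (\<forall>v. continuous_on UNIV (\<lambda>z. D z v))"
    by (rule smooth_on_open_C1[OF smooth open_UNIV]) blast
  from someI_ex[OF this, folded DF_def]
  show "((\<lambda>(s, t). F s t) has_derivative DF z) (at z)" "continuous_on UNIV (\<lambda>z. DF z v)" by blast+
qed

lemma F_tangent: "tangent (F s) t = DF (s, t) (0, 1)" "(F s has_vector_derivative DF (s, t) (0, 1)) (at t)"
proof -
  have "((\<lambda>t. (s, t)) has_vector_derivative (0, 1)) (at t)"
    by (intro has_vector_derivative_Pair has_vector_derivative_const has_vector_derivative_id)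
  from has_derivative_along_curve[OF DF(1) this]
  show "(F s has_vector_derivative DF (s, t) (0, 1)) (at t)" by simp
  then show "tangent (F s) t = DF (s, t) (0, 1)" by (rule vector_derivative_at)
qed

lemma \<gamma>_tangent: "DF (0, t) (0, 1) = tangent \<gamma> t"
  using F_tangent(1)[of 0 t] by (simp add: F0)

lemma F_velocity: "DF (0, t0) (1, 0) = c *\<^sub>R cross3 (\<gamma> t0) (tangent \<gamma> t0)"
proof -
  have "((\<lambda>s. (s, t0)) has_vector_derivative (1, 0)) (at 0)"
    by (intro has_vector_derivative_Pair has_vector_derivative_const has_vector_derivative_id)
  from has_derivative_along_curve[OF DF(1) this]
  have "((\<lambda>s. F s t0) has_vector_derivative DF (0, t0) (1, 0)) (at 0)" by simp
  then show ?thesis using c(2) by (rule vector_derivative_unique_at)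
qed

lemma F_isCont: "isCont (\<lambda>(s, t). F s t) z"
  using DF(1) by (rule has_derivative_continuous)

lemma tangent_isCont: "isCont (\<lambda>(s, t). tangent (F s) t) z"
proof -
  have "(\<lambda>(s, t). tangent (F s) t) = (\<lambda>z. DF z (0, 1))" by (auto simp: F_tangent(1))
  moreover have "isCont (\<lambda>z. DF z (0, 1)) z"
    using DF(2)[of "(0, 1)"] continuous_on_eq_continuous_at[OF open_UNIV] by blast
  ultimately show ?thesis by simp
qed

lemma orient_others: "k \<in> others \<Longrightarrow> orient \<gamma> t0 k \<noteq> 0"
  by (simp add: others_def transversal)

text \<open>The crossing with branch \<open>k\<close> persists by
  \<open>crossing_continuation\<close>, and since the curve near \<open>k\<close> does not move,
  \<open>\<gamma>\<close> may be replaced by \<open>F s\<close> there. The derivatives come from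
  differentiating the crossing equation at 0.\<close>

lemma branch_crossing:
  assumes k: "k \<in> others"
  shows "\<exists>P Q. P 0 = k \<and> Q 0 = t0
    \<and> (P has_real_derivative c * (tangent \<gamma> t0 \<bullet> tangent \<gamma> t0) / orient \<gamma> t0 k) (at 0)
    \<and> (Q has_real_derivative c * rel_cot k) (at 0)
    \<and> (\<forall>\<^sub>F s in nhds 0. F s (Q s) = F s (P s))
    \<and> (\<forall>\<^sub>F x in nhds (0, t0, k). case x of (s, q, p) \<Rightarrow> F s q = F s p \<longrightarrow> q = Q s \<and> p = P s)"
proof -
  have cr: "crossing \<gamma> t0 k" using k by (simp add: others_def)
  have kt: "k \<noteq> t0" and e: "\<gamma> t0 = \<gamma> k" using cr by (auto simp: crossing_def)
  define G where "G = (\<lambda>(s, t). F s t)"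
  define x where "x = \<gamma> k"
  define v where "v = tangent \<gamma> t0"
  define w where "w = tangent \<gamma> k"
  define o1 where "o1 = orient \<gamma> t0 k"
  have o1: "o1 = x \<bullet> cross3 v w" "o1 \<noteq> 0" using orient_others[OF k] e by (simp_all add: o1_def orient_def x_def v_def w_def)
  have xS: "x \<in> S2" using imm by (simp add: x_def immersed_curve_def)
  then have xx: "x \<bullet> x = 1" by (simp add: norm_eq_1)
  have xv: "x \<bullet> v = 0" "x \<bullet> w = 0" using tangent_orthogonal[OF imm, of t0] tangent_orthogonal[OF imm, of k] e
    by (simp_all add: x_def v_def w_def)
  have c\<gamma>: "continuous_on UNIV (tangent \<gamma>)"
  proof -
    have "continuous_on UNIV (\<lambda>t :: real. DF (0, t) (0, 1))"
      by (rule continuous_on_compose2[OF DF(2)]) (auto intro!: continuous_intros)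
    then show ?thesis by (simp add: \<gamma>_tangent)
  qed
  obtain P Q p' q' l' where PQ: "P 0 = k" "Q 0 = t0"
    "(P has_real_derivative p') (at 0)" "(Q has_real_derivative q') (at 0)"
    "DF (0, t0) (1, q') = p' *\<^sub>R tangent \<gamma> k + l' *\<^sub>R \<gamma> k"
    "\<forall>\<^sub>F s in nhds 0. G (s, Q s) = \<gamma> (P s)"
    "\<forall>\<^sub>F x in nhds (0, t0, k). case x of (s, q, p) \<Rightarrow> G (s, q) = \<gamma> p \<longrightarrow> q = Q s \<and> p = P s"
  proof (rule crossing_continuation[of G DF \<gamma> "tangent \<gamma>" t0 k])
    show "(G has_derivative DF z) (at z)" for z using DF(1) by (simp add: G_def)
    show "continuous_on UNIV (\<lambda>z. DF z v)" for v by (rule DF(2))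
    show "(\<gamma> has_vector_derivative tangent \<gamma> t) (at t)" for t by (rule immersed_curve_deriv[OF imm])
    show "continuous_on UNIV (tangent \<gamma>)" by (rule c\<gamma>)
    show "G z \<in> S2" for z using FS by (cases z) (simp add: G_def)
    show "\<gamma> t \<in> S2" for t using imm by (simp add: immersed_curve_def)
    show "G (0, t0) = \<gamma> k" using e by (simp add: G_def F0)
    show "\<gamma> k \<bullet> cross3 (DF (0, t0) (0, 1)) (tangent \<gamma> k) \<noteq> 0" using o1 by (simp add: \<gamma>_tangent x_def v_def w_def)
    show "\<gamma> k \<bullet> DF (0, t0) (0, 1) = 0" "\<gamma> k \<bullet> tangent \<gamma> k = 0" using xv by (simp_all add: \<gamma>_tangent x_def v_def w_def)
  qed blast
  have "DF (0, t0) (1, q') = DF (0, t0) ((1, 0) + q' *\<^sub>R (0, 1))" by simp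
  also have "\<dots> = DF (0, t0) (1, 0) + q' *\<^sub>R DF (0, t0) (0, 1)"
    using DF(1)[THEN has_derivative_linear, of "(0, t0)"] by (simp only: linear_add linear_scale)
  also have "\<dots> = c *\<^sub>R cross3 x v + q' *\<^sub>R v"
    by (simp only: F_velocity \<gamma>_tangent) (simp add: x_def v_def e)
  \<comment> \<open>Here \<open>p'\<close> and \<open>q'\<close> are the unknown speeds of the
    crossing along branch \<open>k\<close> and along the moved branch.\<close>
  finally have E: "c *\<^sub>R cross3 x v + q' *\<^sub>R v = p' *\<^sub>R w + l' *\<^sub>R x"
    using PQ(5) by (simp add: w_def x_def)
  \<comment> \<open>Pairing with \<open>cross3 x v\<close> removes \<open>v\<close> and
    \<open>x\<close> and leaves \<open>p'\<close>; below, pairing with \<open>cross3 x w\<close>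
    leaves \<open>q'\<close>.\<close>
  have "c * (v \<bullet> v) = p' * o1"
  proof -
    have "cross3 x v \<bullet> cross3 x v = v \<bullet> v" by (simp add: dot_cross xx xv inner_commute[of v x])
    moreover have "w \<bullet> cross3 x v = o1" unfolding o1(1) by (rule triple_rotate)
    ultimately show ?thesis
      using arg_cong[OF E, of "\<lambda>y. y \<bullet> cross3 x v"] by (simp add: inner_add_left dot_cross_self)
  qed
  moreover have "c * (v \<bullet> w) = q' * o1"
  proof -
    have "cross3 x v \<bullet> cross3 x w = v \<bullet> w" by (simp add: dot_cross xx xv inner_commute[of v x])
    moreover have "v \<bullet> cross3 x w = - o1" unfolding o1(1) by (rule triple_swap)
    ultimately show ?thesis
      using arg_cong[OF E, of "\<lambda>y. y \<bullet> cross3 x w"] by (simp add: inner_add_left dot_cross_self)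
  qed
  ultimately have pq: "p' = c * (v \<bullet> v) / o1" "q' = c * ((v \<bullet> w) / o1)"
    using o1(2) by (simp_all add: field_simps)
  obtain T where T: "open T" "k \<in> T" "\<And>s t. t \<in> T \<Longrightarrow> F s t = \<gamma> t"
    using crossing_near_fixed[OF crossing_sym[OF cr] kt] by blast
  have "\<forall>\<^sub>F s in nhds 0. P s \<in> T"
    using eventually_nhds_continuous[OF DERIV_isCont[OF PQ(3)], of "\<lambda>y. y \<in> T"] T(1,2) PQ(1)
    by (simp add: eventually_nhds_in_open)
  with PQ(6) have ev1: "\<forall>\<^sub>F s in nhds 0. F s (Q s) = F s (P s)"
    by eventually_elim (simp add: T(3) G_def)
  have "\<forall>\<^sub>F x in nhds (0 :: real, t0, k). snd (snd x) \<in> T"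
  proof -
    have "isCont (\<lambda>x :: real \<times> real \<times> real. snd (snd x)) (0, t0, k)" by (intro continuous_intros)
    from eventually_nhds_continuous[OF this, of "\<lambda>y. y \<in> T"] show ?thesis
      using T(1,2) by (simp add: eventually_nhds_in_open)
  qed
  with PQ(7) have ev2: "\<forall>\<^sub>F x in nhds (0, t0, k). case x of (s, q, p) \<Rightarrow> F s q = F s p \<longrightarrow> q = Q s \<and> p = P s"
    by eventually_elim (auto simp: T(3) G_def)
  show ?thesis
    using PQ(1-4) ev1 ev2 unfolding pq rel_cot_def v_def w_def o1_def by blast
qed

text \<open>In the direction of the tangent at \<open>\<tau>\<close> the curve \<open>F s\<close> is
  strictly increasing near \<open>\<tau>\<close>, uniformly for small \<open>s\<close>. This
  excludes new crossings near the diagonal.\<close>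

lemma F_locally_injective:
  "\<forall>\<^sub>F x in nhds (0, \<tau>, \<tau>). case x of (s, q, p) \<Rightarrow> F s q = F s p \<longrightarrow> q = p"
proof -
  define v where "v = tangent \<gamma> \<tau>"
  have "v \<noteq> 0" using imm by (simp add: v_def immersed_curve_def)
  then have pos: "DF (0, \<tau>) (0, 1) \<bullet> v > 0" by (simp add: \<gamma>_tangent v_def)
  have "isCont (\<lambda>z. DF z (0, 1) \<bullet> v) (0, \<tau>)"
    using DF(2)[of "(0, 1)"] by (intro continuous_intros) (simp add: continuous_on_eq_continuous_at)
  moreover have "eventually (\<lambda>y. y > 0) (nhds (DF (0, \<tau>) (0, 1) \<bullet> v))"
    using pos eventually_nhds_in_open[of "{0<..}" "DF (0, \<tau>) (0, 1) \<bullet> v"] by simp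
  ultimately have "\<forall>\<^sub>F z in nhds (0, \<tau>). DF z (0, 1) \<bullet> v > 0"
    by (rule eventually_nhds_continuous)
  then obtain d where d: "d > 0" "\<And>z. dist z (0, \<tau>) < d \<Longrightarrow> DF z (0, 1) \<bullet> v > 0"
    unfolding eventually_nhds_metric by blast
  have box: "DF (s, q) (0, 1) \<bullet> v > 0" if "\<bar>s\<bar> < d / 2" "\<bar>q - \<tau>\<bar> < d / 2" for s q
  proof (rule d(2))
    have "dist (s, q) (0, \<tau>) \<le> \<bar>s\<bar> + \<bar>q - \<tau>\<bar>"
      using real_sqrt_sum_squares_triangle_ineq[of "\<bar>s\<bar>" 0 0 "\<bar>q - \<tau>\<bar>"]
      by (simp add: dist_Pair_Pair dist_real_def)
    then show "dist (s, q) (0, \<tau>) < d" using that by linarith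
  qed
  have inj: "q = p" if "\<bar>s\<bar> < d / 2" "\<bar>q - \<tau>\<bar> < d / 2" "\<bar>p - \<tau>\<bar> < d / 2" "F s q = F s p" for s q p
  proof -
    have *: "F s q \<bullet> v < F s p \<bullet> v" if qp: "\<bar>q - \<tau>\<bar> < d / 2" "\<bar>p - \<tau>\<bar> < d / 2" "q < p" for q p
    proof (rule DERIV_pos_imp_increasing[OF qp(3)])
      fix r assume r: "q \<le> r" "r \<le> p"
      have "((\<lambda>t. F s t \<bullet> v) has_vector_derivative DF (s, r) (0, 1) \<bullet> v) (at r)"
        by (rule bounded_linear.has_vector_derivative[OF bounded_linear_inner_left F_tangent(2)])
      moreover have "\<bar>r - \<tau>\<bar> < d / 2" using qp(1,2) r by arith
      then have "DF (s, r) (0, 1) \<bullet> v > 0" by (rule box[OF \<open>\<bar>s\<bar> < d / 2\<close>])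
      ultimately show "\<exists>y. ((\<lambda>t. F s t \<bullet> v) has_real_derivative y) (at r) \<and> 0 < y"
        by (auto simp: has_real_derivative_iff_has_vector_derivative)
    qed
    show ?thesis using *[of q p] *[of p q] that by (cases q p rule: linorder_cases) auto
  qed
  show ?thesis unfolding eventually_nhds_metric
  proof (intro exI[of _ "d / 2"] conjI allI impI)
    show "d / 2 > 0" using d(1) by simp
    fix x :: "real \<times> real \<times> real" assume x: "dist x (0, \<tau>, \<tau>) < d / 2"
    obtain s q p where [simp]: "x = (s, q, p)" by (cases x)
    have "dist s 0 < d / 2" "dist (q, p) (\<tau>, \<tau>) < d / 2"
      using x dist_fst_le[of x "(0, \<tau>, \<tau>)"] dist_snd_le[of x "(0, \<tau>, \<tau>)"] by auto
    moreover have "dist q \<tau> \<le> dist (q, p) (\<tau>, \<tau>)" "dist p \<tau> \<le> dist (q, p) (\<tau>, \<tau>)"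
      using dist_fst_le[of "(q, p)" "(\<tau>, \<tau>)"] dist_snd_le[of "(q, p)" "(\<tau>, \<tau>)"] by auto
    ultimately show "case x of (s, q, p) \<Rightarrow> F s q = F s p \<longrightarrow> q = p"
      using inj[of s q p] by (auto simp: dist_real_def)
  qed
qed

lemma F_isCont_compose:
  assumes "isCont g z" "isCont h z" shows "isCont (\<lambda>x. F (g x) (h x)) z"
  using isCont_o2[OF continuous_Pair[OF assms] F_isCont] by simp

lemma tangent_isCont_compose:
  assumes "isCont g z" "isCont h z" shows "isCont (\<lambda>x. tangent (F (g x)) (h x)) z"
  using isCont_o2[OF continuous_Pair[OF assms] tangent_isCont] by simp

text \<open>By compactness a local statement at each pair \<open>(q0, p0)\<close> suffices. Either
  the images differ and stay apart, or the parameters agree modulo 1 and local injectivity applies,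
  or the pair is an old crossing; its parameter in the arc is then \<open>t0\<close>, and the
  uniqueness of the continued crossing applies.\<close>

lemma F_crossings_near:
  assumes loc: "\<And>k. k \<in> others \<Longrightarrow> \<forall>\<^sub>F x in nhds (0, t0, k). case x of (s, q, p) \<Rightarrow>
    F s q = F s p \<longrightarrow> q = Q k s \<and> p = P k s"
  shows "\<forall>\<^sub>F s in nhds 0. \<forall>q\<in>{a..b}. \<forall>p. F s q = F s p \<longrightarrow>
    (\<exists>m::int. q = p + of_int m) \<or> (\<exists>k\<in>others. \<exists>m::int. q = Q k s \<and> p = P k s + of_int m)"
proof -
  define good where "good s q p \<longleftrightarrow> (F s q = F s p \<longrightarrow>
    (\<exists>m::int. q = p + of_int m) \<or> (\<exists>k\<in>others. \<exists>m::int. q = Q k s \<and> p = P k s + of_int m))" for s q p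
  have "\<forall>\<^sub>F s in nhds 0. \<forall>w\<in>{a..b} \<times> {a..a+1}. good s (fst w) (snd w)"
  proof (rule eventually_nhds_compact)
    show "compact ({a..b} \<times> {a..a+1})" by (intro compact_Times compact_Icc)
    fix z assume "z \<in> {a..b} \<times> {a..a+1}"
    then obtain q0 p0 where z: "z = (q0, p0)" "q0 \<in> {a..b}" by auto
    have shift: "isCont (\<lambda>x. (fst x, fst (snd x), snd (snd x) + of_int m)) (0 :: real, z)" for m :: int
      by (intro continuous_intros)
    consider "\<gamma> q0 \<noteq> \<gamma> p0" | m :: int where "q0 = p0 + of_int m" | "\<gamma> q0 = \<gamma> p0" "\<forall>m::int. q0 \<noteq> p0 + of_int m" by blast
    then show "\<forall>\<^sub>F x in nhds (0, z). good (fst x) (fst (snd x)) (snd (snd x))"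
    proof cases
      case 1
      have "isCont (\<lambda>x. F (fst x) (fst (snd x)) - F (fst x) (snd (snd x))) (0, z)"
        by (intro continuous_diff F_isCont_compose continuous_intros)
      moreover have "eventually (\<lambda>y. y \<in> - {0}) (nhds (F (fst (0, z)) (fst (snd (0 :: real, z))) - F (fst (0, z)) (snd (snd (0 :: real, z)))))"
        using 1 by (intro eventually_nhds_in_open) (auto simp: z F0)
      ultimately have "\<forall>\<^sub>F x in nhds (0, z). F (fst x) (fst (snd x)) - F (fst x) (snd (snd x)) \<in> - {0}"
        by (rule eventually_nhds_continuous)
      then show ?thesis by eventually_elim (auto simp: good_def)
    next
      case 2
      have "\<forall>\<^sub>F x in nhds (0, z). (\<lambda>x. case x of (s, q, p) \<Rightarrow> F s q = F s p \<longrightarrow> q = p)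
          (fst x, fst (snd x), snd (snd x) + of_int m)"
        by (rule eventually_nhds_continuous[OF shift]) (simp add: z 2 F_locally_injective)
      then show ?thesis by eventually_elim (auto simp: good_def F_of_int)
    next
      case 3
      have ne: "frac q0 \<noteq> frac p0" using 3(2) frac_eq_of_int by blast
      have cr: "crossing \<gamma> (frac q0) (frac p0)" using crossing_frac[OF imm 3(1) ne] .
      then have "\<gamma> q0 \<in> self_intersections \<gamma>" using self_intersectionI immersed_curve_frac[OF imm] by metis
      then have q0: "q0 = t0" using only[OF z(2)] by blast
      define k where "k = frac p0"
      have k: "k \<in> others" using cr q0 frac_t0 by (simp add: others_def k_def)
      have p0: "p0 + of_int (- \<lfloor>p0\<rfloor>) = k" by (simp add: k_def frac_def)
      have "\<forall>\<^sub>F x in nhds (0, z). (\<lambda>x. case x of (s, q, p) \<Rightarrow> F s q = F s p \<longrightarrow> q = Q k s \<and> p = P k s)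
          (fst x, fst (snd x), snd (snd x) + of_int (- \<lfloor>p0\<rfloor>))"
        by (rule eventually_nhds_continuous[OF shift]) (use loc[OF k] p0 q0 in \<open>simp add: z\<close>)
      then show ?thesis
      proof eventually_elim
        case (elim x)
        obtain s q p where x: "x = (s, q, p)" by (cases x)
        show ?case
        proof (unfold good_def x fst_conv snd_conv, intro impI disjI2)
          assume "F s q = F s p"
          then have "F s q = F s (p + of_int (- \<lfloor>p0\<rfloor>))" by (simp only: F_of_int)
          then have "q = Q k s" "p + of_int (- \<lfloor>p0\<rfloor>) = P k s" using elim x by auto
          then have "q = Q k s" "p = P k s + of_int \<lfloor>p0\<rfloor>" by auto
          then show "\<exists>k\<in>others. \<exists>m::int. q = Q k s \<and> p = P k s + of_int m" using k by blast
        qed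
      qed
    qed
  qed
  then show ?thesis
  proof eventually_elim
    case (elim s)
    show ?case
    proof (intro ballI allI)
      fix q p assume q: "q \<in> {a..b}"
      \<comment> \<open>Reduces \<open>p\<close> modulo 1 to the compact interval
        \<open>{a..a+1}\<close>.\<close>
      define p' where "p' = p + of_int (- \<lfloor>p - a\<rfloor>)"
      have "p' \<in> {a..a+1}" unfolding p'_def by simp linarith
      then have "good s q p'" using elim q by auto
      moreover have "F s p' = F s p" by (simp only: p'_def F_of_int)
      moreover have "\<exists>m::int. q = p + of_int m" if "q = p' + of_int m" for m :: int
        using that by (intro exI[of _ "m - \<lfloor>p - a\<rfloor>"]) (simp add: p'_def)
      moreover have "\<exists>m::int. p = y + of_int m" if "p' = y + of_int m" for y and m :: int
        using that by (intro exI[of _ "m + \<lfloor>p - a\<rfloor>"]) (simp add: p'_def)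
      ultimately show "F s q = F s p \<longrightarrow>
        (\<exists>m::int. q = p + of_int m) \<or> (\<exists>k\<in>others. \<exists>m::int. q = Q k s \<and> p = P k s + of_int m)"
        unfolding good_def by metis
    qed
  qed
qed

text \<open>Equal cotangents make the combination \<open>u\<close> of the two tangents both parallel
  and orthogonal to \<open>v\<close>, hence zero, and the two branches would be tangent to each
  other. Distinct crossings therefore separate to first order along the moved branch.\<close>

lemma rel_cot_inj:
  assumes "k \<in> others" "l \<in> others" "k \<noteq> l"
  shows "rel_cot k \<noteq> rel_cot l"
proof
  assume eq: "rel_cot k = rel_cot l"
  define x where "x = \<gamma> t0"
  define v where "v = tangent \<gamma> t0"
  define w where "w j = tangent \<gamma> j" for j
  define o' where "o' j = orient \<gamma> t0 j" for j
  have o': "o' j = x \<bullet> cross3 v (w j)" for j by (simp add: o'_def orient_def x_def v_def w_def)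
  have on: "o' k \<noteq> 0" "o' l \<noteq> 0" using orient_others assms by (auto simp: o'_def)
  have e: "\<gamma> k = x" "\<gamma> l = x" using assms by (auto simp: others_def crossing_def x_def)
  have x0: "x \<noteq> 0" using imm by (auto simp: x_def immersed_curve_def sphere_def dest: spec[of _ t0])
  have xo: "x \<bullet> v = 0" "x \<bullet> w k = 0" "x \<bullet> w l = 0"
    using tangent_orthogonal[OF imm, of t0] tangent_orthogonal[OF imm, of k] tangent_orthogonal[OF imm, of l] e
    by (simp_all add: x_def v_def w_def)
  define u where "u = o' l *\<^sub>R w k - o' k *\<^sub>R w l"
  have "v \<bullet> w k * o' l = v \<bullet> w l * o' k"
    using eq on by (simp add: rel_cot_def v_def w_def o'_def frac_eq_eq)
  then have vu: "v \<bullet> u = 0" by (simp add: u_def inner_diff_right mult.commute)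
  have "x \<bullet> cross3 v u = 0"
    by (simp add: u_def Cross3.right_diff_distrib cross_mult_right inner_diff_right flip: o')
  moreover have "cross3 x (cross3 v u) = 0" by (simp add: Lagrange xo u_def inner_diff_right)
  ultimately have "cross3 v u = 0" using norm_and_cross_eq_0[of x "cross3 v u"] x0 by auto
  moreover have "v \<noteq> 0" using imm by (simp add: v_def immersed_curve_def)
  ultimately have "u = 0" using norm_and_cross_eq_0[of v u] vu by auto
  then have "o' l *\<^sub>R w k = o' k *\<^sub>R w l" by (simp add: u_def)
  then have "o' l *\<^sub>R cross3 (w k) (w l) = o' k *\<^sub>R cross3 (w l) (w l)" by (metis cross_mult_left)
  then have "cross3 (w k) (w l) = 0" using on by simp
  then have "orient \<gamma> k l = 0" by (simp add: orient_def w_def)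
  moreover have "crossing \<gamma> k l" using assms e by (auto simp: others_def crossing_def)
  ultimately show False using transversal by blast
qed

end

text \<open>The quotient \<open>f s / s\<close> tends to \<open>d\<close>. The factor
  \<open>sgn s\<close> lets one statement cover both directions of the move.\<close>

lemma eventually_sgn_deriv:
  fixes f :: "real \<Rightarrow> real"
  assumes "(f has_real_derivative d) (at 0)" "f 0 = 0" "d \<noteq> 0"
  shows "\<forall>\<^sub>F s in at 0. sgn (f s) = sgn s * sgn d"
proof -
  have lim: "((\<lambda>h. f h / h) \<longlongrightarrow> d) (at 0)" using assms(1,2) by (simp add: DERIV_def)
  have ne: "\<forall>\<^sub>F h in at (0::real). h \<noteq> 0" by (simp add: eventually_at_filter)
  have sg: "sgn (f h) = sgn h * sgn (f h / h)" if "h \<noteq> 0" for h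
    using that by (simp add: sgn_divide)
  have "\<forall>\<^sub>F h in at 0. sgn (f h / h) = sgn d"
  proof (cases "d > 0")
    case True
    from order_tendstoD(1)[OF lim this] show ?thesis by eventually_elim (simp only: sgn_pos True)
  next
    case False
    then have "d < 0" using assms(3) by simp
    from order_tendstoD(2)[OF lim this] show ?thesis by eventually_elim (simp only: sgn_neg \<open>d < 0\<close>)
  qed
  with ne show ?thesis by eventually_elim (use sg in metis)
qed

lemma eventually_sgn_isCont:
  fixes f :: "'a::t2_space \<Rightarrow> real"
  assumes "isCont f x" "f x \<noteq> 0"
  shows "\<forall>\<^sub>F s in nhds x. sgn (f s) = sgn (f x)"
proof -
  have "\<forall>\<^sub>F s in nhds x. f s \<in> (if f x > 0 then {0<..} else {..<0})"
    by (rule eventually_nhds_continuous[OF assms(1), of "\<lambda>y. y \<in> (if f x > 0 then {0<..} else {..<0})"],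
        rule eventually_nhds_in_open) (use assms(2) in auto)
  then show ?thesis by eventually_elim (use assms(2) in \<open>auto split: if_splits\<close>)
qed

lemma eventually_nhds_imp_at: "eventually P (nhds x) \<Longrightarrow> eventually P (at x)"
  unfolding eventually_at_filter by (erule eventually_mono) simp

context branch_move
begin

text \<open>There are finitely many other branches, so the conditions on all of them hold together
  for small \<open>s\<close>. The direction of the move enters the positions through
  \<open>sgn s\<close> and first derivatives, whereas the sign of \<open>orient\<close> at a new
  crossing is independent of it, being continuous and nonzero at 0.\<close>

lemma small_move:
  assumes "\<rho> > 0"
  shows "\<forall>\<^sub>F s in at 0. \<exists>P Q :: real \<Rightarrow> real.
    (\<forall>k\<in>others. \<bar>P k - k\<bar> < \<rho> \<and> \<bar>Q k - t0\<bar> < \<rho>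
       \<and> sgn (P k - k) = sgn s * sgn (orient \<gamma> t0 k)
       \<and> sgn (orient (F s) (P k) (Q k)) = sgn (orient \<gamma> k t0))
    \<and> (\<forall>k\<in>others. \<forall>l\<in>others. Q k < Q l \<longleftrightarrow> sgn s * rel_cot k < sgn s * rel_cot l)
    \<and> (\<forall>u v. crossing (F s) u v \<longleftrightarrow> crossing \<gamma> u v \<and> u \<noteq> t0 \<and> v \<noteq> t0
       \<or> (\<exists>k\<in>others. (u, v) = (frac (P k), frac (Q k)) \<or> (u, v) = (frac (Q k), frac (P k))))"
proof -
  have "\<exists>P. \<forall>k\<in>others. \<exists>Q. P k 0 = k \<and> Q 0 = t0
    \<and> (P k has_real_derivative c * (tangent \<gamma> t0 \<bullet> tangent \<gamma> t0) / orient \<gamma> t0 k) (at 0)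
    \<and> (Q has_real_derivative c * rel_cot k) (at 0)
    \<and> (\<forall>\<^sub>F s in nhds 0. F s (Q s) = F s (P k s))
    \<and> (\<forall>\<^sub>F x in nhds (0, t0, k). case x of (s, q, p) \<Rightarrow> F s q = F s p \<longrightarrow> q = Q s \<and> p = P k s)"
    by (intro bchoice ballI branch_crossing)
  then obtain P where "\<forall>k\<in>others. \<exists>Q. P k 0 = k \<and> Q 0 = t0
    \<and> (P k has_real_derivative c * (tangent \<gamma> t0 \<bullet> tangent \<gamma> t0) / orient \<gamma> t0 k) (at 0)
    \<and> (Q has_real_derivative c * rel_cot k) (at 0)
    \<and> (\<forall>\<^sub>F s in nhds 0. F s (Q s) = F s (P k s))
    \<and> (\<forall>\<^sub>F x in nhds (0, t0, k). case x of (s, q, p) \<Rightarrow> F s q = F s p \<longrightarrow> q = Q s \<and> p = P k s)" ..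
  from bchoice[OF this] obtain Q where PQ: "\<And>k. k \<in> others \<Longrightarrow> P k 0 = k"
    "\<And>k. k \<in> others \<Longrightarrow> Q k 0 = t0"
    "\<And>k. k \<in> others \<Longrightarrow> (P k has_real_derivative c * (tangent \<gamma> t0 \<bullet> tangent \<gamma> t0) / orient \<gamma> t0 k) (at 0)"
    "\<And>k. k \<in> others \<Longrightarrow> (Q k has_real_derivative c * rel_cot k) (at 0)"
    "\<And>k. k \<in> others \<Longrightarrow> \<forall>\<^sub>F s in nhds 0. F s (Q k s) = F s (P k s)"
    "\<And>k. k \<in> others \<Longrightarrow> \<forall>\<^sub>F x in nhds (0, t0, k). case x of (s, q, p) \<Rightarrow> F s q = F s p \<longrightarrow> q = Q k s \<and> p = P k s"
    by blast
  have finO: "finite others" by (rule finite_subset[OF _ fin]) (auto simp: others_def dest: crossing_sym)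
  note fb = eventually_ball_finite[OF finO]
  have vv: "tangent \<gamma> t0 \<bullet> tangent \<gamma> t0 > 0" using imm by (simp add: immersed_curve_def)
  have cP: "isCont (P k) 0" "isCont (Q k) 0" if "k \<in> others" for k
    using PQ(3,4)[OF that] DERIV_isCont by blast+
  have close: "\<forall>\<^sub>F s in nhds 0. \<bar>f s - y\<bar> < \<rho>" if "isCont f 0" "f 0 = y" for f :: "real \<Rightarrow> real" and y
  proof -
    have "eventually (\<lambda>r. r \<in> ball y \<rho>) (nhds (f 0))"
      using assms that(2) by (intro eventually_nhds_in_open) auto
    from eventually_nhds_continuous[OF that(1) this] show ?thesis
      by eventually_elim (simp add: dist_real_def abs_minus_commute)
  qed
  have e1: "\<forall>\<^sub>F s in at 0. \<forall>k\<in>others. \<bar>P k s - k\<bar> < \<rho>"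
    by (intro fb ballI eventually_nhds_imp_at close cP PQ(1))
  have e2: "\<forall>\<^sub>F s in at 0. \<forall>k\<in>others. \<bar>Q k s - t0\<bar> < \<rho>"
    by (intro fb ballI eventually_nhds_imp_at close cP PQ(2))
  have e3: "\<forall>\<^sub>F s in at 0. \<forall>k\<in>others. sgn (P k s - k) = sgn s * sgn (orient \<gamma> t0 k)"
  proof (intro fb ballI)
    fix k assume k: "k \<in> others"
    have d1: "((\<lambda>s. P k s - k) has_real_derivative c * (tangent \<gamma> t0 \<bullet> tangent \<gamma> t0) / orient \<gamma> t0 k) (at 0)"
      using DERIV_diff[OF PQ(3)[OF k] DERIV_const[of k]] by simp
    have sg: "sgn (c * (tangent \<gamma> t0 \<bullet> tangent \<gamma> t0) / orient \<gamma> t0 k) = sgn (orient \<gamma> t0 k)"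
    proof -
      have "c * (tangent \<gamma> t0 \<bullet> tangent \<gamma> t0) > 0" using c(1) vv by (rule mult_pos_pos)
      then have "sgn (c * (tangent \<gamma> t0 \<bullet> tangent \<gamma> t0)) = 1" by (rule sgn_pos)
      then have "sgn (c * (tangent \<gamma> t0 \<bullet> tangent \<gamma> t0) / orient \<gamma> t0 k) = 1 / sgn (orient \<gamma> t0 k)"
        by (simp only: sgn_divide)
      also have "\<dots> = sgn (orient \<gamma> t0 k)" by (simp add: sgn_if)
      finally show ?thesis .
    qed
    have ne: "c * (tangent \<gamma> t0 \<bullet> tangent \<gamma> t0) / orient \<gamma> t0 k \<noteq> 0"
      using c(1) vv orient_others[OF k] by simp
    have "\<forall>\<^sub>F s in at 0. sgn (P k s - k) = sgn s * sgn (c * (tangent \<gamma> t0 \<bullet> tangent \<gamma> t0) / orient \<gamma> t0 k)"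
      by (rule eventually_sgn_deriv[OF d1 _ ne]) (simp add: PQ(1)[OF k])
    then show "\<forall>\<^sub>F s in at 0. sgn (P k s - k) = sgn s * sgn (orient \<gamma> t0 k)" by (simp only: sg)
  qed
  have e4: "\<forall>\<^sub>F s in at 0. \<forall>k\<in>others. sgn (orient (F s) (P k s) (Q k s)) = sgn (orient \<gamma> k t0)"
  proof (intro fb ballI eventually_nhds_imp_at)
    fix k assume k: "k \<in> others"
    have "isCont (\<lambda>s. orient (F s) (P k s) (Q k s)) 0"
      unfolding orient_def using cP[OF k]
      by (intro continuous_inner continuous_cross F_isCont_compose tangent_isCont_compose continuous_ident)
    moreover have v0: "orient (F 0) (P k 0) (Q k 0) = orient \<gamma> k t0" using PQ(1,2)[OF k] by (simp add: F0)
    moreover have "orient \<gamma> k t0 \<noteq> 0" using k crossing_sym transversal by (simp add: others_def)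
    ultimately show "\<forall>\<^sub>F s in nhds 0. sgn (orient (F s) (P k s) (Q k s)) = sgn (orient \<gamma> k t0)"
      using eventually_sgn_isCont[where x = 0 and f = "\<lambda>s. orient (F s) (P k s) (Q k s)"] by simp
  qed
  have e5: "\<forall>\<^sub>F s in at 0. \<forall>k\<in>others. \<forall>l\<in>others. Q k s < Q l s \<longleftrightarrow> sgn s * rel_cot k < sgn s * rel_cot l"
  proof (intro fb ballI)
    fix k l assume kl: "k \<in> others" "l \<in> others"
    show "\<forall>\<^sub>F s in at 0. Q k s < Q l s \<longleftrightarrow> sgn s * rel_cot k < sgn s * rel_cot l"
    proof (cases "k = l")
      case True
      then show ?thesis by simp
    next
      case False
      have d: "((\<lambda>s. Q l s - Q k s) has_real_derivative c * (rel_cot l - rel_cot k)) (at 0)"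
        using DERIV_diff[OF PQ(4)[OF kl(2)] PQ(4)[OF kl(1)]] by (simp add: right_diff_distrib)
      have ne: "rel_cot l - rel_cot k \<noteq> 0" using rel_cot_inj[OF kl False] by simp
      have "\<forall>\<^sub>F s in at 0. sgn (Q l s - Q k s) = sgn s * sgn (c * (rel_cot l - rel_cot k))"
        by (rule eventually_sgn_deriv[OF d]) (use PQ(2) kl ne c(1) in auto)
      then show ?thesis
      proof eventually_elim
        case (elim s)
        have "sgn (c * (rel_cot l - rel_cot k)) = sgn (rel_cot l - rel_cot k)" using c(1) by (simp add: sgn_mult)
        with elim have *: "sgn (Q l s - Q k s) = sgn s * sgn (rel_cot l - rel_cot k)" by simp
        have "Q k s < Q l s \<longleftrightarrow> sgn (Q l s - Q k s) = 1" by (simp add: sgn_1_pos)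
        also have "\<dots> \<longleftrightarrow> sgn s * (rel_cot l - rel_cot k) > 0"
          unfolding * using ne by (auto simp: sgn_if)
        finally show ?case by (simp add: right_diff_distrib)
      qed
    qed
  qed
  \<comment> \<open>The parameters \<open>k\<close> and \<open>t0\<close> differ modulo 1 and
    \<open>\<int>\<close> is closed, so the two parameters of the new crossing differ modulo 1 as
    well.\<close>
  have e6: "\<forall>\<^sub>F s in at 0. \<forall>k\<in>others. frac (P k s) \<noteq> frac (Q k s)"
  proof (intro fb ballI eventually_nhds_imp_at)
    fix k assume k: "k \<in> others"
    have "k - t0 \<notin> \<int>"
    proof
      assume "k - t0 \<in> \<int>"
      then obtain m where "k = t0 + of_int m" by (auto elim!: Ints_cases simp: algebra_simps)
      then have "frac k = frac t0" using frac_eq_of_int by blast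
      then show False using k t0 by (auto simp: others_def crossing_def frac_eq)
    qed
    then have "eventually (\<lambda>y. y \<in> - \<int>) (nhds (P k 0 - Q k 0))"
      using PQ(1,2)[OF k] by (intro eventually_nhds_in_open) auto
    moreover have "isCont (\<lambda>s. P k s - Q k s) 0" using cP[OF k] by (intro continuous_diff)
    ultimately have "\<forall>\<^sub>F s in nhds 0. P k s - Q k s \<in> - \<int>"
      using eventually_nhds_continuous[where f = "\<lambda>s. P k s - Q k s" and z = 0 and P = "\<lambda>y. y \<in> - \<int>"] by simp
    then show "\<forall>\<^sub>F s in nhds 0. frac (P k s) \<noteq> frac (Q k s)"
      by eventually_elim (auto simp: frac_eq_of_int)
  qed
  have e7: "\<forall>\<^sub>F s in at 0. \<forall>k\<in>others. F s (Q k s) = F s (P k s)"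
    by (intro fb ballI eventually_nhds_imp_at PQ(5))
  have e8: "\<forall>\<^sub>F s in at 0. \<forall>q\<in>{a..b}. \<forall>p. F s q = F s p \<longrightarrow>
    (\<exists>m::int. q = p + of_int m) \<or> (\<exists>k\<in>others. \<exists>m::int. q = Q k s \<and> p = P k s + of_int m)"
    by (intro eventually_nhds_imp_at F_crossings_near PQ(6))
  from e1 e2 e3 e4 e5 e6 e7 e8 show ?thesis
  proof eventually_elim
    case (elim s)
    have arc: "\<exists>k\<in>others. u = frac (Q k s) \<and> v = frac (P k s)"
      if cr: "crossing (F s) u v" and u: "u \<in> periodic {a<..<b}" for u v
    proof -
      obtain q where q: "q \<in> {a<..<b}" "frac q = frac u" using u by (metis periodic_lift)
      have fr: "frac u = u" "frac v = v" using cr by (auto simp: crossing_def frac_eq)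
      have "F s q = F s v" using q(2) fr cr F_frac by (metis crossing_def)
      moreover have "q \<in> {a..b}" using q(1) by auto
      ultimately consider m :: int where "q = v + of_int m" | k m where "k \<in> others" "q = Q k s" "v = P k s + of_int (m :: int)"
        using elim(8) by blast
      then show ?thesis
      proof cases
        case 1
        then have "frac q = frac v" using frac_eq_of_int by blast
        then show ?thesis using q(2) fr cr by (simp add: crossing_def)
      next
        case 2
        then have "frac v = frac (P k s)" using frac_eq_of_int by blast
        then show ?thesis using 2 q(2) fr by auto
      qed
    qed
    have fixed: "crossing \<gamma> u v \<and> u \<noteq> t0 \<and> v \<noteq> t0"
      if cr: "crossing (F s) u v" and uv: "u \<notin> periodic {a<..<b}" "v \<notin> periodic {a<..<b}" for u v
    proof -
      have "t0 \<in> periodic {a<..<b}" unfolding periodic_iff using ab by (intro exI[of _ 0]) simp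
      then have "u \<noteq> t0" "v \<noteq> t0" using uv by auto
      then show ?thesis using cr Fout[OF uv(1)] Fout[OF uv(2)] by (simp add: crossing_def)
    qed
    have "crossing (F s) u v \<longleftrightarrow> crossing \<gamma> u v \<and> u \<noteq> t0 \<and> v \<noteq> t0
       \<or> (\<exists>k\<in>others. (u, v) = (frac (P k s), frac (Q k s)) \<or> (u, v) = (frac (Q k s), frac (P k s)))" for u v
    proof
      assume cr: "crossing (F s) u v"
      consider "u \<in> periodic {a<..<b}" | "v \<in> periodic {a<..<b}" | "u \<notin> periodic {a<..<b}" "v \<notin> periodic {a<..<b}" by blast
      then show "crossing \<gamma> u v \<and> u \<noteq> t0 \<and> v \<noteq> t0
       \<or> (\<exists>k\<in>others. (u, v) = (frac (P k s), frac (Q k s)) \<or> (u, v) = (frac (Q k s), frac (P k s)))"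
      proof cases
        case 1
        then show ?thesis using arc[OF cr] by blast
      next
        case 2
        then show ?thesis using arc[OF crossing_sym[OF cr]] by blast
      next
        case 3
        then show ?thesis using fixed[OF cr] by blast
      qed
    next
      have new: "crossing (F s) (frac (P k s)) (frac (Q k s))" if "k \<in> others" for k
        using elim(6,7) that unfolding crossing_def by (simp add: F_frac frac_lt_1)
      assume "crossing \<gamma> u v \<and> u \<noteq> t0 \<and> v \<noteq> t0
       \<or> (\<exists>k\<in>others. (u, v) = (frac (P k s), frac (Q k s)) \<or> (u, v) = (frac (Q k s), frac (P k s)))"
      then show "crossing (F s) u v"
      proof
        assume uv: "crossing \<gamma> u v \<and> u \<noteq> t0 \<and> v \<noteq> t0"
        then have "F s u = \<gamma> u" "F s v = \<gamma> v" using crossing_fixed(1) crossing_sym by blast+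
        then show ?thesis using uv by (simp add: crossing_def)
      qed (use new crossing_sym in blast)
    qed
    note char = this
    show ?case
    proof (rule exI[of _ "\<lambda>k. P k s"], rule exI[of _ "\<lambda>k. Q k s"], intro conjI ballI allI)
      fix k assume "k \<in> others"
      then show "\<bar>P k s - k\<bar> < \<rho>" "\<bar>Q k s - t0\<bar> < \<rho>" "sgn (P k s - k) = sgn s * sgn (orient \<gamma> t0 k)"
        "sgn (orient (F s) (P k s) (Q k s)) = sgn (orient \<gamma> k t0)"
        using elim(1-4) by simp_all
      fix l assume "l \<in> others"
      then show "Q k s < Q l s \<longleftrightarrow> sgn s * rel_cot k < sgn s * rel_cot l"
        using elim(5) \<open>k \<in> others\<close> by simp
    qed (rule char)
  qed
qed

end


section \<open>Combinatorial form of the complete resolution\<close>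

definition idx :: "real list \<Rightarrow> real \<Rightarrow> nat" where
  "idx l t = length (takeWhile (\<lambda>u. u \<noteq> t) l)"

lemma idx_less_length: "t \<in> set l \<Longrightarrow> idx l t < length l"
  unfolding idx_def by (induction l) auto

lemma nth_idx: "t \<in> set l \<Longrightarrow> l ! idx l t = t"
  unfolding idx_def using nth_length_takeWhile[of "\<lambda>u. u \<noteq> t" l] idx_less_length[of t l] by (simp add: idx_def)

lemma idx_inj: "t \<in> set l \<Longrightarrow> u \<in> set l \<Longrightarrow> idx l t = idx l u \<Longrightarrow> t = u"
  using nth_idx by metis

lemma idx_nth: "distinct l \<Longrightarrow> i < length l \<Longrightarrow> idx l (l ! i) = i"
  using nth_idx[of "l ! i" l] idx_less_length[of "l ! i" l] nth_eq_iff_index_eq by fastforce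

lemma idx_last: "distinct l \<Longrightarrow> l \<noteq> [] \<Longrightarrow> idx l (last l) = length l - 1"
  by (simp add: last_conv_nth idx_nth)

lemma idx_butlast:
  assumes "t \<in> set (butlast l)" shows "idx (butlast l) t = idx l t"
proof -
  have "l = butlast l @ [last l]" using assms by (cases l rule: rev_cases) auto
  then have "idx l t = length (takeWhile (\<lambda>u. u \<noteq> t) (butlast l @ [last l]))" by (simp add: idx_def)
  also have "\<dots> = idx (butlast l) t"
    unfolding idx_def using assms by (subst takeWhile_append1[of t]) auto
  finally show ?thesis ..
qed

lemma card_idx_ge_2:
  assumes "distinct l" shows "card {t \<in> set l. 2 \<le> idx l t} = length l - 2"
proof -
  have "{t \<in> set l. 2 \<le> idx l t} = (!) l ` {2..<length l}"
  proof
    show "{t \<in> set l. 2 \<le> idx l t} \<subseteq> (!) l ` {2..<length l}"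
      using idx_less_length nth_idx by (force simp: image_iff)
    show "(!) l ` {2..<length l} \<subseteq> {t \<in> set l. 2 \<le> idx l t}"
      using idx_nth[OF assms] by auto
  qed
  moreover have "inj_on ((!) l) {2..<length l}"
    using assms by (auto simp: inj_on_def nth_eq_iff_index_eq)
  ultimately show ?thesis by (simp add: card_image)
qed

text \<open>Since \<^const>\<open>idx\<close> counts from 0, these are all branches but the first two.\<close>

definition movable :: "curve \<Rightarrow> (real^3 \<Rightarrow> real list) \<Rightarrow> real set" where
  "movable \<gamma> ord = {t. (\<exists>u. crossing \<gamma> t u) \<and> 2 \<le> idx (ord (\<gamma> t)) t}"

text \<open>The value 0 is meant for the first two branches of a point; it gives their common
  crossing, which stays in place, the key 0.\<close>

definition move_sign :: "real set \<Rightarrow> real set \<Rightarrow> real \<Rightarrow> real" where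
  "move_sign M N t = (if t \<in> N then 1 else if t \<in> M then -1 else 0)"

text \<open>The keys order the endpoints of the arrows that lie near the parameter \<open>t\<close> of a branch; \<open>\<epsilon>\<close> tells in
  which direction each branch is moved. A later branch \<open>u\<close> crosses the branch \<open>t\<close> on the side given by
  \<open>\<epsilon> u\<close>, and the farther away the later it is, since the later branches are moved first and the others by
  much less. An earlier branch is crossed still closer to \<open>t\<close>, at a distance proportional to the cotangent
  of the angle between the branches. Dividing the arcus tangent by 2 only makes it less than 1 in absolute
  value.\<close>

definition key :: "curve \<Rightarrow> (real^3 \<Rightarrow> real list) \<Rightarrow> (real \<Rightarrow> real) \<Rightarrow> real \<Rightarrow> real \<Rightarrow> real" where
  "key \<gamma> ord \<epsilon> t u =
    (if idx (ord (\<gamma> t)) t < idx (ord (\<gamma> t)) u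
     then \<epsilon> u * sgn (orient \<gamma> u t) * (1 + real (idx (ord (\<gamma> t)) u))
     else \<epsilon> t * (arctan ((tangent \<gamma> t \<bullet> tangent \<gamma> u) / orient \<gamma> t u) / 2))"

text \<open>\<open>Pos t u\<close> stands for the parameter near \<open>t\<close> at which the
  branches \<open>t\<close> and \<open>u\<close> cross after the moves. It is a real lift, reduced
  modulo 1 only here.\<close>

definition place :: "(real \<Rightarrow> real \<Rightarrow> real) \<Rightarrow> real \<times> real \<Rightarrow> real \<times> real" where
  "place Pos = (\<lambda>(t, u). (frac (Pos t u), frac (Pos u t)))"

text \<open>For a singular doodle \<open>arrows \<gamma>\<close> has one arrow for each pair of
  branches at a point, and is no arrow diagram when three branches meet; the positions pull its
  endpoints apart. Within \<open>\<rho>\<close> of a branch only their order is recorded.\<close>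

definition realizes ::
  "curve \<Rightarrow> (real^3 \<Rightarrow> real list) \<Rightarrow> (real \<Rightarrow> real) \<Rightarrow> real \<Rightarrow> (real \<Rightarrow> real \<Rightarrow> real) \<Rightarrow> (real \<times> real) set \<Rightarrow> bool" where
  "realizes \<gamma> ord \<epsilon> \<rho> Pos A \<longleftrightarrow>
     (\<forall>t u. crossing \<gamma> t u \<longrightarrow> \<bar>Pos t u - t\<bar> < \<rho>)
     \<and> (\<forall>t u v. crossing \<gamma> t u \<longrightarrow> crossing \<gamma> t v \<longrightarrow>
          (Pos t u < Pos t v \<longleftrightarrow> key \<gamma> ord \<epsilon> t u < key \<gamma> ord \<epsilon> t v))
     \<and> bij_betw (place Pos) (arrows \<gamma>) A \<and> is_arrow_diagram A"

text \<open>Here \<open>N\<close> is the set of the branches that are moved in the positive direction.\<close>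

definition resolution_form :: "curve \<Rightarrow> (real^3 \<Rightarrow> real list) \<Rightarrow> qd \<Rightarrow> bool" where
  "resolution_form \<gamma> ord L \<longleftrightarrow> (\<forall>\<rho>>0. \<exists>A.
     (\<forall>N\<subseteq>movable \<gamma> ord. \<exists>Pos. realizes \<gamma> ord (move_sign (movable \<gamma> ord) N) \<rho> Pos (A N))
     \<and> L = (\<Sum>N\<in>Pow (movable \<gamma> ord).
              qd_scale ((-1) ^ card (movable \<gamma> ord - N)) (diag (abs_arrow_diagram (A N)))))"

section \<open>Parameters and branches of a singular doodle\<close>

lemma singular_doodle_ord:
  assumes "singular_doodle \<gamma> ord" "crossing \<gamma> t u"
  shows "distinct (ord (\<gamma> t))" "set (ord (\<gamma> t)) = branches \<gamma> (\<gamma> t)" "t \<in> set (ord (\<gamma> t))" "u \<in> set (ord (\<gamma> t))"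
proof -
  have "\<gamma> t \<in> self_intersections \<gamma>" using assms(2) by (rule self_intersectionI)
  then show 1: "distinct (ord (\<gamma> t))" "set (ord (\<gamma> t)) = branches \<gamma> (\<gamma> t)"
    using assms(1) by (auto simp: singular_doodle_def)
  show "t \<in> set (ord (\<gamma> t))" "u \<in> set (ord (\<gamma> t))"
    unfolding 1(2) using assms(2) by (auto simp: crossing_def branches_def)
qed

lemma singular_doodle_immersed: "singular_doodle \<gamma> ord \<Longrightarrow> immersed_curve \<gamma>"
  by (simp add: singular_doodle_def)

lemma singular_doodle_orient:
  "singular_doodle \<gamma> ord \<Longrightarrow> crossing \<gamma> s t \<Longrightarrow> orient \<gamma> s t \<noteq> 0"
  by (rule orient_nonzero) (auto simp: singular_doodle_def)

lemma singular_doodle_finite: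
  assumes "singular_doodle \<gamma> ord" shows "finite {s. \<exists>t. crossing \<gamma> s t}"
proof (rule finite_crossing_params)
  show "finite (self_intersections \<gamma>)" using assms by (simp add: singular_doodle_def)
  fix x assume "x \<in> self_intersections \<gamma>"
  then have "set (ord x) = branches \<gamma> x" using assms by (simp add: singular_doodle_def)
  then show "finite (branches \<gamma> x)" by (metis finite_set)
qed

lemma singular_doodle_card:
  assumes "singular_doodle \<gamma> ord" "x \<in> self_intersections \<gamma>"
  shows "card (branches \<gamma> x) = length (ord x)" "2 \<le> card (branches \<gamma> x)"
proof -
  have o: "distinct (ord x)" "set (ord x) = branches \<gamma> x" using assms by (auto simp: singular_doodle_def)
  then show "card (branches \<gamma> x) = length (ord x)" by (metis distinct_card)
  obtain s t where st: "s \<in> branches \<gamma> x" "t \<in> branches \<gamma> x" "s \<noteq> t" using assms(2) by (auto simp: self_intersections_def)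
  have "finite (branches \<gamma> x)" using o(2) by (metis finite_set)
  then have "card {s, t} \<le> card (branches \<gamma> x)" using st by (intro card_mono) auto
  then show "2 \<le> card (branches \<gamma> x)" using st(3) by simp
qed

text \<open>The smaller of \<open>\<bar>t - u\<bar>\<close> and \<open>1 - \<bar>t - u\<bar>\<close>
  is the distance on the circle. Including 1 in \<open>D\<close> provides the bound
  \<open>d \<le> 1\<close>, and a minimum even if there are no two points.\<close>

lemma circle_gap:
  assumes "finite K" "K \<subseteq> {0..<1::real}"
  obtains d where "d > 0" "d \<le> 1" "\<And>t u m. t \<in> K \<Longrightarrow> u \<in> K \<Longrightarrow> t \<noteq> u \<Longrightarrow> \<bar>t - u - of_int m\<bar> \<ge> d"
proof -
  define D where "D = insert 1 ((\<lambda>(t, u). min \<bar>t - u\<bar> (1 - \<bar>t - u\<bar>)) ` {(t, u) \<in> K \<times> K. t \<noteq> u})"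
  have fin: "finite {(t, u) \<in> K \<times> K. t \<noteq> u}"
    by (rule finite_subset[of _ "K \<times> K"]) (use assms(1) in auto)
  have D: "finite D" "D \<noteq> {}" using fin by (auto simp: D_def)
  have lt: "\<bar>t - u\<bar> < 1" if "t \<in> K" "u \<in> K" for t u
  proof -
    have "t \<in> {0..<1}" "u \<in> {0..<1}" using that assms(2) by blast+
    then show ?thesis by auto
  qed
  have pos: "x > 0" if "x \<in> D" for x using that lt by (auto simp: D_def)
  have "Min D > 0" using pos Min_in[OF D] by blast
  moreover have "Min D \<le> 1" using Min_le[OF D(1), of 1] by (simp add: D_def)
  moreover have "\<bar>t - u - of_int m\<bar> \<ge> Min D" if "t \<in> K" "u \<in> K" "t \<noteq> u" for t u m
  proof -
    have "min \<bar>t - u\<bar> (1 - \<bar>t - u\<bar>) \<in> D" using that by (force simp: D_def)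
    then have le: "Min D \<le> min \<bar>t - u\<bar> (1 - \<bar>t - u\<bar>)" using Min_le[OF D(1)] by blast
    consider "m = 0" | "m \<ge> 1" | "m \<le> -1" by linarith
    then show ?thesis
    proof cases
      case 1
      then show ?thesis using le by simp
    next
      case 2
      then have "(of_int m :: real) \<ge> 1" by simp
      then show ?thesis using le lt[OF that(1,2)] by linarith
    next
      case 3
      then have "(of_int m :: real) \<le> -1" by simp
      then show ?thesis using le lt[OF that(1,2)] by linarith
    qed
  qed
  ultimately show ?thesis using that by blast
qed

lemma place_id:
  assumes "e \<in> arrows \<gamma>" shows "place (\<lambda>t u. t) e = e"
  using assms by (cases e) (auto simp: place_def arrows_iff crossing_def frac_eq)

lemma nonsingular_doodle:
  assumes "singular_doodle \<gamma> ord" "singular_points \<gamma> = {}"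
  shows "doodle \<gamma>" "movable \<gamma> ord = {}"
proof -
  have c: "card (branches \<gamma> x) = 2" if x: "x \<in> self_intersections \<gamma>" for x
  proof -
    have "\<not> 3 \<le> card (branches \<gamma> x)" using assms(2) x by (auto simp: singular_points_def)
    then show ?thesis using singular_doodle_card(2)[OF assms(1) x] by simp
  qed
  then show "doodle \<gamma>" using assms(1) by (auto simp: doodle_def singular_doodle_def)
  have "\<not> 2 \<le> idx (ord (\<gamma> t)) t" if cr: "crossing \<gamma> t u" for t u
    using idx_less_length[OF singular_doodle_ord(3)[OF assms(1) cr]] c[OF self_intersectionI[OF cr]]
      singular_doodle_card(1)[OF assms(1) self_intersectionI[OF cr]] by simp
  then show "movable \<gamma> ord = {}" by (auto simp: movable_def)
qed

text \<open>Without singular points nothing is movable, so the only choice is the empty set, with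
  the original parameters as positions. The order condition is trivial because a parameter crosses
  at most one other.\<close>

lemma resolution_form_nonsingular:
  assumes "singular_doodle \<gamma> ord" "singular_points \<gamma> = {}"
  shows "resolution_form \<gamma> ord (diag (diagram_of \<gamma>))"
  unfolding resolution_form_def
proof (intro allI impI)
  fix \<rho> :: real assume "\<rho> > 0"
  note dg = nonsingular_doodle[OF assms]
  have "realizes \<gamma> ord \<epsilon> \<rho> (\<lambda>t u. t) (arrows \<gamma>)" for \<epsilon>
  proof -
    have "u = v" if "crossing \<gamma> t u" "crossing \<gamma> t v" for t u v
      using doodle_crossing_unique[OF dg(1) that] .
    then have "(t < t) = (key \<gamma> ord \<epsilon> t u < key \<gamma> ord \<epsilon> t v)" if "crossing \<gamma> t u" "crossing \<gamma> t v" for t u v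
      using that by (metis less_irrefl)
    moreover have "bij_betw (place (\<lambda>t u. t)) (arrows \<gamma>) (arrows \<gamma>)"
      by (rule bij_betw_byWitness[of _ "\<lambda>e. e"]) (auto simp: place_id)
    ultimately show ?thesis
      unfolding realizes_def using is_arrow_diagram_arrows[OF dg(1)] \<open>\<rho> > 0\<close> by simp
  qed
  then show "\<exists>A. (\<forall>N\<subseteq>movable \<gamma> ord. \<exists>Pos. realizes \<gamma> ord (move_sign (movable \<gamma> ord) N) \<rho> Pos (A N))
     \<and> diag (diagram_of \<gamma>) = (\<Sum>N\<in>Pow (movable \<gamma> ord).
              qd_scale ((-1) ^ card (movable \<gamma> ord - N)) (diag (abs_arrow_diagram (A N))))"
    by (intro exI[of _ "\<lambda>N. arrows \<gamma>"]) (auto simp: dg(2) diagram_of_def)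
qed

lemma abs_arctan_half_less: "\<bar>arctan x / 2\<bar> < 1"
proof -
  have "\<bar>arctan x\<bar> < pi / 2" using arctan_lbound[of x] arctan_ubound[of x] by linarith
  then show ?thesis using pi_less_4 by simp
qed

lemma abs_move_sign_le: "\<bar>move_sign M N t\<bar> \<le> 1"
  by (simp add: move_sign_def)

text \<open>The bound grows with the index, so the key of the crossing with a moved last branch
  dominates all other keys on the branch \<open>t\<close>.\<close>

lemma abs_key_less:
  assumes "\<bar>\<epsilon> t\<bar> \<le> 1" "\<bar>\<epsilon> u\<bar> \<le> 1"
  shows "\<bar>key \<gamma> ord \<epsilon> t u\<bar> \<le> 1 + real (idx (ord (\<gamma> t)) u)"
proof (cases "idx (ord (\<gamma> t)) t < idx (ord (\<gamma> t)) u")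
  case True
  have "\<bar>\<epsilon> u * sgn (orient \<gamma> u t)\<bar> \<le> 1 * 1"
    unfolding abs_mult using assms(2) by (intro mult_mono) (auto simp: sgn_if)
  then have "\<bar>\<epsilon> u * sgn (orient \<gamma> u t)\<bar> * \<bar>1 + real (idx (ord (\<gamma> t)) u)\<bar> \<le> 1 * (1 + real (idx (ord (\<gamma> t)) u))"
    by (intro mult_mono) auto
  then show ?thesis using True by (simp add: key_def abs_mult)
next
  case False
  have "\<bar>\<epsilon> t\<bar> * \<bar>arctan ((tangent \<gamma> t \<bullet> tangent \<gamma> u) / orient \<gamma> t u) / 2\<bar> \<le> 1 * 1"
    using assms(1) less_imp_le[OF abs_arctan_half_less] by (intro mult_mono) auto
  then show ?thesis using False unfolding key_def by (simp only: if_False abs_mult)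
qed

text \<open>One small \<open>s\<close> on either side is fixed here, with the data supplied by
  \<open>small_move\<close>. The tolerance \<open>d / 4\<close>, for a gap \<open>d\<close> between
  the crossing parameters, leaves as much again for the moves still to come; positions belonging to
  different branches then stay apart.\<close>

locale resolution_step = branch_move \<gamma> t0 F a b c
  for \<gamma> :: curve and t0 and F :: "real \<Rightarrow> curve" and a b c +
  fixes ord ord' :: "real^3 \<Rightarrow> real list" and s d :: real and P Q :: "real \<Rightarrow> real"
  assumes sd: "singular_doodle \<gamma> ord" and sing: "\<gamma> t0 \<in> singular_points \<gamma>" and t0_last: "t0 = last (ord (\<gamma> t0))"
    and sd': "singular_doodle (F s) ord'" and keep: "keeps_order \<gamma> ord (\<gamma> t0) ord'" and s: "s \<noteq> 0"
    and d: "d > 0" "d \<le> 1"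
    and gap: "\<And>t u t' u' m. crossing \<gamma> t t' \<Longrightarrow> crossing \<gamma> u u' \<Longrightarrow> t \<noteq> u \<Longrightarrow> \<bar>t - u - of_int m\<bar> \<ge> d"
    and near: "\<And>k. k \<in> others \<Longrightarrow> \<bar>P k - k\<bar> < d / 4" "\<And>k. k \<in> others \<Longrightarrow> \<bar>Q k - t0\<bar> < d / 4"
    and sgnP: "\<And>k. k \<in> others \<Longrightarrow> sgn (P k - k) = sgn s * sgn (orient \<gamma> t0 k)"
    and sgnO: "\<And>k. k \<in> others \<Longrightarrow> sgn (orient (F s) (P k) (Q k)) = sgn (orient \<gamma> k t0)"
    and ordQ: "\<And>k l. k \<in> others \<Longrightarrow> l \<in> others \<Longrightarrow> Q k < Q l \<longleftrightarrow> sgn s * rel_cot k < sgn s * rel_cot l"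
    and cross: "\<And>u v. crossing (F s) u v \<longleftrightarrow> crossing \<gamma> u v \<and> u \<noteq> t0 \<and> v \<noteq> t0
       \<or> (\<exists>k\<in>others. (u, v) = (frac (P k), frac (Q k)) \<or> (u, v) = (frac (Q k), frac (P k)))"
begin

definition "M = movable \<gamma> ord"

text \<open>Positions after the move of \<open>t0\<close> alone; the remaining resolution starts
  from these.\<close>

definition pos :: "real \<Rightarrow> real \<Rightarrow> real" where
  "pos t u = (if t = t0 then Q u else if u = t0 then P t else t)"

lemma imm': "immersed_curve (F s)"
  using sd' by (rule singular_doodle_immersed)

lemma crossing_t0: "crossing \<gamma> t0 k \<longleftrightarrow> k \<in> others" "crossing \<gamma> k t0 \<longleftrightarrow> k \<in> others"
  using crossing_sym by (auto simp: others_def)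

lemma pos_near: "crossing \<gamma> t u \<Longrightarrow> \<bar>pos t u - t\<bar> < d / 4"
  using near d crossing_t0 by (auto simp: pos_def)

lemma frac_crossing: "crossing \<gamma>' t u \<Longrightarrow> frac t = t"
  by (simp add: crossing_def frac_eq)

text \<open>The ordered crossings of \<open>\<gamma>\<close> stay in correspondence with those of
  \<open>F s\<close>, because the moved branch meets every other branch of its point exactly
  once.\<close>

lemma crossing_pos: "crossing \<gamma> t u \<Longrightarrow> crossing (F s) (frac (pos t u)) (frac (pos u t))"
  unfolding cross using crossing_t0 frac_crossing[of \<gamma> t u] frac_crossing[of \<gamma> u t] crossing_sym[of \<gamma> t u]
  by (auto simp: pos_def crossing_def)

lemma crossing_of_pos:
  assumes "crossing (F s) u v"
  obtains t t' where "crossing \<gamma> t t'" "u = frac (pos t t')" "v = frac (pos t' t)"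
proof -
  have ne: "k \<noteq> t0" if "k \<in> others" for k using that by (auto simp: others_def crossing_def)
  from assms consider "crossing \<gamma> u v" "u \<noteq> t0" "v \<noteq> t0"
    | k where "k \<in> others" "u = frac (P k)" "v = frac (Q k)" | k where "k \<in> others" "u = frac (Q k)" "v = frac (P k)"
    unfolding cross by blast
  then show ?thesis
  proof cases
    case 1
    then show ?thesis using that[of u v] frac_crossing crossing_sym[OF 1(1)] by (simp add: pos_def)
  next
    case 2
    then show ?thesis using that[of k t0] crossing_t0 ne[OF 2(1)] by (simp add: pos_def)
  next
    case 3
    then show ?thesis using that[of t0 k] crossing_t0 ne[OF 3(1)] by (simp add: pos_def)
  qed
qed

lemma orient_pos:
  assumes cr: "crossing \<gamma> t u"
  shows "sgn (orient (F s) (frac (pos t u)) (frac (pos u t))) = sgn (orient \<gamma> t u)"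
proof -
  have e: "\<gamma> t = \<gamma> u" "t \<noteq> u" using cr by (auto simp: crossing_def)
  have tu: "frac t = t" "frac u = u" using frac_crossing[OF cr] frac_crossing[OF crossing_sym[OF cr]] .
  consider "t \<noteq> t0" "u \<noteq> t0" | "t = t0" "u \<noteq> t0" | "t \<noteq> t0" "u = t0" using e by blast
  then show ?thesis
  proof cases
    case 1
    then show ?thesis
      using crossing_fixed[OF cr 1(1)] crossing_fixed[OF crossing_sym[OF cr] 1(2)]
      by (simp add: pos_def orient_def tu)
  next
    case 2
    then have u: "u \<in> others" using cr crossing_t0 by simp
    have "crossing (F s) (frac (P u)) (frac (Q u))" unfolding cross using u by blast
    then have "F s (P u) = F s (Q u)" by (simp add: crossing_def F_frac)
    then have "orient (F s) (Q u) (P u) = - orient (F s) (P u) (Q u)" by (rule orient_swap)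
    moreover have "orient \<gamma> t0 u = - orient \<gamma> u t0" by (rule orient_swap) (use e 2 in simp)
    ultimately show ?thesis using 2 sgnO[OF u] by (simp add: pos_def orient_frac[OF imm'] sgn_minus)
  next
    case 3
    then have "t \<in> others" using cr crossing_t0 by simp
    then show ?thesis using 3 sgnO by (simp add: pos_def orient_frac[OF imm'])
  qed
qed

lemma P_ne: "k \<in> others \<Longrightarrow> P k \<noteq> k"
  using sgnP[of k] orient_others[of k] s by (auto simp: sgn_zero_iff)

lemma Q_inj: "k \<in> others \<Longrightarrow> l \<in> others \<Longrightarrow> Q k = Q l \<Longrightarrow> k = l"
  using ordQ[of k l] ordQ[of l k] rel_cot_inj[of k l] s by (auto simp: sgn_if split: if_splits)

text \<open>Positions are within \<open>d / 4\<close> of their branches, so two that agree modulo 1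
  have branches closer than the gap \<open>d\<close>.\<close>

lemma pos_eq_base:
  assumes "crossing \<gamma> t u" "crossing \<gamma> t' u'" "frac (pos t u) = frac (pos t' u')"
  shows "t = t'" "pos t u = pos t' u'"
proof -
  obtain m :: int where m: "pos t u = pos t' u' + of_int m" using assms(3) frac_eq_of_int by blast
  have n: "\<bar>pos t u - t\<bar> < d / 4" "\<bar>pos t' u' - t'\<bar> < d / 4" using pos_near assms by auto
  have "t - t' - of_int m = (pos t' u' - t') - (pos t u - t)" using m by simp
  then have lt: "\<bar>t - t' - of_int m\<bar> < d" using n d(1) by linarith
  then show t: "t = t'" using gap[OF assms(1,2), of m] by linarith
  have "\<bar>pos t u - pos t' u'\<bar> < 1" using n d t by linarith
  then show "pos t u = pos t' u'" using frac_eq_near assms(3) by blast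
qed

lemma pos_inj:
  assumes "crossing \<gamma> t u" "crossing \<gamma> t' u'" "frac (pos t u) = frac (pos t' u')" "frac (pos u t) = frac (pos u' t')"
  shows "t = t'" "u = u'"
  using pos_eq_base[OF assms(1-3)] pos_eq_base[OF crossing_sym[OF assms(1)] crossing_sym[OF assms(2)] assms(4)] by auto

text \<open>The crossings on \<open>t0\<close> separate from each other by \<open>Q_inj\<close>, and
  the crossings with \<open>t0\<close> leave the other branches' parameters by \<open>P_ne\<close>;
  only crossings untouched by the move can still share a parameter.\<close>

lemma pos_eq_cases:
  assumes "crossing \<gamma> t u" "crossing \<gamma> t v" "pos t u = pos t v"
  shows "u = v \<or> (t \<noteq> t0 \<and> u \<noteq> t0 \<and> v \<noteq> t0)"
proof (cases "t = t0")
  case True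
  then have "u \<in> others" "v \<in> others" using assms crossing_t0 by auto
  then show ?thesis using Q_inj assms(3) True by (simp add: pos_def)
next
  case False
  then show ?thesis using assms P_ne not_sym[OF P_ne] crossing_t0 by (auto simp: pos_def split: if_splits)
qed

lemma place_pos_bij: "bij_betw (place pos) (arrows \<gamma>) (arrows (F s))"
proof (rule bij_betwI')
  fix x y assume xy: "x \<in> arrows \<gamma>" "y \<in> arrows \<gamma>"
  obtain t u t' u' where [simp]: "x = (t, u)" "y = (t', u')" by (cases x, cases y)
  have "crossing \<gamma> t u" "crossing \<gamma> t' u'" using xy by (auto simp: arrows_iff)
  then show "(place pos x = place pos y) = (x = y)"
    using pos_inj[of t u t' u'] by (auto simp: place_def)
next
  fix x assume x: "x \<in> arrows \<gamma>"
  obtain t u where [simp]: "x = (t, u)" by (cases x)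
  have "crossing \<gamma> t u" "orient \<gamma> t u > 0" using x by (auto simp: arrows_iff)
  then show "place pos x \<in> arrows (F s)"
    using crossing_pos[of t u] orient_pos[of t u] by (simp add: place_def arrows_iff) (metis sgn_1_pos)
next
  fix y assume y: "y \<in> arrows (F s)"
  obtain u v where [simp]: "y = (u, v)" by (cases y)
  have uv: "crossing (F s) u v" "orient (F s) u v > 0" using y by (auto simp: arrows_iff)
  obtain t t' where t: "crossing \<gamma> t t'" "u = frac (pos t t')" "v = frac (pos t' t)"
    using crossing_of_pos[OF uv(1)] .
  then have "orient \<gamma> t t' > 0" using orient_pos[OF t(1)] uv(2) by (metis sgn_1_pos)
  then show "\<exists>x\<in>arrows \<gamma>. y = place pos x"
    using t by (intro bexI[of _ "(t, t')"]) (auto simp: place_def arrows_iff)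
qed

lemma t0_crossing: obtains u where "crossing \<gamma> t0 u"
proof -
  have "\<gamma> t0 \<in> self_intersections \<gamma>" using sing by (simp add: singular_points_def)
  then obtain v w where "v \<in> branches \<gamma> (\<gamma> t0)" "w \<in> branches \<gamma> (\<gamma> t0)" "v \<noteq> w"
    by (auto simp: self_intersections_def)
  then have "crossing \<gamma> t0 v \<or> crossing \<gamma> t0 w" using t0 by (auto simp: crossing_def branches_def)
  then show ?thesis using that by blast
qed

lemma idx_t0:
  "idx (ord (\<gamma> t0)) t0 = length (ord (\<gamma> t0)) - 1" "3 \<le> length (ord (\<gamma> t0))"
proof -
  obtain u where u: "crossing \<gamma> t0 u" by (rule t0_crossing)
  have "3 \<le> card (branches \<gamma> (\<gamma> t0))" using sing by (simp add: singular_points_def)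
  then show l: "3 \<le> length (ord (\<gamma> t0))"
    using singular_doodle_card(1)[OF sd self_intersectionI[OF u]] by simp
  then have "ord (\<gamma> t0) \<noteq> []" by auto
  then show "idx (ord (\<gamma> t0)) t0 = length (ord (\<gamma> t0)) - 1"
    using idx_last[OF singular_doodle_ord(1)[OF sd u]] t0_last by metis
qed

lemma idx_less_t0:
  assumes "k \<in> others" shows "idx (ord (\<gamma> t0)) k < idx (ord (\<gamma> t0)) t0"
proof -
  have cr: "crossing \<gamma> t0 k" using assms by (simp add: others_def)
  have "idx (ord (\<gamma> t0)) k < length (ord (\<gamma> t0))"
    using singular_doodle_ord(4)[OF sd cr] by (rule idx_less_length)
  moreover have "idx (ord (\<gamma> t0)) k \<noteq> idx (ord (\<gamma> t0)) t0"
    using idx_inj[OF singular_doodle_ord(4,3)[OF sd cr]] cr by (auto simp: crossing_def)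
  ultimately show ?thesis using idx_t0 by linarith
qed

lemma t0_in_M: "t0 \<in> M"
proof -
  obtain u where "crossing \<gamma> t0 u" by (rule t0_crossing)
  moreover have "2 \<le> idx (ord (\<gamma> t0)) t0" using idx_t0 by linarith
  ultimately show ?thesis unfolding M_def movable_def by blast
qed

text \<open>Dropping the last entry of a list does not change the indices of the others.\<close>

lemma idx_keep:
  assumes cr: "crossing \<gamma> t u" and "t \<noteq> t0" "u \<noteq> t0"
  shows "idx (ord' (\<gamma> t)) t = idx (ord (\<gamma> t)) t" "idx (ord' (\<gamma> t)) u = idx (ord (\<gamma> t)) u"
proof -
  have self: "\<gamma> t \<in> self_intersections \<gamma>" using cr by (rule self_intersectionI)
  note o = singular_doodle_ord(3,4)[OF sd cr]
  show "idx (ord' (\<gamma> t)) t = idx (ord (\<gamma> t)) t" "idx (ord' (\<gamma> t)) u = idx (ord (\<gamma> t)) u"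
  proof (atomize(full), cases "\<gamma> t = \<gamma> t0")
    case True
    have bl: "v \<in> set (butlast (ord (\<gamma> t0)))" if "v \<in> set (ord (\<gamma> t0))" "v \<noteq> t0" for v
    proof -
      have "ord (\<gamma> t0) = butlast (ord (\<gamma> t0)) @ [t0]"
        using t0_last idx_t0(2) by (metis append_butlast_last_id list.size(3) not_numeral_le_zero)
      then have "v \<in> set (butlast (ord (\<gamma> t0)) @ [t0])" using that(1) by metis
      then show ?thesis using that(2) by auto
    qed
    have "ord' (\<gamma> t) = butlast (ord (\<gamma> t0))" using keep True by (simp add: keeps_order_def)
    then show "idx (ord' (\<gamma> t)) t = idx (ord (\<gamma> t)) t \<and> idx (ord' (\<gamma> t)) u = idx (ord (\<gamma> t)) u"
      using idx_butlast[OF bl, of t] idx_butlast[OF bl, of u] o True assms by simp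
  next
    case False
    then have "ord' (\<gamma> t) = ord (\<gamma> t)" using keep self by (simp add: keeps_order_def)
    then show "idx (ord' (\<gamma> t)) t = idx (ord (\<gamma> t)) t \<and> idx (ord' (\<gamma> t)) u = idx (ord (\<gamma> t)) u" by simp
  qed
qed

text \<open>A point created by the move lies on just two branches, so neither is movable there,
  whatever order it is given. A movable branch other than \<open>t0\<close> keeps its index and at
  least one crossing.\<close>

lemma movable_step: "movable (F s) ord' = M - {t0}"
proof (rule set_eqI, rule iffI)
  fix w assume "w \<in> movable (F s) ord'"
  then obtain u where u: "crossing (F s) w u" and i: "2 \<le> idx (ord' (F s w)) w"
    by (auto simp: movable_def)
  obtain t t' where t: "crossing \<gamma> t t'" "w = frac (pos t t')" "u = frac (pos t' t)"
    using crossing_of_pos[OF u] .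
  have only: "t \<noteq> t0 \<and> t' \<noteq> t0"
  proof (rule ccontr)
    assume a: "\<not> (t \<noteq> t0 \<and> t' \<noteq> t0)"
    have "v = u" if v: "crossing (F s) w v" for v
    proof -
      obtain r r' where r: "crossing \<gamma> r r'" "w = frac (pos r r')" "v = frac (pos r' r)"
        using crossing_of_pos[OF v] .
      have "t = r" "pos t t' = pos r r'" using pos_eq_base[OF t(1) r(1)] t(2) r(2) by auto
      then have "t' = r'" using pos_eq_cases[OF t(1)] r(1) a by auto
      then show "v = u" using t(3) r(3) \<open>t = r\<close> by simp
    qed
    then have "branches (F s) (F s w) \<subseteq> {w, u}"
      using u by (auto simp: branches_def crossing_def)
    then have "card (branches (F s) (F s w)) \<le> card {w, u}" by (rule card_mono[rotated]) simp
    also have "\<dots> \<le> 2" by (simp add: card_insert_if)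
    finally have "length (ord' (F s w)) \<le> 2"
      using singular_doodle_card(1)[OF sd' self_intersectionI[OF u]] by simp
    then show False using i idx_less_length[OF singular_doodle_ord(3)[OF sd' u]] by simp
  qed
  then have w: "w = t" "F s w = \<gamma> t"
    using t frac_crossing[OF t(1)] crossing_fixed(1)[OF t(1)] by (auto simp: pos_def)
  then have "2 \<le> idx (ord (\<gamma> w)) w" using i idx_keep(1)[OF t(1)] only by simp
  then show "w \<in> M - {t0}" using t(1) w only by (auto simp: M_def movable_def)
next
  fix w assume w: "w \<in> M - {t0}"
  then obtain v where v: "crossing \<gamma> w v" and i: "2 \<le> idx (ord (\<gamma> w)) w" by (auto simp: M_def movable_def)
  define l where "l = ord (\<gamma> w)"
  have l: "distinct l" "set l = branches \<gamma> (\<gamma> w)" "w \<in> set l"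
    using singular_doodle_ord[OF sd v] by (auto simp: l_def)
  have len: "idx l w < length l" using l(3) by (rule idx_less_length)
  \<comment> \<open>The first branch is neither \<open>w\<close> nor \<open>t0\<close>, whose
    indices are at least 2, so the move leaves its crossing with \<open>w\<close> alone.\<close>
  define u where "u = l ! 0"
  have iu: "idx l u = 0" unfolding u_def using len by (intro idx_nth[OF l(1)]) linarith
  have "u \<in> set l" unfolding u_def using len by (intro nth_mem) linarith
  then have "u \<in> branches \<gamma> (\<gamma> w)" using l(2) by simp
  moreover have "u \<noteq> w" using iu i by (auto simp: l_def)
  ultimately have cr: "crossing \<gamma> w u" using v by (auto simp: branches_def crossing_def)
  have "u \<noteq> t0"
  proof
    assume "u = t0"
    then have "idx (ord (\<gamma> t0)) t0 = 0" using iu cr by (simp add: l_def crossing_def)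
    then show False using idx_t0 by simp
  qed
  then have "crossing (F s) w u" unfolding cross using cr w by blast
  moreover have "F s w = \<gamma> w" using crossing_fixed(1)[OF cr] w by blast
  ultimately show "w \<in> movable (F s) ord'"
    using idx_keep(1)[OF cr] w i \<open>u \<noteq> t0\<close> by (auto simp: movable_def)
qed

lemma key_step:
  assumes cr: "crossing \<gamma> t u" and ne: "t \<noteq> t0" "u \<noteq> t0" and "\<epsilon>' t = \<epsilon> t" "\<epsilon>' u = \<epsilon> u"
  shows "key (F s) ord' \<epsilon>' t u = key \<gamma> ord \<epsilon> t u"
proof -
  note f = crossing_fixed[OF cr ne(1)] crossing_fixed[OF crossing_sym[OF cr] ne(2)]
  show ?thesis
    unfolding key_def orient_def f idx_keep[OF cr ne] using assms(4,5) by simp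
qed

text \<open>Among the keys at \<open>t\<close>, the one of the crossing with a moved last branch is
  farthest from 0, on the side given by the direction of the move and the orientation.\<close>

lemma key_far:
  assumes k: "t \<in> others" and cr: "crossing \<gamma> t v" and v: "v \<noteq> t0"
    and \<epsilon>: "\<And>w. \<bar>\<epsilon> w\<bar> \<le> 1"
  shows "\<bar>key \<gamma> ord \<epsilon> t v\<bar> < 1 + real (idx (ord (\<gamma> t)) t0)"
    "key \<gamma> ord \<epsilon> t t0 = \<epsilon> t0 * sgn (orient \<gamma> t0 t) * (1 + real (idx (ord (\<gamma> t)) t0))"
proof -
  have e: "\<gamma> t = \<gamma> t0" using k by (simp add: others_def crossing_def)
  then have "v \<in> others" using cr v t0 by (auto simp: others_def crossing_def)
  then have "idx (ord (\<gamma> t)) v < idx (ord (\<gamma> t)) t0" using idx_less_t0 e by simp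
  then show "\<bar>key \<gamma> ord \<epsilon> t v\<bar> < 1 + real (idx (ord (\<gamma> t)) t0)"
    using abs_key_less[of \<epsilon> t v \<gamma> ord] \<epsilon> by (intro le_less_trans[OF abs_key_less]) auto
  show "key \<gamma> ord \<epsilon> t t0 = \<epsilon> t0 * sgn (orient \<gamma> t0 t) * (1 + real (idx (ord (\<gamma> t)) t0))"
    using idx_less_t0[OF k] e by (simp add: key_def)
qed

text \<open>The resolution of the moved curve displaces endpoints by less than half of the gaps that
  the move has left. So where the move has separated two crossings of a branch, it alone decides
  their order, and the key reflects its first-order behaviour; where it has not, neither crossing
  involves \<open>t0\<close>, and the keys for \<open>F s\<close> are those for
  \<open>\<gamma>\<close>.\<close>

lemma realizes_step:
  assumes N: "N' \<subseteq> M - {t0}" "N = (if s > 0 then insert t0 N' else N')"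
    and \<rho>': "\<rho>' > 0" "\<rho>' \<le> d / 4"
    and gap': "\<And>t u t' u' m. crossing (F s) t t' \<Longrightarrow> crossing (F s) u u' \<Longrightarrow> t \<noteq> u \<Longrightarrow> \<bar>t - u - of_int m\<bar> \<ge> 2 * \<rho>'"
    and R: "realizes (F s) ord' (move_sign (movable (F s) ord') N') \<rho>' Pos' A"
  shows "\<exists>Pos. realizes \<gamma> ord (move_sign M N) (d / 2) Pos A"
proof -
  define \<epsilon>' where "\<epsilon>' = move_sign (movable (F s) ord') N'"
  define \<epsilon> where "\<epsilon> = move_sign M N"
  have \<epsilon>t0: "\<epsilon> t0 = sgn s" using N t0_in_M s by (auto simp: \<epsilon>_def move_sign_def sgn_if)
  have \<epsilon>e: "\<epsilon>' w = \<epsilon> w" if "w \<noteq> t0" for w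
    using N(2) that by (auto simp: \<epsilon>_def \<epsilon>'_def move_sign_def movable_step)
  \<comment> \<open>The integer part lost by \<open>frac\<close> is added back, so that
    \<open>Pos t u\<close> is a lift near \<open>t\<close>.\<close>
  define Pos where "Pos t u = Pos' (frac (pos t u)) (frac (pos u t)) + of_int \<lfloor>pos t u\<rfloor>" for t u
  have Pn: "\<bar>Pos t u - pos t u\<bar> < \<rho>'" if "crossing \<gamma> t u" for t u
  proof -
    have "\<bar>Pos' (frac (pos t u)) (frac (pos u t)) - frac (pos t u)\<bar> < \<rho>'"
      using R crossing_pos[OF that] by (simp add: realizes_def)
    then show ?thesis by (simp add: Pos_def frac_def algebra_simps)
  qed
  have Pf: "frac (Pos t u) = frac (Pos' (frac (pos t u)) (frac (pos u t)))" for t u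
    by (simp add: Pos_def frac_def)
  have "\<bar>Pos t u - t\<bar> < d / 2" if "crossing \<gamma> t u" for t u
    using Pn[OF that] pos_near[OF that] \<rho>'(2) by linarith
  moreover have "bij_betw (place Pos) (arrows \<gamma>) A"
  proof -
    have "bij_betw (place Pos') (arrows (F s)) A" using R by (simp add: realizes_def)
    then have "bij_betw (place Pos' \<circ> place pos) (arrows \<gamma>) A"
      using bij_betw_trans[OF place_pos_bij] by blast
    moreover have "place Pos' \<circ> place pos = place Pos" by (auto simp: place_def Pf fun_eq_iff)
    ultimately show ?thesis by simp
  qed
  moreover have "is_arrow_diagram A" using R by (simp add: realizes_def)
  moreover have "Pos t u < Pos t v \<longleftrightarrow> key \<gamma> ord \<epsilon> t u < key \<gamma> ord \<epsilon> t v"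
    if cu: "crossing \<gamma> t u" and cv: "crossing \<gamma> t v" for t u v
  proof -
    have far: "Pos t u < Pos t v \<longleftrightarrow> pos t u < pos t v" if ne: "pos t u \<noteq> pos t v"
    proof -
      have "frac (pos t u) \<noteq> frac (pos t v)" using pos_eq_base(2)[OF cu cv] ne by blast
      from gap'[OF crossing_pos[OF cu] crossing_pos[OF cv] this, of "\<lfloor>pos t v\<rfloor> - \<lfloor>pos t u\<rfloor>"]
      have "\<bar>pos t u - pos t v\<bar> \<ge> 2 * \<rho>'" by (simp add: frac_def algebra_simps)
      then show ?thesis using Pn[OF cu] Pn[OF cv] by linarith
    qed
    consider "u = v" | "t = t0" "u \<noteq> v" | "t \<noteq> t0" "u \<noteq> t0" "v \<noteq> t0"
      | "t \<noteq> t0" "u = t0" "v \<noteq> t0" | "t \<noteq> t0" "u \<noteq> t0" "v = t0" by blast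
    then show ?thesis
    proof cases
      case 1
      then show ?thesis by simp
    next
      case 2
      have o: "u \<in> others" "v \<in> others" using cu cv 2 crossing_t0 by auto
      \<comment> \<open>On the moved branch itself the order is that of the cotangents, which the
        increasing function \<open>arctan\<close> preserves.\<close>
      have k: "key \<gamma> ord \<epsilon> t0 w = sgn s * (arctan (rel_cot w) / 2)" if "w \<in> others" for w
        using idx_less_t0[OF that] by (simp add: key_def \<epsilon>t0 rel_cot_def)
      have "pos t u \<noteq> pos t v" using pos_eq_cases[OF cu cv] 2 by blast
      then have "Pos t u < Pos t v \<longleftrightarrow> Q u < Q v" using far 2 by (simp add: pos_def)
      also have "\<dots> \<longleftrightarrow> sgn s * rel_cot u < sgn s * rel_cot v" by (rule ordQ[OF o])
      also have "\<dots> \<longleftrightarrow> sgn s * (arctan (rel_cot u) / 2) < sgn s * (arctan (rel_cot v) / 2)"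
        using s by (auto simp: sgn_if arctan_less_iff)
      finally show ?thesis by (simp only: 2(1) k[OF o(1)] k[OF o(2)])
    next
      case 3
      have p: "pos t u = t" "pos t v = t" "pos u t = u" "pos v t = v" using 3 by (auto simp: pos_def)
      have fr: "frac t = t" "frac u = u" "frac v = v"
        using cu cv frac_crossing crossing_sym by blast+
      have "\<lfloor>t\<rfloor> = 0" using fr(1) by (simp add: frac_def)
      then have "Pos t u = Pos' t u" "Pos t v = Pos' t v" by (simp_all add: Pos_def p fr)
      moreover have "crossing (F s) t u" "crossing (F s) t v" using crossing_pos[OF cu] crossing_pos[OF cv] by (simp_all add: p fr)
      then have "Pos' t u < Pos' t v \<longleftrightarrow> key (F s) ord' \<epsilon>' t u < key (F s) ord' \<epsilon>' t v"
        using R unfolding realizes_def \<epsilon>'_def by blast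
      ultimately show ?thesis
        using key_step[OF cu 3(1,2)] key_step[OF cv 3(1,3)] \<epsilon>e 3 by simp
    next
      case 4
      have to: "t \<in> others" using cu 4 crossing_t0 by simp
      \<comment> \<open>The crossing with \<open>t0\<close> has the key of largest modulus, with the
        sign of \<open>P t - t\<close>; the other crossing is still at \<open>t\<close>.\<close>
      have big: "\<bar>key \<gamma> ord \<epsilon> t v\<bar> < 1 + real (idx (ord (\<gamma> t)) t0)" "key \<gamma> ord \<epsilon> t t0 = sgn (P t - t) * (1 + real (idx (ord (\<gamma> t)) t0))"
        using key_far[OF to cv 4(3)] \<epsilon>t0 abs_move_sign_le sgnP[OF to] by (auto simp: \<epsilon>_def)
      have "Pos t u < Pos t v \<longleftrightarrow> P t < t" using far 4 P_ne[OF to] by (simp add: pos_def)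
      then show ?thesis using big P_ne[OF to] 4(2) by (auto simp: sgn_if split: if_splits)
    next
      case 5
      have to: "t \<in> others" using cv 5 crossing_t0 by simp
      have big: "\<bar>key \<gamma> ord \<epsilon> t u\<bar> < 1 + real (idx (ord (\<gamma> t)) t0)" "key \<gamma> ord \<epsilon> t t0 = sgn (P t - t) * (1 + real (idx (ord (\<gamma> t)) t0))"
        using key_far[OF to cu 5(2)] \<epsilon>t0 abs_move_sign_le sgnP[OF to] by (auto simp: \<epsilon>_def)
      have "Pos t u < Pos t v \<longleftrightarrow> t < P t" using far 5 P_ne[OF to] by (auto simp: pos_def)
      then show ?thesis using big P_ne[OF to] 5(3) by (auto simp: sgn_if split: if_splits)
    qed
  qed
  ultimately show ?thesis unfolding realizes_def \<epsilon>_def by blast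
qed

end

lemma realizes_mono:
  "realizes \<gamma> ord \<epsilon> \<rho> Pos A \<Longrightarrow> \<rho> \<le> \<rho>' \<Longrightarrow> realizes \<gamma> ord \<epsilon> \<rho>' Pos A"
  unfolding realizes_def by (meson less_le_trans)

lemma singular_doodle_gap:
  assumes "singular_doodle \<gamma> ord"
  obtains d where "d > 0" "d \<le> 1"
    "\<And>t u t' u' m. crossing \<gamma> t t' \<Longrightarrow> crossing \<gamma> u u' \<Longrightarrow> t \<noteq> u \<Longrightarrow> \<bar>t - u - of_int m\<bar> \<ge> d"
proof -
  have K: "finite {s. \<exists>t. crossing \<gamma> s t}" "{s. \<exists>t. crossing \<gamma> s t} \<subseteq> {0..<1}"
    using singular_doodle_finite[OF assms] by (auto simp: crossing_def)
  obtain d where "d > 0" "d \<le> 1"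
    "\<And>t u m. t \<in> {s. \<exists>t. crossing \<gamma> s t} \<Longrightarrow> u \<in> {s. \<exists>t. crossing \<gamma> s t} \<Longrightarrow> t \<noteq> u \<Longrightarrow> \<bar>t - u - of_int m\<bar> \<ge> d"
    by (rule circle_gap[OF K]) blast
  then show ?thesis using that[of d] by blast
qed

lemma moves_branch_locale:
  assumes sd: "singular_doodle \<gamma> ord" and mv: "moves_branch \<gamma> t0 F" and t0: "t0 \<in> {0..<1}"
  obtains a b c where "branch_move \<gamma> t0 F a b c"
proof -
  obtain a b c where m: "smooth_on UNIV (\<lambda>(s, t). F s t)" "F 0 = \<gamma>"
    "\<forall>s t. F s t \<in> S2 \<and> F s (t + 1) = F s t" "a < t0" "t0 < b" "b < a + 1"
    "\<forall>t\<in>{a..b}. t \<noteq> t0 \<longrightarrow> \<gamma> t \<notin> self_intersections \<gamma>"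
    "\<forall>s t. t \<notin> periodic {a<..<b} \<longrightarrow> F s t = \<gamma> t" "c > 0"
    "((\<lambda>s. F s t0) has_vector_derivative c *\<^sub>R cross3 (\<gamma> t0) (tangent \<gamma> t0)) (at 0)"
    using mv unfolding moves_branch_def by blast
  have "branch_move \<gamma> t0 F a b c"
  proof
    show "immersed_curve \<gamma>" using sd by (rule singular_doodle_immersed)
    show "finite {s. \<exists>t. crossing \<gamma> s t}" using sd by (rule singular_doodle_finite)
    show "orient \<gamma> s t \<noteq> 0" if "crossing \<gamma> s t" for s t using sd that by (rule singular_doodle_orient)
  qed (use m t0 in blast)+
  then show ?thesis by (rule that)
qed

text \<open>Both terms of a one-step resolution are treated together, \<open>\<sigma>\<close> being
  the sign of \<open>s\<close> on the side \<open>fl\<close>. The filter is nontrivial, so there is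
  one \<open>s\<close> at which all the eventual properties hold.\<close>

lemma (in branch_move) resolution_step_form:
  assumes sd: "singular_doodle \<gamma> ord" and sing: "\<gamma> t0 \<in> singular_points \<gamma>" and t0_last: "t0 = last (ord (\<gamma> t0))"
    and fil: "fl = at_right 0 \<and> \<sigma> = 1 \<or> fl = at_left 0 \<and> \<sigma> = (- 1 :: real)"
    and ev: "\<forall>\<^sub>F s in fl. \<exists>ord'. keeps_order \<gamma> ord (\<gamma> t0) ord' \<and> singular_doodle (F s) ord' \<and> resolution_form (F s) ord' L"
    and \<rho>: "\<rho> > 0"
  shows "t0 \<in> movable \<gamma> ord \<and> (\<exists>A. (\<forall>N\<subseteq>movable \<gamma> ord - {t0}. \<exists>Pos. realizes \<gamma> ord
       (move_sign (movable \<gamma> ord) (if \<sigma> = 1 then insert t0 N else N)) \<rho> Pos (A N))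
     \<and> L = (\<Sum>N\<in>Pow (movable \<gamma> ord - {t0}).
              qd_scale ((-1) ^ card (movable \<gamma> ord - {t0} - N)) (diag (abs_arrow_diagram (A N)))))"
proof -
  obtain d0 where d0: "d0 > 0" "d0 \<le> 1"
    "\<And>t u t' u' m. crossing \<gamma> t t' \<Longrightarrow> crossing \<gamma> u u' \<Longrightarrow> t \<noteq> u \<Longrightarrow> \<bar>t - u - of_int m\<bar> \<ge> d0"
    using singular_doodle_gap[OF sd] by metis
  define d where "d = min d0 \<rho>"
  have d: "d > 0" "d \<le> 1" "d \<le> d0" and d\<rho>: "d \<le> \<rho>" using d0 \<rho> by (auto simp: d_def)
  have g: "\<bar>t - u - of_int m\<bar> \<ge> d" if "crossing \<gamma> t t'" "crossing \<gamma> u u'" "t \<noteq> u" for t u t' u' m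
    using d0(3)[OF that, of m] d(3) by linarith
  have "d / 4 > 0" using d(1) by simp
  from small_move[OF this] have "\<forall>\<^sub>F s in fl. \<exists>P Q :: real \<Rightarrow> real.
    (\<forall>k\<in>others. \<bar>P k - k\<bar> < d / 4 \<and> \<bar>Q k - t0\<bar> < d / 4
       \<and> sgn (P k - k) = sgn s * sgn (orient \<gamma> t0 k)
       \<and> sgn (orient (F s) (P k) (Q k)) = sgn (orient \<gamma> k t0))
    \<and> (\<forall>k\<in>others. \<forall>l\<in>others. Q k < Q l \<longleftrightarrow> sgn s * rel_cot k < sgn s * rel_cot l)
    \<and> (\<forall>u v. crossing (F s) u v \<longleftrightarrow> crossing \<gamma> u v \<and> u \<noteq> t0 \<and> v \<noteq> t0
       \<or> (\<exists>k\<in>others. (u, v) = (frac (P k), frac (Q k)) \<or> (u, v) = (frac (Q k), frac (P k))))"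
    using fil by (auto simp: eventually_at_split)
  moreover have "\<forall>\<^sub>F s in fl. sgn s = \<sigma>"
    using fil by (auto simp: eventually_at_filter)
  moreover have "fl \<noteq> bot" using fil by (metis trivial_limit_at_left_real trivial_limit_at_right_real)
  ultimately have "\<exists>s. (\<exists>P Q :: real \<Rightarrow> real.
    (\<forall>k\<in>others. \<bar>P k - k\<bar> < d / 4 \<and> \<bar>Q k - t0\<bar> < d / 4
       \<and> sgn (P k - k) = sgn s * sgn (orient \<gamma> t0 k)
       \<and> sgn (orient (F s) (P k) (Q k)) = sgn (orient \<gamma> k t0))
    \<and> (\<forall>k\<in>others. \<forall>l\<in>others. Q k < Q l \<longleftrightarrow> sgn s * rel_cot k < sgn s * rel_cot l)
    \<and> (\<forall>u v. crossing (F s) u v \<longleftrightarrow> crossing \<gamma> u v \<and> u \<noteq> t0 \<and> v \<noteq> t0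
       \<or> (\<exists>k\<in>others. (u, v) = (frac (P k), frac (Q k)) \<or> (u, v) = (frac (Q k), frac (P k)))))
    \<and> sgn s = \<sigma> \<and> (\<exists>ord'. keeps_order \<gamma> ord (\<gamma> t0) ord' \<and> singular_doodle (F s) ord' \<and> resolution_form (F s) ord' L)"
    using ev eventually_happens'[OF _ eventually_conj[OF _ eventually_conj]] by blast
  then obtain s P Q ord' where
    PQ1: "\<forall>k\<in>others. \<bar>P k - k\<bar> < d / 4 \<and> \<bar>Q k - t0\<bar> < d / 4
       \<and> sgn (P k - k) = sgn s * sgn (orient \<gamma> t0 k)
       \<and> sgn (orient (F s) (P k) (Q k)) = sgn (orient \<gamma> k t0)"
    and PQ2: "\<forall>k\<in>others. \<forall>l\<in>others. Q k < Q l \<longleftrightarrow> sgn s * rel_cot k < sgn s * rel_cot l"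
    and PQ3: "\<forall>u v. crossing (F s) u v \<longleftrightarrow> crossing \<gamma> u v \<and> u \<noteq> t0 \<and> v \<noteq> t0
       \<or> (\<exists>k\<in>others. (u, v) = (frac (P k), frac (Q k)) \<or> (u, v) = (frac (Q k), frac (P k)))"
    and s\<sigma>: "sgn s = \<sigma>" and o: "keeps_order \<gamma> ord (\<gamma> t0) ord'" "singular_doodle (F s) ord'" "resolution_form (F s) ord' L"
    by (elim exE conjE) (rule that)
  have s0: "s \<noteq> 0" and s_pos: "s > 0 \<longleftrightarrow> \<sigma> = 1" using s\<sigma> fil by (auto simp: sgn_if split: if_splits)
  interpret resolution_step \<gamma> t0 F a b c ord ord' s d P Q
  proof
    show "\<bar>t - u - of_int m\<bar> \<ge> d" if "crossing \<gamma> t t'" "crossing \<gamma> u u'" "t \<noteq> u" for t u t' u' m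
      by (rule g[OF that])
    show "crossing (F s) u v \<longleftrightarrow> crossing \<gamma> u v \<and> u \<noteq> t0 \<and> v \<noteq> t0
       \<or> (\<exists>k\<in>others. (u, v) = (frac (P k), frac (Q k)) \<or> (u, v) = (frac (Q k), frac (P k)))" for u v
      using PQ3 by blast
  qed (use sd sing t0_last o s0 d PQ1 PQ2 in simp_all)
  obtain d' where d': "d' > 0" "d' \<le> 1"
    "\<And>t u t' u' m. crossing (F s) t t' \<Longrightarrow> crossing (F s) u u' \<Longrightarrow> t \<noteq> u \<Longrightarrow> \<bar>t - u - of_int m\<bar> \<ge> d'"
    using singular_doodle_gap[OF o(2)] by metis
  \<comment> \<open>\<open>d'\<close> is a gap of the chosen \<open>F s\<close> and not known before
    \<open>s\<close> is, hence the need for \<open>resolution_form\<close> to cover every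
    tolerance.\<close>
  define \<rho>' where "\<rho>' = min (d / 4) (d' / 2)"
  have \<rho>': "\<rho>' > 0" "\<rho>' \<le> d / 4" "2 * \<rho>' \<le> d'" using d(1) d'(1) by (auto simp: \<rho>'_def min_def)
  have g': "\<bar>t - u - of_int m\<bar> \<ge> 2 * \<rho>'" if "crossing (F s) t t'" "crossing (F s) u u'" "t \<noteq> u" for t u t' u' m
    using d'(3)[OF that, of m] \<rho>'(3) by linarith
  obtain A where A: "\<And>N. N \<subseteq> movable (F s) ord' \<Longrightarrow> \<exists>Pos. realizes (F s) ord' (move_sign (movable (F s) ord') N) \<rho>' Pos (A N)"
    "L = (\<Sum>N\<in>Pow (movable (F s) ord'). qd_scale ((-1) ^ card (movable (F s) ord' - N)) (diag (abs_arrow_diagram (A N))))"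
    using o(3) \<rho>'(1) unfolding resolution_form_def by blast
  have "\<exists>Pos. realizes \<gamma> ord (move_sign (movable \<gamma> ord) (if \<sigma> = 1 then insert t0 N else N)) \<rho> Pos (A N)"
    if N: "N \<subseteq> movable \<gamma> ord - {t0}" for N
  proof -
    have "N \<subseteq> movable (F s) ord'" using N by (simp add: movable_step M_def)
    then obtain Pos' where P': "realizes (F s) ord' (move_sign (movable (F s) ord') N) \<rho>' Pos' (A N)" using A(1) by blast
    have N': "N \<subseteq> M - {t0}" using N by (simp add: M_def)
    have "\<exists>Pos. realizes \<gamma> ord (move_sign M (if s > 0 then insert t0 N else N)) (d / 2) Pos (A N)"
      by (rule realizes_step[OF N' refl \<rho>'(1,2) g' P'])
    then obtain Pos where "realizes \<gamma> ord (move_sign M (if \<sigma> = 1 then insert t0 N else N)) (d / 2) Pos (A N)"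
      unfolding s_pos by blast
    moreover have "d / 2 \<le> \<rho>" using d(1) d\<rho> by linarith
    ultimately show ?thesis using realizes_mono unfolding M_def by blast
  qed
  then show ?thesis using A(2) t0_in_M unfolding movable_step unfolding M_def by blast
qed

section \<open>Induction over the one-step resolutions\<close>

lemma complete_resolution_singular_doodle: "complete_resolution \<gamma> ord L \<Longrightarrow> singular_doodle \<gamma> ord"
  by (erule complete_resolution.cases) simp_all

text \<open>The subsets that contain the moved branch \<open>t0\<close> come from the positive side
  and the others from the negative side, where one more branch lies outside the subset; this
  accounts for the minus sign between the two terms.\<close>

lemma resolution_form_complete_resolution:
  "complete_resolution \<gamma> ord L \<Longrightarrow> resolution_form \<gamma> ord L"
proof (induction rule: complete_resolution.induct)
  case (nonsingular \<gamma> ord)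
  then show ?case by (rule resolution_form_nonsingular)
next
  case (one_step \<gamma> ord x F L1 L2)
  define t0 where "t0 = last (ord x)"
  have self: "x \<in> self_intersections \<gamma>" using one_step.hyps(2) by (simp add: singular_points_def)
  then have ox: "distinct (ord x)" "set (ord x) = branches \<gamma> x" using one_step.hyps(1) by (auto simp: singular_doodle_def)
  have "ord x \<noteq> []" using singular_doodle_card[OF one_step.hyps(1) self] by auto
  then have "t0 \<in> branches \<gamma> x" using ox(2) last_in_set t0_def by metis
  then have t0: "t0 \<in> {0..<1}" and x: "\<gamma> t0 = x" by (auto simp: branches_def)
  obtain a b c where "branch_move \<gamma> t0 F a b c"
    using moves_branch_locale[OF one_step.hyps(1) _ t0] one_step.hyps(3) unfolding t0_def by blast
  then interpret branch_move \<gamma> t0 F a b c .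
  have t0l: "t0 = last (ord (\<gamma> t0))" unfolding x by (rule t0_def)
  have sing: "\<gamma> t0 \<in> singular_points \<gamma>" using one_step.hyps(2) by (simp add: x)
  have ev1: "\<forall>\<^sub>F s in at_right 0. \<exists>ord'. keeps_order \<gamma> ord (\<gamma> t0) ord' \<and> singular_doodle (F s) ord' \<and> resolution_form (F s) ord' L1"
    using one_step.IH(1) by (rule eventually_mono) (auto simp: x dest: complete_resolution_singular_doodle)
  have ev2: "\<forall>\<^sub>F s in at_left 0. \<exists>ord'. keeps_order \<gamma> ord (\<gamma> t0) ord' \<and> singular_doodle (F s) ord' \<and> resolution_form (F s) ord' L2"
    using one_step.IH(2) by (rule eventually_mono) (auto simp: x dest: complete_resolution_singular_doodle)
  define M where "M = movable \<gamma> ord"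
  show ?case unfolding resolution_form_def M_def[symmetric]
  proof (intro allI impI)
    fix \<rho> :: real assume \<rho>: "\<rho> > 0"
    obtain A1 where t0M: "t0 \<in> M" and A1: "\<And>N. N \<subseteq> M - {t0} \<Longrightarrow> \<exists>Pos. realizes \<gamma> ord (move_sign M (insert t0 N)) \<rho> Pos (A1 N)"
      "L1 = (\<Sum>N\<in>Pow (M - {t0}). qd_scale ((-1) ^ card (M - {t0} - N)) (diag (abs_arrow_diagram (A1 N))))"
      using resolution_step_form[OF one_step.hyps(1) sing t0l _ ev1 \<rho>, of 1] unfolding M_def by auto
    obtain A2 where A2: "\<And>N. N \<subseteq> M - {t0} \<Longrightarrow> \<exists>Pos. realizes \<gamma> ord (move_sign M N) \<rho> Pos (A2 N)"
      "L2 = (\<Sum>N\<in>Pow (M - {t0}). qd_scale ((-1) ^ card (M - {t0} - N)) (diag (abs_arrow_diagram (A2 N))))"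
      using resolution_step_form[OF one_step.hyps(1) sing t0l _ ev2 \<rho>, of "-1"] unfolding M_def by auto
    define A where "A N = (if t0 \<in> N then A1 (N - {t0}) else A2 N)" for N
    have finM: "finite M"
      by (rule finite_subset[OF _ fin]) (auto simp: M_def movable_def)
    have r: "\<exists>Pos. realizes \<gamma> ord (move_sign M N) \<rho> Pos (A N)" if "N \<subseteq> M" for N
    proof (cases "t0 \<in> N")
      case True
      then have "insert t0 (N - {t0}) = N" by blast
      moreover have "N - {t0} \<subseteq> M - {t0}" using that by blast
      ultimately show ?thesis using A1(1)[of "N - {t0}"] True by (simp add: A_def)
    next
      case False
      then have "N \<subseteq> M - {t0}" using that by blast
      then show ?thesis using A2(1)[of N] False by (simp add: A_def)
    qed
    define g where "g N = qd_scale ((-1) ^ card (M - N)) (diag (abs_arrow_diagram (A N)))" for N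
    have "(\<Sum>N\<in>Pow M. g N) = (\<Sum>N\<in>Pow (M - {t0}). g N) + (\<Sum>N\<in>insert t0 ` Pow (M - {t0}). g N)"
    proof -
      have "Pow M = Pow (M - {t0}) \<union> insert t0 ` Pow (M - {t0})"
        using Pow_insert[of t0 "M - {t0}"] t0M by (simp add: insert_absorb)
      moreover have "Pow (M - {t0}) \<inter> insert t0 ` Pow (M - {t0}) = {}" by auto
      ultimately show ?thesis using finM by (simp add: sum.union_disjoint)
    qed
    also have "(\<Sum>N\<in>insert t0 ` Pow (M - {t0}). g N) = (\<Sum>N\<in>Pow (M - {t0}). g (insert t0 N))"
    proof (rule sum.reindex_cong[of "insert t0"])
      show "inj_on (insert t0) (Pow (M - {t0}))" by (auto simp: inj_on_def)
    qed auto
    also have "\<dots> = L1"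
      unfolding A1(2)
    proof (rule sum.cong[OF refl])
      fix N assume N: "N \<in> Pow (M - {t0})"
      then have "insert t0 N - {t0} = N" "M - insert t0 N = M - {t0} - N" by auto
      then show "g (insert t0 N) = qd_scale ((-1) ^ card (M - {t0} - N)) (diag (abs_arrow_diagram (A1 N)))"
        by (simp add: g_def A_def)
    qed
    also have "(\<Sum>N\<in>Pow (M - {t0}). g N) = (\<Sum>N\<in>Pow (M - {t0}). - qd_scale ((-1) ^ card (M - {t0} - N)) (diag (abs_arrow_diagram (A2 N))))"
    proof (rule sum.cong[OF refl])
      fix N assume N: "N \<in> Pow (M - {t0})"
      then have nt: "t0 \<notin> N" and i: "M - N = insert t0 (M - {t0} - N)" using t0M by auto
      have "card (M - N) = Suc (card (M - {t0} - N))"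
        unfolding i using finM by (subst card_insert_disjoint) auto
      then show "g N = - qd_scale ((-1) ^ card (M - {t0} - N)) (diag (abs_arrow_diagram (A2 N)))"
        using nt by (simp add: g_def A_def QD.scale_minus_left)
    qed
    also have "\<dots> = - L2" unfolding A2(2) by (rule sum_negf)
    finally have "L1 - L2 = (\<Sum>N\<in>Pow M. g N)" by simp
    then show "\<exists>A. (\<forall>N\<subseteq>M. \<exists>Pos. realizes \<gamma> ord (move_sign M N) \<rho> Pos (A N))
      \<and> L1 - L2 = (\<Sum>N\<in>Pow M. qd_scale ((-1) ^ card (M - N)) (diag (abs_arrow_diagram (A N))))"
      using r unfolding g_def by blast
  qed
qed


section \<open>Cancellation\<close>

lemma map_prod_circle_map_place:
  assumes \<phi>: "circle_diffeo \<phi>" and "\<phi> (Pos t u) = Pos' t u" "\<phi> (Pos u t) = Pos' u t"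
  shows "map_prod (circle_map \<phi>) (circle_map \<phi>) (place Pos (t, u)) = place Pos' (t, u)"
proof -
  have *: "circle_map \<phi> (frac y) = frac (\<phi> y)" for y
  proof -
    have "\<phi> (frac y) = \<phi> y + of_int (- \<lfloor>y\<rfloor>)"
      using circle_diffeo_add_int[OF \<phi>, of y "- \<lfloor>y\<rfloor>"] by (simp add: frac_def)
    then show ?thesis by (simp add: circle_map_def frac_def)
  qed
  show ?thesis using assms by (simp add: place_def *)
qed

text \<open>Positions near different branches are ordered by the branches themselves, positions near
  the same branch by their keys. Equal keys on the endpoints of \<open>S\<close> therefore give the
  same cyclic order, and interpolation yields the diffeomorphism. The two full diagrams may well
  differ outside \<open>S\<close>.\<close>

lemma place_equiv:
  assumes sd: "singular_doodle \<gamma> ord"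
    and gap: "\<And>t u t' u' m. crossing \<gamma> t t' \<Longrightarrow> crossing \<gamma> u u' \<Longrightarrow> t \<noteq> u \<Longrightarrow> \<bar>t - u - of_int m\<bar> \<ge> d"
    and d: "d \<le> 1" and R: "realizes \<gamma> ord \<epsilon> (d / 4) Pos A" "realizes \<gamma> ord \<epsilon>' (d / 4) Pos' A'"
    and S: "S \<subseteq> arrows \<gamma>"
    and key: "\<And>t u. (t, u) \<in> S \<or> (u, t) \<in> S \<Longrightarrow> key \<gamma> ord \<epsilon> t u = key \<gamma> ord \<epsilon>' t u"
  shows "symb (place Pos ` S) = symb (place Pos' ` S)"
proof -
  \<comment> \<open>Each arrow contributes both orders of its pair, one for each endpoint.\<close>
  define I where "I = {(t, u). (t, u) \<in> S \<or> (u, t) \<in> S}"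
  have cr: "crossing \<gamma> t u" if "(t, u) \<in> I" for t u
    using that S crossing_sym by (auto simp: I_def arrows_iff)
  have fin: "finite I"
  proof (rule finite_subset)
    show "I \<subseteq> {s. \<exists>t. crossing \<gamma> s t} \<times> {s. \<exists>t. crossing \<gamma> s t}"
    proof clarify
      fix t u assume "(t, u) \<in> I"
      then have "crossing \<gamma> t u" "crossing \<gamma> u t" using cr crossing_sym by blast+
      then show "t \<in> {s. \<exists>t. crossing \<gamma> s t} \<and> u \<in> {s. \<exists>t. crossing \<gamma> s t}" by blast
    qed
  qed (use singular_doodle_finite[OF sd] in blast)
  have "case_prod Pos i < case_prod Pos j + of_int k \<longleftrightarrow> case_prod Pos' i < case_prod Pos' j + of_int k"
    if ij: "i \<in> I" "j \<in> I" for i j k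
  proof -
    obtain t u t' u' where [simp]: "i = (t, u)" "j = (t', u')" by (cases i, cases j)
    have c: "crossing \<gamma> t u" "crossing \<gamma> t' u'" using ij cr by auto
    have n: "\<bar>Pos t u - t\<bar> < d / 4" "\<bar>Pos t' u' - t'\<bar> < d / 4" "\<bar>Pos' t u - t\<bar> < d / 4" "\<bar>Pos' t' u' - t'\<bar> < d / 4"
      using R c by (auto simp: realizes_def)
    show ?thesis
    proof (cases "t = t'")
      case False
      from gap[OF c False, of k] have "t - t' - of_int k \<ge> d \<or> t - t' - of_int k \<le> - d" by linarith
      then show ?thesis
      proof
        assume "t - t' - of_int k \<ge> d"
        then have "\<not> Pos t u < Pos t' u' + of_int k" "\<not> Pos' t u < Pos' t' u' + of_int k" using n by linarith+
        then show ?thesis by simp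
      next
        assume "t - t' - of_int k \<le> - d"
        then have "Pos t u < Pos t' u' + of_int k" "Pos' t u < Pos' t' u' + of_int k" using n by linarith+
        then show ?thesis by simp
      qed
    next
      case True
      consider "k = 0" | "k \<ge> 1" | "k \<le> -1" by linarith
      then show ?thesis
      proof cases
        case 1
        have "key \<gamma> ord \<epsilon> t u = key \<gamma> ord \<epsilon>' t u" "key \<gamma> ord \<epsilon> t u' = key \<gamma> ord \<epsilon>' t u'"
          using ij True by (auto intro!: key simp: I_def)
        then show ?thesis using R c True 1 by (simp add: realizes_def)
      next
        case 2
        then have "(of_int k :: real) \<ge> 1" by simp
        then have "Pos t u < Pos t' u' + of_int k" "Pos' t u < Pos' t' u' + of_int k" using n d True by linarith+
        then show ?thesis by simp
      next
        case 3
        then have "(of_int k :: real) \<le> -1" by simp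
        then have "\<not> Pos t u < Pos t' u' + of_int k" "\<not> Pos' t u < Pos' t' u' + of_int k" using n d True by linarith+
        then show ?thesis by simp
      qed
    qed
  qed
  then have "\<exists>\<phi>. circle_diffeo \<phi> \<and> (\<forall>i\<in>I. \<phi> (case_prod Pos i) = case_prod Pos' i)"
    by (rule circle_diffeo_interpolation[OF fin])
  then obtain \<phi> where
    \<phi>: "circle_diffeo \<phi>" "\<And>i. i \<in> I \<Longrightarrow> \<phi> (case_prod Pos i) = case_prod Pos' i" by blast
  have "map_prod (circle_map \<phi>) (circle_map \<phi>) (place Pos e) = place Pos' e" if e: "e \<in> S" for e
  proof -
    obtain t u where [simp]: "e = (t, u)" by (cases e)
    have "(t, u) \<in> I" "(u, t) \<in> I" using e by (auto simp: I_def)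
    then show ?thesis using \<phi>(2)[of "(t, u)"] \<phi>(2)[of "(u, t)"] map_prod_circle_map_place[OF \<phi>(1)] by simp
  qed
  then have im: "place Pos' ` S = map_prod (circle_map \<phi>) (circle_map \<phi>) ` (place Pos ` S)"
    by (force simp: image_image)
  have "place Pos ` S \<subseteq> A" "place Pos' ` S \<subseteq> A'" "is_arrow_diagram A" "is_arrow_diagram A'"
    using R S by (auto simp: realizes_def bij_betw_def)
  then have "is_arrow_diagram (place Pos ` S)" "is_arrow_diagram (place Pos' ` S)"
    using is_arrow_diagram_subset by blast+
  then have "arrow_equiv (place Pos ` S) (place Pos' ` S)"
    using \<phi>(1) im unfolding arrow_equiv_def by blast
  then show ?thesis unfolding symb_def by (simp only: abs_arrow_diagram_eqI)
qed

text \<open>The terms of \<open>N\<close> and \<open>insert t N\<close> have the same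
  \<open>g\<close> and opposite signs.\<close>

lemma sum_Pow_cancel:
  fixes g :: "real set \<Rightarrow> alg"
  assumes "finite M" "t \<in> M" and eq: "\<And>N. N \<subseteq> M - {t} \<Longrightarrow> g (insert t N) = g N"
  shows "(\<Sum>N\<in>Pow M. alg_scale ((-1) ^ card (M - N)) (g N)) = 0"
proof -
  let ?f = "\<lambda>N. alg_scale ((-1) ^ card (M - N)) (g N)"
  have "Pow M = Pow (M - {t}) \<union> insert t ` Pow (M - {t})"
    using Pow_insert[of t "M - {t}"] assms(2) by (simp add: insert_absorb)
  moreover have "Pow (M - {t}) \<inter> insert t ` Pow (M - {t}) = {}" by auto
  ultimately have "sum ?f (Pow M) = sum ?f (Pow (M - {t})) + sum ?f (insert t ` Pow (M - {t}))"
    using assms(1) by (simp add: sum.union_disjoint)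
  also have "sum ?f (insert t ` Pow (M - {t})) = (\<Sum>N\<in>Pow (M - {t}). ?f (insert t N))"
    by (rule sum.reindex_cong[of "insert t"]) (auto simp: inj_on_def)
  also have "\<dots> = (\<Sum>N\<in>Pow (M - {t}). - ?f N)"
  proof (rule sum.cong[OF refl])
    fix N assume N: "N \<in> Pow (M - {t})"
    then have i: "M - N = insert t (M - insert t N)" using assms(2) by auto
    have "card (M - N) = Suc (card (M - insert t N))"
      by (subst i) (use assms(1) in \<open>simp add: card_insert_disjoint\<close>)
    then show "?f (insert t N) = - ?f N" using eq N by (simp add: Alg.scale_minus_left)
  qed
  finally show ?thesis by (simp add: sum_negf)
qed

text \<open>Through the positions, the subsets of the one set \<open>arrows \<gamma>\<close> index
  the subdiagrams of all the resolutions. This allows the sums over \<open>N\<close> and over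
  \<open>S\<close> to be exchanged and each \<open>S\<close> to be treated by itself.\<close>

lemma resolution_form_filt:
  assumes sd: "singular_doodle \<gamma> ord" and L: "resolution_form \<gamma> ord L"
  shows "I_alg L \<in> filt (card (movable \<gamma> ord))"
proof -
  define M where "M = movable \<gamma> ord"
  have finK: "finite {s. \<exists>t. crossing \<gamma> s t}" by (rule singular_doodle_finite[OF sd])
  have finM: "finite M" by (rule finite_subset[OF _ finK]) (auto simp: M_def movable_def)
  obtain d where d: "d > 0" "d \<le> 1"
    "\<And>t u t' u' m. crossing \<gamma> t t' \<Longrightarrow> crossing \<gamma> u u' \<Longrightarrow> t \<noteq> u \<Longrightarrow> \<bar>t - u - of_int m\<bar> \<ge> d"
    by (rule singular_doodle_gap[OF sd]) blast
  have d4: "d / 4 > 0" using d(1) by simp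
  then obtain A where A: "\<And>N. N \<subseteq> M \<Longrightarrow> \<exists>Pos. realizes \<gamma> ord (move_sign M N) (d / 4) Pos (A N)"
    "L = (\<Sum>N\<in>Pow M. qd_scale ((-1) ^ card (M - N)) (diag (abs_arrow_diagram (A N))))"
    using L unfolding resolution_form_def M_def by blast
  then obtain Pos where Pos: "\<And>N. N \<subseteq> M \<Longrightarrow> realizes \<gamma> ord (move_sign M N) (d / 4) (Pos N) (A N)" by metis
  have finA: "finite (arrows \<gamma>)" by (rule finite_arrows[OF finK])
  have inj: "inj_on (place (Pos N)) (arrows \<gamma>)" "place (Pos N) ` arrows \<gamma> = A N" "is_arrow_diagram (A N)"
    if "N \<subseteq> M" for N
    using Pos[OF that] by (auto simp: realizes_def bij_betw_def)
  have "I_alg L = (\<Sum>N\<in>Pow M. alg_scale ((-1) ^ card (M - N)) (\<Sum>S\<in>Pow (arrows \<gamma>). symb (place (Pos N) ` S)))"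
  proof (unfold A(2) I_alg_sum I_alg_scale, rule sum.cong[OF refl])
    fix N assume "N \<in> Pow M"
    then have N: "N \<subseteq> M" by simp
    have "I_alg (diag (abs_arrow_diagram (A N))) = (\<Sum>S\<in>Pow (A N). symb S)"
      by (rule I_alg_diag[OF inj(3)[OF N]])
    also have "Pow (A N) = (`) (place (Pos N)) ` Pow (arrows \<gamma>)"
      using inj(2)[OF N] by (simp add: image_Pow_surj)
    also have "(\<Sum>S\<in>\<dots>. symb S) = (\<Sum>S\<in>Pow (arrows \<gamma>). symb (place (Pos N) ` S))"
      by (subst sum.reindex) (auto simp: inj_on_image_Pow[OF inj(1)[OF N]])
    finally show "alg_scale ((-1) ^ card (M - N)) (I_alg (diag (abs_arrow_diagram (A N))))
      = alg_scale ((-1) ^ card (M - N)) (\<Sum>S\<in>Pow (arrows \<gamma>). symb (place (Pos N) ` S))" by simp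
  qed
  also have "\<dots> = (\<Sum>S\<in>Pow (arrows \<gamma>). \<Sum>N\<in>Pow M. alg_scale ((-1) ^ card (M - N)) (symb (place (Pos N) ` S)))"
    unfolding Alg.scale_sum_right by (rule sum.swap)
  also have "\<dots> \<in> filt (card M)"
  proof (rule Alg.subspace_sum[OF subspace_filt])
    fix S assume "S \<in> Pow (arrows \<gamma>)"
    then have S: "S \<subseteq> arrows \<gamma>" by simp
    have low: "crossing \<gamma> t u" "\<gamma> u = \<gamma> t" if "(t, u) \<in> S \<or> (u, t) \<in> S" for t u
      using that S crossing_sym by (auto simp: arrows_iff crossing_def)
    show "(\<Sum>N\<in>Pow M. alg_scale ((-1) ^ card (M - N)) (symb (place (Pos N) ` S))) \<in> filt (card M)"
    proof (cases "\<exists>t\<in>M. \<forall>u. (t, u) \<in> S \<or> (u, t) \<in> S \<longrightarrow> idx (ord (\<gamma> t)) t < idx (ord (\<gamma> t)) u")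
      case True
      then obtain t where t: "t \<in> M" "\<And>u. (t, u) \<in> S \<or> (u, t) \<in> S \<Longrightarrow> idx (ord (\<gamma> t)) t < idx (ord (\<gamma> t)) u" by blast
      have "(\<Sum>N\<in>Pow M. alg_scale ((-1) ^ card (M - N)) (symb (place (Pos N) ` S))) = 0"
      proof (rule sum_Pow_cancel[OF finM t(1)])
        fix N assume N: "N \<subseteq> M - {t}"
        then have NM: "insert t N \<subseteq> M" "N \<subseteq> M" using t(1) by auto
        show "symb (place (Pos (insert t N)) ` S) = symb (place (Pos N) ` S)"
        proof (rule place_equiv[OF sd d(3) d(2) Pos[OF NM(1)] Pos[OF NM(2)] S])
          \<comment> \<open>The key of \<open>v\<close> and \<open>w\<close> refers to the sign at
            the later of the two, and by the choice of \<open>t\<close> this is never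
            \<open>t\<close>.\<close>
          fix v w assume vw: "(v, w) \<in> S \<or> (w, v) \<in> S"
          have e: "move_sign M (insert t N) y = move_sign M N y" if "y \<noteq> t" for y
            using that by (simp add: move_sign_def)
          show "key \<gamma> ord (move_sign M (insert t N)) v w = key \<gamma> ord (move_sign M N) v w"
          proof (cases "idx (ord (\<gamma> v)) v < idx (ord (\<gamma> v)) w")
            case True
            have "w \<noteq> t" using t(2)[of v] vw True low(2)[OF vw] by auto
            then show ?thesis using True e by (simp add: key_def)
          next
            case False
            then have "v \<noteq> t" using t(2)[of w] vw by auto
            then show ?thesis using False e by (simp add: key_def)
          qed
        qed
      qed
      then show ?thesis using Alg.subspace_0[OF subspace_filt] by simp
    next
      case False
      \<comment> \<open>Each arrow has a single later branch. Without cancellation every movable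
        branch is the later one of some arrow, so this map bounds \<open>card M\<close> by
        \<open>card S\<close>.\<close>
      define hi where "hi = (\<lambda>(t, u). if idx (ord (\<gamma> t)) t < idx (ord (\<gamma> t)) u then u else t)"
      have "M \<subseteq> hi ` S"
      proof
        fix t assume "t \<in> M"
        then obtain u where u: "(t, u) \<in> S \<or> (u, t) \<in> S" and i: "\<not> idx (ord (\<gamma> t)) t < idx (ord (\<gamma> t)) u"
          using False by blast
        note l = low[OF u]
        have "idx (ord (\<gamma> t)) t \<noteq> idx (ord (\<gamma> t)) u"
          using idx_inj[OF singular_doodle_ord(3,4)[OF sd l(1)]] l(1) by (auto simp: crossing_def)
        then have "hi (t, u) = t" "hi (u, t) = t" using i l(2) by (auto simp: hi_def)
        then show "t \<in> hi ` S" using u by (metis image_eqI)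
      qed
      then have "card M \<le> card S" using finite_subset[OF S finA] by (rule surj_card_le[rotated])
      moreover have "card (place (Pos N) ` S) = card S" "is_arrow_diagram (place (Pos N) ` S)" if "N \<subseteq> M" for N
      proof -
        show "card (place (Pos N) ` S) = card S" using inj(1)[OF that] S by (meson card_image inj_on_subset)
        have "place (Pos N) ` S \<subseteq> A N" using inj(2)[OF that] S by blast
        then show "is_arrow_diagram (place (Pos N) ` S)" using is_arrow_diagram_subset[OF inj(3)[OF that]] by blast
      qed
      ultimately show ?thesis
        by (intro Alg.subspace_sum[OF subspace_filt] Alg.subspace_scale[OF subspace_filt] symb_in_filt) auto
    qed
  qed
  finally show ?thesis by (simp add: M_def)
qed

lemma complexity_le_movable:
  assumes sd: "singular_doodle \<gamma> ord"
  shows "complexity \<gamma> \<le> 2 * card (movable \<gamma> ord)"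
proof -
  define X where "X = singular_points \<gamma>"
  define T where "T x = {t \<in> set (ord x). 2 \<le> idx (ord x) t}" for x
  have self: "x \<in> self_intersections \<gamma>" "3 \<le> card (branches \<gamma> x)" if "x \<in> X" for x
    using that by (auto simp: X_def singular_points_def)
  have finX: "finite X"
    using sd by (auto simp: X_def singular_points_def singular_doodle_def)
  have o: "distinct (ord x)" "set (ord x) = branches \<gamma> x" if "x \<in> X" for x
    using sd self(1)[OF that] by (auto simp: singular_doodle_def)
  have sub: "(\<Union>x\<in>X. T x) \<subseteq> movable \<gamma> ord"
  proof
    fix t assume "t \<in> (\<Union>x\<in>X. T x)"
    then obtain x where x: "x \<in> X" "t \<in> set (ord x)" "2 \<le> idx (ord x) t" by (auto simp: T_def)
    then have tb: "t \<in> branches \<gamma> x" using o by blast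
    obtain u v where "u \<in> branches \<gamma> x" "v \<in> branches \<gamma> x" "u \<noteq> v"
      using self(1)[OF x(1)] by (auto simp: self_intersections_def)
    then have "crossing \<gamma> t u \<or> crossing \<gamma> t v" using tb by (auto simp: branches_def crossing_def)
    moreover have "\<gamma> t = x" using tb by (simp add: branches_def)
    ultimately show "t \<in> movable \<gamma> ord" using x(3) by (auto simp: movable_def)
  qed
  have finM: "finite (movable \<gamma> ord)"
    by (rule finite_subset[OF _ singular_doodle_finite[OF sd]]) (auto simp: movable_def)
  \<comment> \<open>A parameter determines its image, so different points have different
    branches.\<close>
  have dis: "T x \<inter> T y = {}" if "x \<in> X" "y \<in> X" "x \<noteq> y" for x y
  proof -
    have "T x \<subseteq> branches \<gamma> x" "T y \<subseteq> branches \<gamma> y" using o that by (auto simp: T_def)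
    then show ?thesis using that(3) by (auto simp: branches_def)
  qed
  have "complexity \<gamma> = (\<Sum>x\<in>X. card (branches \<gamma> x) - 1)" by (simp add: complexity_def X_def)
  also have "\<dots> \<le> (\<Sum>x\<in>X. 2 * card (T x))"
  proof (rule sum_mono)
    fix x assume x: "x \<in> X"
    have "card (T x) = card (branches \<gamma> x) - 2"
      unfolding T_def using card_idx_ge_2[OF o(1)[OF x]] singular_doodle_card(1)[OF sd self(1)[OF x]] by simp
    then show "card (branches \<gamma> x) - 1 \<le> 2 * card (T x)" using self(2)[OF x] by linarith
  qed
  also have "\<dots> = 2 * card (\<Union>x\<in>X. T x)"
    using dis finX by (subst card_UN_disjoint) (auto simp: T_def sum_distrib_left)
  also have "\<dots> \<le> 2 * card (movable \<gamma> ord)" using card_mono[OF finM sub] by simp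
  finally show ?thesis .
qed

theorem corollary2p4:
  fixes n :: nat and \<sigma> :: "nat \<Rightarrow> alg set \<Rightarrow> alg set \<times> alg set"
  assumes "linear_splitting \<sigma>"
  shows "finite_type_invariant (filt (Suc n)) (V_space n) (2 * n) (\<lambda>x. split_iso \<sigma> (I_bar x) n)"
  unfolding finite_type_invariant_def doodle_invariant_def
proof (intro conjI allI impI)
  show "linear_map_into (filt (Suc n)) (V_space n) (\<lambda>x. split_iso \<sigma> (I_bar x) n)"
    by (rule split_iso_linear_map[OF assms])
next
  fix \<gamma> \<delta> assume "doodle \<gamma> \<and> doodle \<delta> \<and> doodle_equiv \<gamma> \<delta>"
  then show "split_iso \<sigma> (I_bar (diag (diagram_of \<gamma>))) n = split_iso \<sigma> (I_bar (diag (diagram_of \<delta>))) n"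
    by (intro split_iso_cong doodle_equiv_I_alg) simp
next
  fix \<gamma> ord L assume *: "singular_doodle \<gamma> ord \<and> 2 * n < complexity \<gamma> \<and> complete_resolution \<gamma> ord L"
  then have "Suc n \<le> card (movable \<gamma> ord)" using complexity_le_movable[of \<gamma> ord] by linarith
  moreover have "I_alg L \<in> filt (card (movable \<gamma> ord))"
    using * resolution_form_filt resolution_form_complete_resolution by blast
  ultimately have "I_alg L \<in> filt (Suc n)" using filt_mono by blast
  then show "split_iso \<sigma> (I_bar L) n = filt (Suc n)" by (rule split_iso_eq_0[OF assms])
qed

end
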